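(* Let $X$ be a separable complex Banach space, $T$ a bounded linear operator on $X$, $\Omega\subset\mathbb{C}$ a bounded open set containing $\sigma(T)$, and $f\colon\Omega\to\mathbb{C}$ an analytic function that is not constant on any connected component of $\Omega$. (1) If the eigenspaces of $T$ form an unconditional basis, then the eigenspaces of $f(T)$ also form an unconditional basis. (2) If $f'\ne 0$ on $\sigma(T)$ and the eigenspaces of $f(T)$ form an unconditional basis, then the eigenspaces of $T$ form an unconditional basis.
   Context: $f(T)$ is defined by the Riesz--Dunford functional calculus. For a bounded operator $A$ on $X$, $\sigma_p(A)$ is its point spectrum, and the eigenspaces of $A$ are the spaces $\ker(A-\lambda)$, $\lambda\in\sigma_p(A)$. A countable family $\{X_\alpha\}_{\alpha\in A}$ of linearly independent subspaces of $X$ is an unconditional basis in $X$ if it is complete in $X$ (its linear span is dense in $X$) and there is a constant $C>0$ such that $\big\|\sum_{\alpha\in F_1}x_\alpha\big\|\le C\big\|\sum_{\alpha\in F_2}x_\alpha\big\|$ for all finite subsets $F_1\subset F_2$ of $A$ and all $x_\alpha\in X_\alpha$. Saying that the eigenspaces of an operator form an unconditional basis includes the requirement that its point spectrum is countable; the family in question is that of the eigenspaces for all eigenvalues. *)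

theory Defs
  imports "HOL-Complex_Analysis.Complex_Analysis"
begin

section \<open>Complex Banach spaces\<close>

class complex_normed_vector = real_normed_vector +
  fixes scaleC :: "complex \<Rightarrow> 'a \<Rightarrow> 'a"  (infixr \<open>*\<^sub>C\<close> 75)
  assumes scaleC_add_right: "c *\<^sub>C (x + y) = c *\<^sub>C x + c *\<^sub>C y"
    and scaleC_add_left: "(c + d) *\<^sub>C x = c *\<^sub>C x + d *\<^sub>C x"
    and scaleC_scaleC: "c *\<^sub>C d *\<^sub>C x = (c * d) *\<^sub>C x"
    and scaleC_of_real: "complex_of_real r *\<^sub>C x = r *\<^sub>R x"
    and norm_scaleC: "norm (c *\<^sub>C x) = cmod c * norm x"

class complex_banach = complex_normed_vector + banach

lemma scaleC_one: "1 *\<^sub>C (x :: 'a::complex_normed_vector) = x"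
  using scaleC_of_real[of 1 x] by simp

global_interpretation complex_vector:
  vector_space "scaleC :: complex \<Rightarrow> 'a \<Rightarrow> 'a::complex_normed_vector"
  by unfold_locales (simp_all add: scaleC_add_right scaleC_add_left scaleC_scaleC scaleC_one)

lemma bounded_linear_scaleC:
  "bounded_linear (\<lambda>x :: 'a::complex_normed_vector. c *\<^sub>C x)"
proof (rule bounded_linear_intro[where K = "cmod c"])
  show "c *\<^sub>C r *\<^sub>R x = r *\<^sub>R c *\<^sub>C x" for r and x :: 'a
    unfolding scaleC_of_real[symmetric] by (simp add: scaleC_scaleC mult.commute)
qed (simp_all add: scaleC_add_right norm_scaleC mult.commute)

instantiation complex :: complex_banach
begin

definition scaleC_complex :: "complex \<Rightarrow> complex \<Rightarrow> complex"
  where "scaleC_complex = (*)"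

instance
  by standard (simp_all add: scaleC_complex_def algebra_simps norm_mult scaleR_conv_of_real)

end

instantiation blinfun :: (real_normed_vector, complex_normed_vector) complex_normed_vector
begin

lift_definition scaleC_blinfun :: "complex \<Rightarrow> 'a \<Rightarrow>\<^sub>L 'b \<Rightarrow> 'a \<Rightarrow>\<^sub>L 'b"
  is "\<lambda>c f x. c *\<^sub>C f x"
  by (rule bounded_linear_compose[OF bounded_linear_scaleC])

instance
proof
  fix c d :: complex and r :: real and S T :: "'a \<Rightarrow>\<^sub>L 'b"
  show "c *\<^sub>C (S + T) = c *\<^sub>C S + c *\<^sub>C T"
    by transfer (simp add: scaleC_add_right)
  show "(c + d) *\<^sub>C T = c *\<^sub>C T + d *\<^sub>C T"
    by transfer (simp add: scaleC_add_left)
  show "c *\<^sub>C d *\<^sub>C T = (c * d) *\<^sub>C T"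
    by transfer (simp add: scaleC_scaleC)
  show "complex_of_real r *\<^sub>C T = r *\<^sub>R T"
    by transfer (simp add: scaleC_of_real)
  have le: "norm (a *\<^sub>C U) \<le> cmod a * norm U" for a and U :: "'a \<Rightarrow>\<^sub>L 'b"
  proof (rule norm_blinfun_bound)
    show "norm (blinfun_apply (a *\<^sub>C U) x) \<le> cmod a * norm U * norm x" for x
      using mult_left_mono[OF norm_blinfun[of U x], of "cmod a"]
      by (simp add: scaleC_blinfun.rep_eq norm_scaleC mult.assoc)
  qed simp
  show "norm (c *\<^sub>C T) = cmod c * norm T"
  proof (cases "c = 0")
    case True
    then show ?thesis using le[of c T] by simp
  next
    case False
    have "inverse c *\<^sub>C c *\<^sub>C T = T"
      using False by transfer (simp add: scaleC_scaleC scaleC_one)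
    then have "norm T \<le> inverse (cmod c) * norm (c *\<^sub>C T)"
      using le[of "inverse c" "c *\<^sub>C T"] by (simp add: norm_inverse)
    then have "cmod c * norm T \<le> norm (c *\<^sub>C T)"
      using False by (simp add: field_simps)
    with le[of c T] show ?thesis by simp
  qed
qed

end

instance blinfun :: (real_normed_vector, complex_banach) complex_banach ..

section \<open>Spectrum and eigenspaces\<close>

text \<open>
  The type \<open>'a \<Rightarrow>\<^sub>L 'a\<close> consists of the bounded \<^emph>\<open>real\<close>-linear operators.  A bounded operator
  on a complex Banach space is an element of it that satisfies the following predicate.
\<close>

definition complex_linear_op :: "('a::complex_normed_vector \<Rightarrow>\<^sub>L 'a) \<Rightarrow> bool"
  where "complex_linear_op T \<longleftrightarrow> (\<forall>c x. blinfun_apply T (c *\<^sub>C x) = c *\<^sub>C blinfun_apply T x)"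

definition is_inverse_op :: "('a::complex_normed_vector \<Rightarrow>\<^sub>L 'a) \<Rightarrow> ('a \<Rightarrow>\<^sub>L 'a) \<Rightarrow> bool"
  where "is_inverse_op T S \<longleftrightarrow>
    complex_linear_op S \<and> S o\<^sub>L T = id_blinfun \<and> T o\<^sub>L S = id_blinfun"

definition op_spectrum :: "('a::complex_normed_vector \<Rightarrow>\<^sub>L 'a) \<Rightarrow> complex set"
  where "op_spectrum T = {z. \<nexists>S. is_inverse_op (z *\<^sub>C id_blinfun - T) S}"

definition resolvent :: "('a::complex_normed_vector \<Rightarrow>\<^sub>L 'a) \<Rightarrow> complex \<Rightarrow> 'a \<Rightarrow>\<^sub>L 'a"
  where "resolvent T z = (THE S. is_inverse_op (z *\<^sub>C id_blinfun - T) S)"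

definition eigenspace :: "('a::complex_normed_vector \<Rightarrow>\<^sub>L 'a) \<Rightarrow> complex \<Rightarrow> 'a set"
  where "eigenspace T z = {x. blinfun_apply T x = z *\<^sub>C x}"

definition point_spectrum :: "('a::complex_normed_vector \<Rightarrow>\<^sub>L 'a) \<Rightarrow> complex set"
  where "point_spectrum T = {z. \<exists>x \<in> eigenspace T z. x \<noteq> 0}"

section \<open>Riesz--Dunford functional calculus\<close>

definition encloses :: "(real \<Rightarrow> complex) list \<Rightarrow> complex set \<Rightarrow> complex set \<Rightarrow> bool"
  where "encloses \<Gamma> K \<Omega> \<longleftrightarrow>
    (\<forall>\<gamma> \<in> set \<Gamma>. valid_path \<gamma> \<and> pathfinish \<gamma> = pathstart \<gamma> \<and> path_image \<gamma> \<subseteq> \<Omega> - K) \<and>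
    (\<forall>z \<in> K. (\<Sum>\<gamma>\<leftarrow>\<Gamma>. winding_number \<gamma> z) = 1) \<and>
    (\<forall>z. z \<notin> \<Omega> \<longrightarrow> (\<Sum>\<gamma>\<leftarrow>\<Gamma>. winding_number \<gamma> z) = 0)"

text \<open>The analogue of \<^const>\<open>contour_integral\<close> for integrands with values in a complex Banach space.\<close>

definition vector_contour_integral ::
    "(real \<Rightarrow> complex) \<Rightarrow> (complex \<Rightarrow> 'b::complex_banach) \<Rightarrow> 'b"
  where "vector_contour_integral \<gamma> g =
    integral {0..1} (\<lambda>t. vector_derivative \<gamma> (at t within {0..1}) *\<^sub>C g (\<gamma> t))"

definition dunford_integral ::
    "(real \<Rightarrow> complex) list \<Rightarrow> (complex \<Rightarrow> complex) \<Rightarrow> ('a::complex_banach \<Rightarrow>\<^sub>L 'a) \<Rightarrow> 'a \<Rightarrow>\<^sub>L 'a"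
  where "dunford_integral \<Gamma> f T =
    (1 / (2 * of_real pi * \<i>)) *\<^sub>C
      (\<Sum>\<gamma>\<leftarrow>\<Gamma>. vector_contour_integral \<gamma> (\<lambda>z. f z *\<^sub>C resolvent T z))"

text \<open>
  The operator \<open>f(T)\<close> for \<open>f\<close> holomorphic on the open set \<open>\<Omega>\<close> containing the spectrum of \<open>T\<close>.
  An enclosing cycle always exists, and by Cauchy's theorem the integral does not depend
  on which one is chosen.
\<close>

definition riesz_dunford ::
    "complex set \<Rightarrow> (complex \<Rightarrow> complex) \<Rightarrow> ('a::complex_banach \<Rightarrow>\<^sub>L 'a) \<Rightarrow> 'a \<Rightarrow>\<^sub>L 'a"
  where "riesz_dunford \<Omega> f T =
    dunford_integral (SOME \<Gamma>. encloses \<Gamma> (op_spectrum T) \<Omega>) f T"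

section \<open>Unconditional bases of subspaces\<close>

definition independent_subspaces :: "'i set \<Rightarrow> ('i \<Rightarrow> 'a::complex_normed_vector set) \<Rightarrow> bool"
  where "independent_subspaces A X \<longleftrightarrow>
    (\<forall>F x. finite F \<and> F \<subseteq> A \<and> (\<forall>\<alpha>\<in>F. x \<alpha> \<in> X \<alpha>) \<and> (\<Sum>\<alpha>\<in>F. x \<alpha>) = 0 \<longrightarrow> (\<forall>\<alpha>\<in>F. x \<alpha> = 0))"

definition unconditional_basis :: "'i set \<Rightarrow> ('i \<Rightarrow> 'a::complex_normed_vector set) \<Rightarrow> bool"
  where "unconditional_basis A X \<longleftrightarrow>
    countable A \<and>
    (\<forall>\<alpha>\<in>A. complex_vector.subspace (X \<alpha>)) \<and>
    independent_subspaces A X \<and>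
    closure (complex_vector.span (\<Union>\<alpha>\<in>A. X \<alpha>)) = UNIV \<and>
    (\<exists>C>0. \<forall>F1 F2 x. F1 \<subseteq> F2 \<and> finite F2 \<and> F2 \<subseteq> A \<and> (\<forall>\<alpha>\<in>A. x \<alpha> \<in> X \<alpha>) \<longrightarrow>
       norm (\<Sum>\<alpha>\<in>F1. x \<alpha>) \<le> C * norm (\<Sum>\<alpha>\<in>F2. x \<alpha>))"

definition eigenspaces_form_unconditional_basis :: "('a::complex_normed_vector \<Rightarrow>\<^sub>L 'a) \<Rightarrow> bool"
  where "eigenspaces_form_unconditional_basis T \<longleftrightarrow>
    unconditional_basis (point_spectrum T) (eigenspace T)"

end

theory Submission
  imports Defs
begin

text \<open>
  Write \<open>\<sigma>\<close> for the spectrum of \<open>T\<close>.  On the kernel of \<open>T - z\<close> the operator \<open>f(T)\<close> acts as multiplication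
  by \<open>f z\<close> (\<open>calculus_eigenvector\<close>), and a level set of \<open>f\<close> meets the compact set \<open>\<sigma>\<close> in a finite set
  (\<open>finite_level_set\<close>).  Everything rests on the fact that the eigenspace of \<open>f(T)\<close> for \<open>\<mu>\<close> is the sum of
  the finitely many eigenspaces of \<open>T\<close> for the eigenvalues \<open>z\<close> with \<open>f z = \<mu>\<close>.

  If the eigenspaces of \<open>T\<close> form an unconditional basis, this holds because \<open>f(T)\<close> is then diagonal
  with respect to that basis (\<open>eigenspace_sum_of_diagonal\<close>), and grouping the members of an
  unconditional basis into finite blocks preserves unconditionality (\<open>unconditional_basis_coarsen\<close>).

  Conversely, let \<open>f'\<close> have no zero on \<open>\<sigma>\<close>.  The zeros of \<open>f - \<mu>\<close> on \<open>\<sigma>\<close> are then simple, so that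
  \<open>f - \<mu> = p g\<close> with \<open>p\<close> a polynomial with simple zeros and \<open>g\<close> free of zeros on \<open>\<sigma>\<close>.  Since
  \<open>p(T) = (1/g)(T) (f(T) - \<mu>)\<close>, the kernel of \<open>f(T) - \<mu>\<close> lies in the kernel of \<open>p(T)\<close>, which is the sum
  of the eigenspaces of \<open>T\<close> at the zeros of \<open>p\<close> (\<open>calculus_eigenspace_decomposition\<close>).  The difficulty
  is to split the eigenspaces of \<open>f(T)\<close> with a uniform bound.  An unconditional basis admits all
  bounded multipliers.  By compactness, distinct points of \<open>\<sigma>\<close> with the same value of \<open>f\<close> have
  distance at least some \<open>\<delta> > 0\<close> (\<open>separation_of_level_sets\<close>), so \<open>\<sigma>\<close> is a finite union of pieces on each
  of which \<open>f\<close> is injective.  The projection onto the eigenspaces in one piece is a product of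
  Lagrange factors \<open>(T - b)/(a - b)\<close>, where \<open>a\<close> and \<open>b\<close> depend on the value of \<open>f\<close> only and
  \<open>\<bar>a - b\<bar> \<ge> \<delta>\<close>; it is thus composed of \<open>T\<close> and bounded multipliers (\<open>unconditional_bound_refine\<close>).

  The functional calculus needed for this is built as follows.  A square grid gives a cycle around
  a compact set (\<open>exists_encloses\<close>) and, with Riemann sums, Runge's theorem on approximation by
  rational functions (\<open>runge_rational_approx\<close>).  For a sum of simple fractions with poles of winding
  number zero, Cauchy's theorem for cycles and the rule \<open>(q f)(T) = q(T) f(T)\<close> are elementary
  (resolvent identity); both extend to holomorphic functions by approximation (\<open>cauchy_cycle\<close>,
  \<open>calculus_mult\<close>).  Statements about operator-valued integrals are reduced to complex-valued ones
  by bounded functionals, which separate points (\<open>separating_functional\<close>, a form of the Hahn--Banach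
  theorem).
\<close>

section \<open>Cycles enclosing a compact set\<close>

text \<open>
  A list of paths with as many starting as finishing points at each place can be joined up to
  closed paths: a path that is not closed can be continued by another one.
\<close>

lemma close_up_paths:
  fixes ps :: "(real \<Rightarrow> complex) list"
  assumes "\<forall>p\<in>set ps. valid_path p"
    and "mset (map pathstart ps) = mset (map pathfinish ps)"
  shows "\<exists>\<Gamma>. (\<forall>\<gamma>\<in>set \<Gamma>. valid_path \<gamma> \<and> pathfinish \<gamma> = pathstart \<gamma>
               \<and> path_image \<gamma> \<subseteq> (\<Union>p\<in>set ps. path_image p))
           \<and> (\<forall>z. z \<notin> (\<Union>p\<in>set ps. path_image p) \<longrightarrow>
                (\<Sum>\<gamma>\<leftarrow>\<Gamma>. winding_number \<gamma> z) = (\<Sum>p\<leftarrow>ps. winding_number p z))"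
  using assms
proof (induction "length ps" arbitrary: ps rule: less_induct)
  case less
  show ?case
  proof (cases ps)
    case Nil
    then show ?thesis by (intro exI[of _ "[]"]) auto
  next
    case (Cons p qs)
    show ?thesis
    proof (cases "pathfinish p = pathstart p")
      case True
      have "\<exists>\<Gamma>. (\<forall>\<gamma>\<in>set \<Gamma>. valid_path \<gamma> \<and> pathfinish \<gamma> = pathstart \<gamma>
               \<and> path_image \<gamma> \<subseteq> (\<Union>p\<in>set qs. path_image p))
           \<and> (\<forall>z. z \<notin> (\<Union>p\<in>set qs. path_image p) \<longrightarrow>
                (\<Sum>\<gamma>\<leftarrow>\<Gamma>. winding_number \<gamma> z) = (\<Sum>p\<leftarrow>qs. winding_number p z))"
        by (rule less.hyps) (use less.prems Cons True in auto)
      then obtain \<Gamma> where \<Gamma>: "\<forall>\<gamma>\<in>set \<Gamma>. valid_path \<gamma> \<and> pathfinish \<gamma> = pathstart \<gamma>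
               \<and> path_image \<gamma> \<subseteq> (\<Union>p\<in>set qs. path_image p)"
          "\<forall>z. z \<notin> (\<Union>p\<in>set qs. path_image p) \<longrightarrow>
                (\<Sum>\<gamma>\<leftarrow>\<Gamma>. winding_number \<gamma> z) = (\<Sum>p\<leftarrow>qs. winding_number p z)"
        by blast
      show ?thesis
        by (rule exI[of _ "p # \<Gamma>"]) (use \<Gamma> less.prems Cons True in auto)
    next
      case False
      have "pathfinish p \<in># mset (map pathstart ps)"
        unfolding less.prems(2) using Cons by simp
      then obtain q where q: "q \<in> set qs" "pathstart q = pathfinish p"
        using False Cons by auto
      define ps' where "ps' = (p +++ q) # remove1 q qs"
      have qs: "mset qs = add_mset q (mset (remove1 q qs))"
        using q(1) by simp
      have set_qs: "set qs = insert q (set (remove1 q qs))"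
        by (metis qs set_mset_mset set_mset_add_mset_insert)
      have vp: "valid_path p" "valid_path q"
        using less.prems Cons q by auto
      have im: "path_image (p +++ q) = path_image p \<union> path_image q"
        using q by (simp add: path_image_join)
      have un: "(\<Union>p\<in>set ps'. path_image p) = (\<Union>p\<in>set ps. path_image p)"
        unfolding ps'_def Cons list.set set_qs using im by auto
      have "\<exists>\<Gamma>. (\<forall>\<gamma>\<in>set \<Gamma>. valid_path \<gamma> \<and> pathfinish \<gamma> = pathstart \<gamma>
               \<and> path_image \<gamma> \<subseteq> (\<Union>p\<in>set ps'. path_image p))
           \<and> (\<forall>z. z \<notin> (\<Union>p\<in>set ps'. path_image p) \<longrightarrow>
                (\<Sum>\<gamma>\<leftarrow>\<Gamma>. winding_number \<gamma> z) = (\<Sum>p\<leftarrow>ps'. winding_number p z))"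
      proof (rule less.hyps)
        have "length qs > 0" using q by auto
        then show "length ps' < length ps"
          using q by (simp add: ps'_def Cons length_remove1)
        show "\<forall>p\<in>set ps'. valid_path p"
          using less.prems Cons q vp set_qs by (auto simp: ps'_def valid_path_join)
        have "mset (map pathstart ps) = add_mset (pathstart p) (add_mset (pathstart q) (mset (map pathstart (remove1 q qs))))"
          unfolding Cons using arg_cong[OF qs, of "image_mset pathstart"] by (simp del: mset_remove1)
        moreover have "mset (map pathfinish ps) = add_mset (pathfinish p) (add_mset (pathfinish q) (mset (map pathfinish (remove1 q qs))))"
          unfolding Cons using arg_cong[OF qs, of "image_mset pathfinish"] by (simp del: mset_remove1)
        ultimately show "mset (map pathstart ps') = mset (map pathfinish ps')"
          using less.prems(2) q by (simp add: ps'_def add_mset_commute)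
      qed
      then obtain \<Gamma> where \<Gamma>: "\<forall>\<gamma>\<in>set \<Gamma>. valid_path \<gamma> \<and> pathfinish \<gamma> = pathstart \<gamma>
               \<and> path_image \<gamma> \<subseteq> (\<Union>p\<in>set ps. path_image p)"
          "\<forall>z. z \<notin> (\<Union>p\<in>set ps. path_image p) \<longrightarrow>
                (\<Sum>\<gamma>\<leftarrow>\<Gamma>. winding_number \<gamma> z) = (\<Sum>p\<leftarrow>ps'. winding_number p z)"
        unfolding un by blast
      have "(\<Sum>p\<leftarrow>ps'. winding_number p z) = (\<Sum>p\<leftarrow>ps. winding_number p z)"
        if z: "z \<notin> (\<Union>p\<in>set ps. path_image p)" for z
      proof -
        have "winding_number (p +++ q) z = winding_number p z + winding_number q z"
          using z Cons q vp by (intro winding_number_join) (auto simp: valid_path_imp_path)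
        moreover have "(\<Sum>p\<leftarrow>qs. winding_number p z) =
            winding_number q z + (\<Sum>p\<leftarrow>remove1 q qs. winding_number p z)"
          using q(1) by (rule sum_list_map_remove1)
        ultimately show ?thesis by (simp add: ps'_def Cons)
      qed
      with \<Gamma> show ?thesis by (intro exI[of _ \<Gamma>]) auto
    qed
  qed
qed

text \<open>
  In a finite set of cells with a translation \<open>t\<close> (with inverse \<open>s\<close>), the contributions of interior
  sides to the sum over all cells cancel.
\<close>

lemma sum_telescope_boundary:
  fixes g :: "'i \<Rightarrow> 'b::ab_group_add"
  assumes "finite S" and st: "\<And>p. s (t p) = p" "\<And>p. t (s p) = p"
  shows "(\<Sum>p\<in>{p\<in>S. s p \<notin> S}. g p) - (\<Sum>p\<in>{p\<in>S. t p \<notin> S}. g (t p)) = (\<Sum>p\<in>S. g p - g (t p))"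
proof -
  have "(\<Sum>p\<in>S. g p) = (\<Sum>p\<in>{p\<in>S. s p \<notin> S}. g p) + (\<Sum>p\<in>{p\<in>S. s p \<in> S}. g p)"
    using assms(1) by (subst sum.union_disjoint[symmetric]) (auto intro!: sum.cong)
  moreover have "(\<Sum>p\<in>S. g (t p)) = (\<Sum>p\<in>{p\<in>S. t p \<notin> S}. g (t p)) + (\<Sum>p\<in>{p\<in>S. t p \<in> S}. g (t p))"
    using assms(1) by (subst sum.union_disjoint[symmetric]) (auto intro!: sum.cong)
  moreover have "(\<Sum>p\<in>{p\<in>S. s p \<in> S}. g p) = (\<Sum>p\<in>{p\<in>S. t p \<in> S}. g (t p))"
    by (rule sum.reindex_bij_witness[of _ t s]) (auto simp: st)
  ultimately show ?thesis by (simp add: sum_subtractf)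
qed

lemma contour_integral_rectpath_edges:
  assumes "continuous_on (path_image (rectpath a c)) h"
    and "b = Complex (Re c) (Im a)" "d = Complex (Re a) (Im c)"
  shows "contour_integral (rectpath a c) h =
    contour_integral (linepath a b) h + contour_integral (linepath b c) h +
    contour_integral (linepath c d) h + contour_integral (linepath d a) h"
proof -
  have img: "path_image (rectpath a c) =
      closed_segment a b \<union> closed_segment b c \<union> closed_segment c d \<union> closed_segment d a"
    by (simp add: rectpath_def Let_def assms(2,3) path_image_join Un_assoc)
  have i: "h contour_integrable_on linepath x y" if "closed_segment x y \<subseteq> path_image (rectpath a c)" for x y
    using that assms(1) by (intro contour_integrable_continuous_linepath) (auto intro: continuous_on_subset)
  have ii: "h contour_integrable_on linepath a b" "h contour_integrable_on linepath b c"
     "h contour_integrable_on linepath c d" "h contour_integrable_on linepath d a"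
    using i img by blast+
  show ?thesis
    unfolding rectpath_def Let_def assms(2)[symmetric] assms(3)[symmetric]
    using ii by (simp add: contour_integral_join contour_integrable_joinI valid_path_join)
qed

text \<open>
  The boundary of the union of all squares of a fine grid that meet \<open>K\<close>, as a chain of directed
  segments.  The first property says that it has no boundary as a chain.
\<close>

lemma grid_segments:
  fixes K \<Omega> :: "complex set"
  assumes "compact K" "open \<Omega>" "K \<subseteq> \<Omega>"
  obtains E :: "(complex \<times> complex) list" where
    "mset (map fst E) = mset (map snd E)"
    "\<And>a b. (a, b) \<in> set E \<Longrightarrow> closed_segment a b \<subseteq> \<Omega> - K"
    "\<And>h. h holomorphic_on \<Omega> \<Longrightarrow> (\<Sum>(a, b)\<leftarrow>E. contour_integral (linepath a b) h) = 0"
    "\<And>w. w \<in> K \<Longrightarrow> (\<Sum>(a, b)\<leftarrow>E. winding_number (linepath a b) w) = 1"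
proof -
  obtain e where e: "e > 0" "(\<Union>x\<in>K. ball x e) \<subseteq> \<Omega>"
    using compact_subset_open_imp_ball_epsilon_subset[OF assms] by blast
  \<comment> \<open>Squares of side \<open>e / 3\<close> have diameter less than \<open>e\<close>, so those meeting \<open>K\<close> lie in \<open>\<Omega>\<close>.\<close>
  define d where "d = e / 3"
  have d: "d > 0" using e by (simp add: d_def)
  define V where "V = (\<lambda>(i :: int) (j :: int). Complex (d * i) (d * j))"
  define Q where "Q = (\<lambda>(i :: int) (j :: int). cbox (V i j) (V (i+1) (j+1)))"
  define S where "S = {(i :: int, j :: int). Q i j \<inter> K \<noteq> {}}"
  have memQ: "w \<in> Q i j \<longleftrightarrow> d * i \<le> Re w \<and> Re w \<le> d * (i + 1) \<and> d * j \<le> Im w \<and> Im w \<le> d * (j + 1)" for w and i j :: int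
    by (auto simp: Q_def V_def in_cbox_complex_iff)
  have diam: "dist z w < e" if "z \<in> Q i j" "w \<in> Q i j" for z w and i j :: int
  proof -
    have "\<bar>Re (z - w)\<bar> \<le> d" "\<bar>Im (z - w)\<bar> \<le> d"
      using that by (auto simp: memQ algebra_simps)
    moreover have "cmod (z - w) \<le> \<bar>Re (z - w)\<bar> + \<bar>Im (z - w)\<bar>"
      by (rule cmod_le)
    ultimately show ?thesis using e(1) by (simp add: dist_norm d_def)
  qed
  have QS: "Q i j \<subseteq> \<Omega>" if "(i, j) \<in> S" for i j :: int
  proof
    fix z assume z: "z \<in> Q i j"
    have "Q i j \<inter> K \<noteq> {}" using that by (simp add: S_def)
    then obtain w where "w \<in> Q i j" "w \<in> K" by blast
    with diam[OF this(1) z] have "z \<in> (\<Union>x\<in>K. ball x e)" by auto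
    then show "z \<in> \<Omega>" using e by blast
  qed
  have floorQ: "w \<in> Q \<lfloor>Re w / d\<rfloor> \<lfloor>Im w / d\<rfloor>" for w
  proof -
    have a: "d * of_int \<lfloor>x / d\<rfloor> \<le> x" "x \<le> d * (of_int \<lfloor>x / d\<rfloor> + 1)" for x
    proof -
      have "d * of_int \<lfloor>x / d\<rfloor> \<le> d * (x / d)" "d * (x / d) \<le> d * (of_int \<lfloor>x / d\<rfloor> + 1)"
        using d by (intro mult_left_mono; linarith)+
      then show "d * of_int \<lfloor>x / d\<rfloor> \<le> x" "x \<le> d * (of_int \<lfloor>x / d\<rfloor> + 1)"
        using d by simp_all
    qed
    show ?thesis by (auto simp: memQ a)
  qed
  have fin: "finite S"
  proof -
    obtain B where B: "\<And>z. z \<in> K \<Longrightarrow> cmod z \<le> B"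
      using compact_imp_bounded[OF assms(1)] by (auto simp: bounded_iff)
    have "i \<in> {\<lfloor>- B / d\<rfloor> - 1 .. \<lceil>B / d\<rceil>} \<and> j \<in> {\<lfloor>- B / d\<rfloor> - 1 .. \<lceil>B / d\<rceil>}" if ij: "(i, j) \<in> S" for i j :: int
    proof -
      have "Q i j \<inter> K \<noteq> {}" using ij by (simp add: S_def)
      then obtain w where w: "w \<in> Q i j" "w \<in> K" by blast
      have r: "\<bar>Re w\<bar> \<le> B" "\<bar>Im w\<bar> \<le> B"
        using B[OF w(2)] abs_Re_le_cmod[of w] abs_Im_le_cmod[of w] by linarith+
      have k: "k \<in> {\<lfloor>- B / d\<rfloor> - 1 .. \<lceil>B / d\<rceil>}"
        if "d * of_int k \<le> x" "x \<le> d * (of_int k + 1)" "\<bar>x\<bar> \<le> B" for k :: int and x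
      proof -
        have "d * of_int k \<le> B" "- B \<le> d * (of_int k + 1)" using that by linarith+
        then have "of_int k \<le> B / d" "- B / d \<le> of_int k + 1" using d by (simp_all add: field_simps)
        then have "k \<le> \<lceil>B / d\<rceil>" "\<lfloor>- B / d\<rfloor> \<le> k + 1" by linarith+
        then show ?thesis by simp
      qed
      show ?thesis using w(1) r k[of i "Re w"] k[of j "Im w"] by (simp add: memQ)
    qed
    then have "S \<subseteq> {\<lfloor>- B / d\<rfloor> - 1 .. \<lceil>B / d\<rceil>} \<times> {\<lfloor>- B / d\<rfloor> - 1 .. \<lceil>B / d\<rceil>}" by auto
    then show ?thesis by (rule finite_subset) auto
  qed
  \<comment> \<open>The sides of squares of \<open>S\<close> (bottom, top, left, right, counter-clockwise) whose other neighbour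
    is not in \<open>S\<close>.\<close>
  define tv where "tv = (\<lambda>(i, j). (i, j + 1 :: int) :: int \<times> int)"
  define sv where "sv = (\<lambda>(i, j). (i, j - 1 :: int) :: int \<times> int)"
  define th where "th = (\<lambda>(i, j). (i + 1 :: int, j) :: int \<times> int)"
  define sh where "sh = (\<lambda>(i, j). (i - 1 :: int, j) :: int \<times> int)"
  obtain lB where lB: "set lB = {p\<in>S. sv p \<notin> S}" "distinct lB"
    using finite_distinct_list[of "{p\<in>S. sv p \<notin> S}"] fin by auto
  obtain lT where lT: "set lT = {p\<in>S. tv p \<notin> S}" "distinct lT"
    using finite_distinct_list[of "{p\<in>S. tv p \<notin> S}"] fin by auto
  obtain lL where lL: "set lL = {p\<in>S. sh p \<notin> S}" "distinct lL"
    using finite_distinct_list[of "{p\<in>S. sh p \<notin> S}"] fin by auto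
  obtain lR where lR: "set lR = {p\<in>S. th p \<notin> S}" "distinct lR"
    using finite_distinct_list[of "{p\<in>S. th p \<notin> S}"] fin by auto
  define E where "E = map (\<lambda>(i, j). (V i j, V (i+1) j)) lB
     @ map (\<lambda>(i, j). (V (i+1) (j+1), V i (j+1))) lT
     @ map (\<lambda>(i, j). (V i (j+1), V i j)) lL
     @ map (\<lambda>(i, j). (V (i+1) j, V (i+1) (j+1))) lR"
  \<comment> \<open>Summing an odd function of segments over the boundary is summing it over all squares.\<close>
  have sumE: "(\<Sum>(a, b)\<leftarrow>E. \<phi> a b) =
     (\<Sum>(i, j)\<in>S. \<phi> (V i j) (V (i+1) j) + \<phi> (V (i+1) j) (V (i+1) (j+1))
        + \<phi> (V (i+1) (j+1)) (V i (j+1)) + \<phi> (V i (j+1)) (V i j))"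
    if anti: "\<And>a b. \<phi> b a = - \<phi> a b" for \<phi> :: "complex \<Rightarrow> complex \<Rightarrow> 'b::ab_group_add"
  proof -
    define g where "g = (\<lambda>(i, j). \<phi> (V i j) (V (i+1) j))"
    define h where "h = (\<lambda>(i, j). \<phi> (V i j) (V i (j+1)))"
    have "(\<Sum>(a, b)\<leftarrow>E. \<phi> a b) =
        (\<Sum>p\<in>{p\<in>S. sv p \<notin> S}. g p) + ((\<Sum>p\<in>{p\<in>S. tv p \<notin> S}. - g (tv p))
        + ((\<Sum>p\<in>{p\<in>S. sh p \<notin> S}. - h p) + (\<Sum>p\<in>{p\<in>S. th p \<notin> S}. h (th p))))"
      unfolding E_def map_append sum_list_append map_map
      using lB lT lL lR
      by (simp add: sum_list_distinct_conv_sum_set g_def h_def tv_def th_def anti[symmetric] case_prod_beta)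
    also have "\<dots> = ((\<Sum>p\<in>{p\<in>S. sv p \<notin> S}. g p) - (\<Sum>p\<in>{p\<in>S. tv p \<notin> S}. g (tv p)))
        - ((\<Sum>p\<in>{p\<in>S. sh p \<notin> S}. h p) - (\<Sum>p\<in>{p\<in>S. th p \<notin> S}. h (th p)))"
      by (simp add: sum_negf)
    also have "\<dots> = (\<Sum>p\<in>S. g p - g (tv p)) - (\<Sum>p\<in>S. h p - h (th p))"
      using sum_telescope_boundary[OF fin, of sv tv g] sum_telescope_boundary[OF fin, of sh th h]
      by (simp add: tv_def sv_def th_def sh_def split_beta)
    also have "\<dots> = (\<Sum>p\<in>S. g p + h (th p) + - g (tv p) + - h p)"
      unfolding sum_subtractf[symmetric] by (rule sum.cong) (auto simp: algebra_simps)
    also have "\<dots> = (\<Sum>(i, j)\<in>S. \<phi> (V i j) (V (i+1) j) + \<phi> (V (i+1) j) (V (i+1) (j+1))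
        + \<phi> (V (i+1) (j+1)) (V i (j+1)) + \<phi> (V i (j+1)) (V i j))"
      by (rule sum.cong) (auto simp: g_def h_def tv_def th_def anti[symmetric])
    finally show ?thesis .
  qed
  have ci: "(\<Sum>(a, b)\<leftarrow>E. contour_integral (linepath a b) h) =
      (\<Sum>(i, j)\<in>S. contour_integral (rectpath (V i j) (V (i+1) (j+1))) h)"
    if cont: "\<And>i j. (i, j) \<in> S \<Longrightarrow> continuous_on (path_image (rectpath (V i j) (V (i+1) (j+1)))) h" for h
  proof (subst sumE)
    show "contour_integral (linepath b a) h = - contour_integral (linepath a b) h" for a b
      using contour_integral_reversepath[of "linepath a b" h] by simp
    show "(\<Sum>(i, j)\<in>S. contour_integral (linepath (V i j) (V (i+1) j)) h +
          contour_integral (linepath (V (i+1) j) (V (i+1) (j+1))) h +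
          contour_integral (linepath (V (i+1) (j+1)) (V i (j+1))) h +
          contour_integral (linepath (V i (j+1)) (V i j)) h) =
        (\<Sum>(i, j)\<in>S. contour_integral (rectpath (V i j) (V (i+1) (j+1))) h)"
      by (rule sum.cong, simp, clarify,
          rule contour_integral_rectpath_edges[OF cont, symmetric])
         (auto simp: V_def)
  qed
  have bd: "path_image (rectpath (V i j) (V (i+1) (j+1))) \<subseteq> Q i j" for i j
    unfolding Q_def using d by (intro path_image_rectpath_subset_cbox) (auto simp: V_def)
  have segs: "closed_segment a b \<subseteq> \<Omega> - K" if ab: "(a, b) \<in> set E" for a b
  proof -
    have seg: "closed_segment (V i j) (V (i+1) j) \<subseteq> Q i j \<inter> Q i (j - 1)"
       "closed_segment (V i j) (V i (j+1)) \<subseteq> Q i j \<inter> Q (i - 1) j" for i j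
      unfolding Q_def
      by (rule closed_segment_subset; use d in \<open>auto simp: convex_Int V_def in_cbox_complex_iff algebra_simps\<close>)+
    have *: "closed_segment a b \<subseteq> \<Omega> - K" if "closed_segment a b \<subseteq> Q i j \<inter> Q i' j'"
        "(i, j) \<in> S" "(i', j') \<notin> S" for i j i' j'
      using that QS[OF that(2)] by (auto simp: S_def)
    from ab consider i j where "(i, j) \<in> S" "(i, j - 1) \<notin> S" "a = V i j" "b = V (i+1) j"
      | i j where "(i, j) \<in> S" "(i, j + 1) \<notin> S" "b = V i (j+1)" "a = V (i+1) (j+1)"
      | i j where "(i, j) \<in> S" "(i - 1, j) \<notin> S" "b = V i j" "a = V i (j+1)"
      | i j where "(i, j) \<in> S" "(i + 1, j) \<notin> S" "a = V (i+1) j" "b = V (i+1) (j+1)"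
      unfolding E_def using lB(1) lT(1) lL(1) lR(1) by (auto simp: sv_def tv_def sh_def th_def)
    then show "closed_segment a b \<subseteq> \<Omega> - K"
    proof cases
      case (1 i j) with seg(1)[of i j] * show ?thesis by blast
    next
      case (2 i j)
      have "closed_segment a b \<subseteq> Q i j \<inter> Q i (j+1)"
        using seg(1)[of i "j+1"] 2 by (auto simp: closed_segment_commute)
      with 2 * show ?thesis by blast
    next
      case (3 i j)
      have "closed_segment a b \<subseteq> Q i j \<inter> Q (i-1) j"
        using seg(2)[of i j] 3 by (auto simp: closed_segment_commute)
      with 3 * show ?thesis by blast
    next
      case (4 i j)
      have "closed_segment a b \<subseteq> Q i j \<inter> Q (i+1) j"
        using seg(2)[of "i+1" j] 4 by (auto simp: closed_segment_commute)
      with 4 * show ?thesis by blast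
    qed
  qed
  show ?thesis
  proof (rule that)
    show "mset (map fst E) = mset (map snd E)"
    proof (rule multiset_eqI)
      fix v
      define ind where "ind = (\<lambda>a :: complex. if a = v then 1 else 0 :: int)"
      have cnt: "int (count (mset xs) v) = (\<Sum>x\<leftarrow>xs. ind x)" for xs
        by (induction xs) (auto simp: ind_def)
      have "(\<Sum>(a, b)\<leftarrow>E. ind a - ind b) = 0"
        by (subst sumE) auto
      moreover have "(\<Sum>(a, b)\<leftarrow>xs. ind a - ind b) = (\<Sum>x\<leftarrow>map fst xs. ind x) - (\<Sum>x\<leftarrow>map snd xs. ind x)" for xs
        by (induction xs) auto
      ultimately have "int (count (mset (map fst E)) v) = int (count (mset (map snd E)) v)"
        unfolding cnt by simp
      then show "count (mset (map fst E)) v = count (mset (map snd E)) v" by simp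
    qed
  next
    show "closed_segment a b \<subseteq> \<Omega> - K" if "(a, b) \<in> set E" for a b
      using segs[OF that] .
  next
    fix h assume h: "h holomorphic_on \<Omega>"
    have "contour_integral (rectpath (V i j) (V (i+1) (j+1))) h = 0" if "(i, j) \<in> S" for i j :: int
      by (rule contour_integral_unique, rule Cauchy_theorem_convex_simple[of _ "Q i j"])
         (use bd QS[OF that] h in \<open>auto simp: Q_def intro: holomorphic_on_subset\<close>)
    moreover have "continuous_on (path_image (rectpath (V i j) (V (i+1) (j+1)))) h" if "(i, j) \<in> S" for i j :: int
      using h bd QS[OF that] by (meson holomorphic_on_imp_continuous_on continuous_on_subset)
    ultimately show "(\<Sum>(a, b)\<leftarrow>E. contour_integral (linepath a b) h) = 0"
      by (subst ci) (auto intro!: sum.neutral)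
  next
    fix w assume w: "w \<in> K"
    show "(\<Sum>(a, b)\<leftarrow>E. winding_number (linepath a b) w) = 1"
    proof -
      define i j where "i = \<lfloor>Re w / d\<rfloor>" and "j = \<lfloor>Im w / d\<rfloor>"
      have wQ: "w \<in> Q i j" unfolding i_def j_def by (rule floorQ)
      have ijS: "(i, j) \<in> S" using wQ w by (auto simp: S_def)
      define B where "B = box (V i j) (V (i+1) (j+1))"
      have memB: "u \<in> B \<longleftrightarrow> d * i < Re u \<and> Re u < d * (i + 1) \<and> d * j < Im u \<and> Im u < d * (j + 1)" for u
        by (auto simp: B_def V_def in_box_complex_iff)
      have strict: "k = m" if "d * of_int k \<le> x" "x \<le> d * (of_int k + 1)" "d * of_int m < x" "x < d * (of_int m + 1)"
        for k m :: int and x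
      proof -
        have "d * of_int k < d * (of_int m + 1)" "d * of_int m < d * (of_int k + 1)" using that by linarith+
        then have "of_int k < (of_int m + 1 :: real)" "of_int m < (of_int k + 1 :: real)"
          using d by simp_all
        then show ?thesis by linarith
      qed
      have line: "u \<notin> closed_segment a b" if "(a, b) \<in> set E" "u \<in> B" for u a b
      proof -
        from that(1) have "(\<exists>k :: int. Re a = d * k \<and> Re b = d * k) \<or> (\<exists>k :: int. Im a = d * k \<and> Im b = d * k)"
          unfolding E_def by (auto simp: V_def) (metis of_int_add of_int_1)+
        then show ?thesis
        proof
          assume "\<exists>k :: int. Re a = d * k \<and> Re b = d * k"
          then obtain k :: int where k: "Re a = d * k" "Re b = d * k" by blast
          show ?thesis
          proof
            assume "u \<in> closed_segment a b"
            then obtain t where "u = (1 - t) *\<^sub>R a + t *\<^sub>R b" by (auto simp: in_segment)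
            then have "Re u = (1 - t) * (d * k) + t * (d * k)" using k by simp
            then have "Re u = d * k" by (simp add: algebra_simps)
            with that(2) strict[of k "Re u" i] strict[of "k - 1" "Re u" i] d show False
              by (auto simp: memB algebra_simps)
          qed
        next
          assume "\<exists>k :: int. Im a = d * k \<and> Im b = d * k"
          then obtain k :: int where k: "Im a = d * k" "Im b = d * k" by blast
          show ?thesis
          proof
            assume "u \<in> closed_segment a b"
            then obtain t where "u = (1 - t) *\<^sub>R a + t *\<^sub>R b" by (auto simp: in_segment)
            then have "Im u = (1 - t) * (d * k) + t * (d * k)" using k by simp
            then have "Im u = d * k" by (simp add: algebra_simps)
            with that(2) strict[of k "Im u" j] strict[of "k - 1" "Im u" j] d show False
              by (auto simp: memB algebra_simps)
          qed
        qed
      qed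
      \<comment> \<open>Inside a square the sum is computed square by square; a point of \<open>K\<close> may lie on a grid line,
        but it is off the boundary segments, where the sum is continuous.\<close>
      have inner: "(\<Sum>(a, b)\<leftarrow>E. winding_number (linepath a b) u) = 1" if u: "u \<in> B" for u
      proof -
        have notin: "u \<notin> Q k m" if "(k, m) \<noteq> (i, j)" for k m
          using that u strict[of k "Re u" i] strict[of m "Im u" j] by (auto simp: memQ memB)
        have off: "u \<notin> path_image (rectpath (V k m) (V (k+1) (m+1)))" for k m
        proof (cases "(k, m) = (i, j)")
          case True
          then show ?thesis using u path_image_rectpath_inter_box[of "V i j" "V (i+1) (j+1)"] d
            by (auto simp: B_def V_def)
        next
          case False
          then show ?thesis using notin bd by blast
        qed
        have rect: "contour_integral (rectpath (V k m) (V (k+1) (m+1))) (\<lambda>z. 1 / (z - u)) =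
            2 * pi * \<i> * (if (k, m) = (i, j) then 1 else 0)" for k m
        proof (cases "(k, m) = (i, j)")
          case True
          have "winding_number (rectpath (V i j) (V (i+1) (j+1))) u = 1"
            using u by (intro winding_number_rectpath) (simp add: B_def)
          then show ?thesis using True off[of i j]
            by (simp add: winding_number_valid_path)
        next
          case False
          have "winding_number (rectpath (V k m) (V (k+1) (m+1))) u = 0"
            using notin[OF False] d by (intro winding_number_rectpath_outside) (auto simp: Q_def V_def)
          then show ?thesis using False off[of k m]
            by (auto simp: winding_number_valid_path)
        qed
        have "(\<Sum>(a, b)\<leftarrow>E. winding_number (linepath a b) u) =
            (\<Sum>(a, b)\<leftarrow>E. 1 / (2 * pi * \<i>) * contour_integral (linepath a b) (\<lambda>z. 1 / (z - u)))"
          by (rule arg_cong[of _ _ sum_list], rule map_cong)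
             (use line u in \<open>auto simp: winding_number_valid_path\<close>)
        also have "\<dots> = 1 / (2 * pi * \<i>) * (\<Sum>(a, b)\<leftarrow>E. contour_integral (linepath a b) (\<lambda>z. 1 / (z - u)))"
          by (simp add: sum_list_const_mult[symmetric] case_prod_unfold)
        also have "(\<Sum>(a, b)\<leftarrow>E. contour_integral (linepath a b) (\<lambda>z. 1 / (z - u))) =
            (\<Sum>(k, m)\<in>S. 2 * pi * \<i> * (if (k, m) = (i, j) then 1 else 0))"
          by (subst ci) (use off rect in \<open>auto intro!: continuous_intros sum.cong\<close>)
        also have "\<dots> = 2 * pi * \<i>"
        proof -
          have "(\<Sum>(k, m)\<in>S. 2 * pi * \<i> * (if (k, m) = (i, j) then 1 else 0)) =
              (\<Sum>p\<in>S. if p = (i, j) then 2 * pi * \<i> else 0)"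
            by (rule sum.cong) (auto split: if_splits)
          then show ?thesis using fin ijS by simp
        qed
        finally show ?thesis by simp
      qed
      have segK: "w \<notin> closed_segment a b" if "(a, b) \<in> set E" for a b
        using segs[OF that] w by blast
      have cont: "isCont (\<lambda>u. \<Sum>(a, b)\<leftarrow>xs. winding_number (linepath a b) u) w" if "set xs \<subseteq> set E" for xs
        using that
        by (induction xs)
           (auto intro!: continuous_intros continuous_at_winding_number dest: segK)
      \<comment> \<open>Points inside the square that tend to \<open>w\<close> along the segment from its centre \<open>c\<close>.\<close>
      define c where "c = Complex (d * (i + 1/2)) (d * (j + 1/2))"
      define u where "u = (\<lambda>n. w + (1 / real (Suc n)) *\<^sub>R (c - w))"
      have "u \<longlonglongrightarrow> w + 0 *\<^sub>R (c - w)"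
        unfolding u_def by (intro tendsto_intros LIMSEQ_Suc lim_1_over_n)
      then have lim: "u \<longlonglongrightarrow> w" by simp
      have uB: "u n \<in> B" for n
      proof -
        have conv: "d * k < x + t * (d * (k + 1/2) - x) \<and> x + t * (d * (k + 1/2) - x) < d * (k + 1)"
          if "d * k \<le> x" "x \<le> d * (k + 1)" "0 < t" "t \<le> 1" for k x t :: real
        proof -
          have "0 < (1 - t) * (x - d * k) + t * (d / 2)" "0 < (1 - t) * (d * (k + 1) - x) + t * (d / 2)"
            using that d by (auto intro!: add_nonneg_pos)
          moreover have "(1 - t) * (x - d * k) + t * (d / 2) = x + t * (d * (k + 1/2) - x) - d * k"
            "(1 - t) * (d * (k + 1) - x) + t * (d / 2) = d * (k + 1) - (x + t * (d * (k + 1/2) - x))"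
            by (simp_all add: algebra_simps)
          ultimately show ?thesis by simp
        qed
        show ?thesis
          using wQ conv[of "real_of_int i" "Re w" "1 / real (Suc n)"] conv[of "real_of_int j" "Im w" "1 / real (Suc n)"]
          by (simp add: memB memQ u_def c_def)
      qed
      have "(\<lambda>n. \<Sum>(a, b)\<leftarrow>E. winding_number (linepath a b) (u n)) \<longlonglongrightarrow> (\<Sum>(a, b)\<leftarrow>E. winding_number (linepath a b) w)"
        using isCont_tendsto_compose[OF cont[OF order_refl] lim] .
      then have "(\<lambda>n. 1) \<longlonglongrightarrow> (\<Sum>(a, b)\<leftarrow>E. winding_number (linepath a b) w)"
        using inner uB by simp
      then show ?thesis using LIMSEQ_unique tendsto_const by blast
    qed
  qed
qed

text \<open>
  The existence of an enclosing cycle, which makes the choice in \<^const>\<open>riesz_dunford\<close> meaningful.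
\<close>

lemma exists_encloses:
  assumes "compact K" "open \<Omega>" "K \<subseteq> \<Omega>"
  shows "\<exists>\<Gamma>. encloses \<Gamma> K \<Omega>"
proof -
  obtain E where E: "mset (map fst E) = mset (map snd E)"
    "\<And>a b. (a, b) \<in> set E \<Longrightarrow> closed_segment a b \<subseteq> \<Omega> - K"
    "\<And>h. h holomorphic_on \<Omega> \<Longrightarrow> (\<Sum>(a, b)\<leftarrow>E. contour_integral (linepath a b) h) = 0"
    "\<And>w. w \<in> K \<Longrightarrow> (\<Sum>(a, b)\<leftarrow>E. winding_number (linepath a b) w) = 1"
    using grid_segments[OF assms] by blast
  define ps where "ps = map (\<lambda>(a, b). linepath a b) E"
  have im: "(\<Union>p\<in>set ps. path_image p) \<subseteq> \<Omega> - K"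
  proof (clarsimp simp: ps_def)
    fix z a b assume "(a, b) \<in> set E" "z \<in> closed_segment a b"
    then show "z \<in> \<Omega> \<and> z \<notin> K" using E(2)[of a b] by blast
  qed
  have "\<exists>\<Gamma>. (\<forall>\<gamma>\<in>set \<Gamma>. valid_path \<gamma> \<and> pathfinish \<gamma> = pathstart \<gamma>
               \<and> path_image \<gamma> \<subseteq> (\<Union>p\<in>set ps. path_image p))
           \<and> (\<forall>z. z \<notin> (\<Union>p\<in>set ps. path_image p) \<longrightarrow>
                (\<Sum>\<gamma>\<leftarrow>\<Gamma>. winding_number \<gamma> z) = (\<Sum>p\<leftarrow>ps. winding_number p z))"
  proof (rule close_up_paths)
    have "map pathstart ps = map fst E" "map pathfinish ps = map snd E"
      by (auto simp: ps_def)
    then show "mset (map pathstart ps) = mset (map pathfinish ps)"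
      using E(1) by simp
  qed (auto simp: ps_def)
  then obtain \<Gamma> where \<Gamma>: "\<forall>\<gamma>\<in>set \<Gamma>. valid_path \<gamma> \<and> pathfinish \<gamma> = pathstart \<gamma>
               \<and> path_image \<gamma> \<subseteq> (\<Union>p\<in>set ps. path_image p)"
    "\<And>z. z \<notin> (\<Union>p\<in>set ps. path_image p) \<Longrightarrow>
                (\<Sum>\<gamma>\<leftarrow>\<Gamma>. winding_number \<gamma> z) = (\<Sum>p\<leftarrow>ps. winding_number p z)"
    by blast
  have ps_sum: "(\<Sum>p\<leftarrow>ps. winding_number p z) = (\<Sum>(a, b)\<leftarrow>E. winding_number (linepath a b) z)" for z
    by (simp add: ps_def case_prod_unfold o_def)
  have "(\<Sum>\<gamma>\<leftarrow>\<Gamma>. winding_number \<gamma> z) = 1" if "z \<in> K" for z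
  proof -
    have "z \<notin> (\<Union>p\<in>set ps. path_image p)" using im that by auto
    then show ?thesis using \<Gamma>(2) ps_sum E(4)[OF that] by simp
  qed
  moreover have "(\<Sum>\<gamma>\<leftarrow>\<Gamma>. winding_number \<gamma> z) = 0" if z: "z \<notin> \<Omega>" for z
  proof -
    have wn: "winding_number (linepath a b) z =
        1 / (2 * pi * \<i>) * contour_integral (linepath a b) (\<lambda>w. 1 / (w - z))" if "(a, b) \<in> set E" for a b
      using E(2)[OF that] z by (intro winding_number_valid_path) auto
    have "(\<Sum>(a, b)\<leftarrow>E. winding_number (linepath a b) z) =
        (\<Sum>(a, b)\<leftarrow>E. 1 / (2 * pi * \<i>) * contour_integral (linepath a b) (\<lambda>w. 1 / (w - z)))"
      by (rule arg_cong[of _ _ sum_list], rule map_cong)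
         (use wn in auto)
    also have "\<dots> = 1 / (2 * pi * \<i>) * (\<Sum>(a, b)\<leftarrow>E. contour_integral (linepath a b) (\<lambda>w. 1 / (w - z)))"
      by (simp add: sum_list_const_mult[symmetric] case_prod_unfold)
    also have "(\<Sum>(a, b)\<leftarrow>E. contour_integral (linepath a b) (\<lambda>w. 1 / (w - z))) = 0"
      using z by (intro E(3) holomorphic_intros) auto
    finally have "(\<Sum>(a, b)\<leftarrow>E. winding_number (linepath a b) z) = 0" by simp
    moreover have "z \<notin> (\<Union>p\<in>set ps. path_image p)" using im z by auto
    ultimately show ?thesis using \<Gamma>(2) ps_sum by simp
  qed
  ultimately have "encloses \<Gamma> K \<Omega>"
    using \<Gamma>(1) im unfolding encloses_def by (meson order_trans)
  then show ?thesis by blast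
qed

section \<open>Runge approximation by sums of simple fractions\<close>

lemma riemann_sum_uniform:
  fixes k :: "real \<Rightarrow> complex \<Rightarrow> complex"
  assumes cont: "continuous_on ({0..1} \<times> K) (\<lambda>(t, w). k t w)" and "compact K" "e > 0"
  shows "\<exists>n>0. \<forall>w\<in>K. norm (integral {0..1} (\<lambda>t. k t w) - (\<Sum>j<n. k (real j / real n) w / of_nat n)) \<le> e"
proof -
  have "uniformly_continuous_on ({0..1} \<times> K) (\<lambda>(t, w). k t w)"
    by (intro compact_uniformly_continuous compact_Times assms) auto
  then obtain \<delta> where \<delta>: "\<delta> > 0"
    "\<And>p q. p \<in> {0..1} \<times> K \<Longrightarrow> q \<in> {0..1} \<times> K \<Longrightarrow> dist q p < \<delta> \<Longrightarrow>
        dist ((\<lambda>(t, w). k t w) q) ((\<lambda>(t, w). k t w) p) < e"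
    using \<open>e > 0\<close> unfolding uniformly_continuous_on_def by metis
  obtain n where n: "n > 0" "1 / real n < \<delta>"
    using \<delta>(1) by (metis nat_approx_posE zero_less_Suc)
  have "norm (integral {0..1} (\<lambda>t. k t w) - (\<Sum>j<n. k (real j / real n) w / of_nat n)) \<le> e" if w: "w \<in> K" for w
  proof -
    have cw: "continuous_on {0..1} (\<lambda>t. k t w)"
    proof -
      have "continuous_on {0..1} ((\<lambda>(t, w). k t w) \<circ> (\<lambda>t. (t, w)))"
        using w by (intro continuous_on_compose continuous_intros continuous_on_subset[OF cont]) auto
      then show ?thesis by (simp add: o_def)
    qed
    have "norm (integral {0..real m / real n} (\<lambda>t. k t w) - (\<Sum>j<m. k (real j / real n) w / of_nat n))
          \<le> e * (real m / real n)" if "m \<le> n" for m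
      using that
    proof (induction m)
      case 0
      then show ?case by simp
    next
      case (Suc m)
      let ?a = "real m / real n" and ?b = "real (Suc m) / real n"
      have ab: "0 \<le> ?a" "?a \<le> ?b" "?b \<le> 1" "?b - ?a = 1 / real n"
        using Suc.prems n by (auto simp: field_simps)
      have sub: "{0..?b} \<subseteq> {0..1}" "{?a..?b} \<subseteq> {0..1}" using ab by auto
      have split: "integral {0..?b} (\<lambda>t. k t w) = integral {0..?a} (\<lambda>t. k t w) + integral {?a..?b} (\<lambda>t. k t w)"
        using ab cw sub(1)
        by (intro Henstock_Kurzweil_Integration.integral_combine[symmetric] integrable_continuous_real)
           (auto intro: continuous_on_subset)
      have "norm (integral {?a..?b} (\<lambda>t. k t w - k ?a w)) \<le> e * (?b - ?a)"
      proof (rule integral_bound)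
        show "continuous_on {?a..?b} (\<lambda>t. k t w - k ?a w)"
          by (intro continuous_intros continuous_on_subset[OF cw sub(2)])
        show "norm (k t w - k ?a w) \<le> e" if "t \<in> {?a..?b}" for t
        proof -
          have "dist (t, w) (?a, w) < \<delta>"
            using that ab(4) n(2) by (auto simp: dist_Pair_Pair dist_real_def)
          moreover have "0 \<le> t" using ab(1) that by (meson atLeastAtMost_iff order_trans)
          ultimately show ?thesis
            using \<delta>(2)[of "(?a, w)" "(t, w)"] that w ab
            by (auto simp: dist_norm)
        qed
      qed (use ab in auto)
      moreover have "integral {?a..?b} (\<lambda>t. k t w - k ?a w) = integral {?a..?b} (\<lambda>t. k t w) - k ?a w / of_nat n"
      proof -
        have "integral {?a..?b} (\<lambda>t. k t w - k ?a w) = integral {?a..?b} (\<lambda>t. k t w) - (?b - ?a) *\<^sub>R k ?a w"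
          using continuous_on_subset[OF cw sub(2)] ab(2)
          by (subst integral_diff) (auto intro!: integrable_continuous_real)
        then show ?thesis unfolding ab(4) by (simp add: scaleR_conv_of_real)
      qed
      ultimately have step: "norm (integral {?a..?b} (\<lambda>t. k t w) - k ?a w / of_nat n) \<le> e * (?b - ?a)"
        by simp
      have "norm (integral {0..?b} (\<lambda>t. k t w) - (\<Sum>j<Suc m. k (real j / real n) w / of_nat n)) \<le>
          norm (integral {0..?a} (\<lambda>t. k t w) - (\<Sum>j<m. k (real j / real n) w / of_nat n))
          + norm (integral {?a..?b} (\<lambda>t. k t w) - k ?a w / of_nat n)"
        unfolding split by (rule order_trans[OF _ norm_triangle_ineq]) (simp add: algebra_simps)
      also have "\<dots> \<le> e * ?a + e * (?b - ?a)"
        using Suc step by (intro add_mono) auto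
      also have "\<dots> = e * ?b" by (simp add: algebra_simps)
      finally show ?case .
    qed
    from this[of n] show ?thesis using n by simp
  qed
  with n show ?thesis by blast
qed

lemma linepath_integral_rational_approx:
  assumes "closed_segment a b \<inter> K = {}" "compact K" "continuous_on (closed_segment a b) f" "e > 0"
  shows "\<exists>ps. (\<forall>(c, \<zeta>)\<in>set ps. \<zeta> \<notin> K) \<and>
    (\<forall>w\<in>K. cmod (contour_integral (linepath a b) (\<lambda>\<zeta>. f \<zeta> / (\<zeta> - w)) - (\<Sum>(c, \<zeta>)\<leftarrow>ps. c / (\<zeta> - w))) \<le> e)"
proof -
  define k where "k = (\<lambda>t w. f (linepath a b t) / (linepath a b t - w) * (b - a))"
  have seg: "linepath a b t \<in> closed_segment a b" if "t \<in> {0..1}" for t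
    using that by (rule linepath_in_path)
  have off: "linepath a b t \<notin> K" if "0 \<le> t" "t \<le> 1" for t
    using seg[of t] assms(1) that by auto
  have "continuous_on ({0..1} \<times> K) (\<lambda>p. f (linepath a b (fst p)))"
    by (rule continuous_on_compose2[OF assms(3)]) (use seg in \<open>auto intro!: continuous_intros continuous_on_linepath simp: linepath_def\<close>)
  then have "continuous_on ({0..1} \<times> K) (\<lambda>p. f (linepath a b (fst p)) / (linepath a b (fst p) - snd p) * (b - a))"
    by (intro continuous_intros continuous_on_compose2[OF continuous_on_linepath[of UNIV a b]])
       (auto dest: off)
  then have "continuous_on ({0..1} \<times> K) (\<lambda>(t, w). k t w)"
    by (simp add: k_def case_prod_unfold)
  from riemann_sum_uniform[OF this assms(2,4)] obtain n where n: "n > 0"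
    "\<And>w. w \<in> K \<Longrightarrow> norm (integral {0..1} (\<lambda>t. k t w) - (\<Sum>j<n. k (real j / real n) w / of_nat n)) \<le> e"
    by blast
  define ps where "ps = map (\<lambda>j. (f (linepath a b (real j / real n)) * (b - a) / of_nat n, linepath a b (real j / real n))) [0..<n]"
  have "\<forall>(c, \<zeta>)\<in>set ps. \<zeta> \<notin> K"
  proof -
    have "linepath a b (real j / real n) \<notin> K" if "j < n" for j
      using seg[of "real j / real n"] assms(1) that by auto
    then show ?thesis by (auto simp: ps_def)
  qed
  moreover have "contour_integral (linepath a b) (\<lambda>\<zeta>. f \<zeta> / (\<zeta> - w)) = integral {0..1} (\<lambda>t. k t w)" for w
    unfolding contour_integral_integral k_def
    by (rule integral_cong) (simp add: vector_derivative_linepath_within)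
  moreover have "(\<Sum>(c, \<zeta>)\<leftarrow>ps. c / (\<zeta> - w)) = (\<Sum>j<n. k (real j / real n) w / of_nat n)" for w
    by (simp add: ps_def o_def interv_sum_list_conv_sum_set_nat atLeast0LessThan k_def mult.commute)
  ultimately show ?thesis using n by (intro exI[of _ ps]) auto
qed

text \<open>
  Runge's theorem: the grid chain yields a Cauchy formula for \<open>f\<close> on \<open>K\<close>, whose Riemann sums are
  sums of simple fractions.
\<close>

theorem runge_rational_approx:
  assumes "compact K" "open S" "K \<subseteq> S" "f holomorphic_on S" "e > 0"
  obtains ps :: "(complex \<times> complex) list" where "\<forall>(c, \<zeta>)\<in>set ps. \<zeta> \<notin> K"
    "\<And>w. w \<in> K \<Longrightarrow> cmod (f w - (\<Sum>(c, \<zeta>)\<leftarrow>ps. c / (\<zeta> - w))) \<le> e"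
proof -
  obtain E where E: "\<And>a b. (a, b) \<in> set E \<Longrightarrow> closed_segment a b \<subseteq> S - K"
    "\<And>h. h holomorphic_on S \<Longrightarrow> (\<Sum>(a, b)\<leftarrow>E. contour_integral (linepath a b) h) = 0"
    "\<And>w. w \<in> K \<Longrightarrow> (\<Sum>(a, b)\<leftarrow>E. winding_number (linepath a b) w) = 1"
    using grid_segments[OF assms(1-3)] by metis
  have contf: "continuous_on (closed_segment a b) f" if "(a, b) \<in> set E" for a b
    using E(1)[OF that] assms(4) by (meson Diff_subset continuous_on_subset holomorphic_on_imp_continuous_on order_trans)
  have cauchy: "(\<Sum>(a, b)\<leftarrow>E. contour_integral (linepath a b) (\<lambda>\<zeta>. f \<zeta> / (\<zeta> - w))) = 2 * pi * \<i> * f w"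
    if w: "w \<in> K" for w
  proof -
    define h where "h = (\<lambda>z. if z = w then deriv f w else (f z - f w) / (z - w))"
    have "h holomorphic_on S"
      unfolding h_def by (rule pole_lemma_open[OF assms(4,2)])
    then have "0 = (\<Sum>(a, b)\<leftarrow>E. contour_integral (linepath a b) h)" using E(2) by simp
    also have "\<dots> = (\<Sum>(a, b)\<leftarrow>E. contour_integral (linepath a b) (\<lambda>\<zeta>. f \<zeta> / (\<zeta> - w))
        - 2 * pi * \<i> * f w * winding_number (linepath a b) w)"
    proof (rule arg_cong[of _ _ sum_list], rule map_cong[OF refl], clarify)
      fix a b assume ab: "(a, b) \<in> set E"
      have w': "w \<notin> closed_segment a b" using E(1)[OF ab] w by auto
      have "contour_integral (linepath a b) h =
          contour_integral (linepath a b) (\<lambda>\<zeta>. f \<zeta> / (\<zeta> - w) - f w * (1 / (\<zeta> - w)))"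
        by (rule contour_integral_eq) (use w' in \<open>auto simp: h_def diff_divide_distrib\<close>)
      also have "\<dots> = contour_integral (linepath a b) (\<lambda>\<zeta>. f \<zeta> / (\<zeta> - w))
          - f w * contour_integral (linepath a b) (\<lambda>\<zeta>. 1 / (\<zeta> - w))"
      proof (subst contour_integral_diff)
        show "(\<lambda>\<zeta>. f \<zeta> / (\<zeta> - w)) contour_integrable_on linepath a b"
          using w' contf[OF ab] by (auto intro!: contour_integrable_continuous_linepath continuous_intros)
        have i: "(\<lambda>\<zeta>. 1 / (\<zeta> - w)) contour_integrable_on linepath a b"
          using w' by (auto intro!: contour_integrable_continuous_linepath continuous_intros)
        then show "(\<lambda>\<zeta>. f w * (1 / (\<zeta> - w))) contour_integrable_on linepath a b"
          by (rule contour_integrable_lmul)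
        show "contour_integral (linepath a b) (\<lambda>\<zeta>. f \<zeta> / (\<zeta> - w)) - contour_integral (linepath a b) (\<lambda>\<zeta>. f w * (1 / (\<zeta> - w)))
          = contour_integral (linepath a b) (\<lambda>\<zeta>. f \<zeta> / (\<zeta> - w)) - f w * contour_integral (linepath a b) (\<lambda>\<zeta>. 1 / (\<zeta> - w))"
          by (subst contour_integral_lmul[OF i]) simp
      qed
      also have "contour_integral (linepath a b) (\<lambda>\<zeta>. 1 / (\<zeta> - w)) = 2 * pi * \<i> * winding_number (linepath a b) w"
        using w' by (simp add: winding_number_valid_path)
      finally show "contour_integral (linepath a b) h = contour_integral (linepath a b) (\<lambda>\<zeta>. f \<zeta> / (\<zeta> - w))
        - 2 * pi * \<i> * f w * winding_number (linepath a b) w" by simp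
    qed
    also have "\<dots> = (\<Sum>(a, b)\<leftarrow>E. contour_integral (linepath a b) (\<lambda>\<zeta>. f \<zeta> / (\<zeta> - w)))
        - 2 * pi * \<i> * f w * (\<Sum>(a, b)\<leftarrow>E. winding_number (linepath a b) w)"
      by (simp add: sum_list_subtractf case_prod_unfold sum_list_const_mult)
    finally show ?thesis using E(3)[OF w] by simp
  qed
  have approx: "\<exists>ps. (\<forall>(c, \<zeta>)\<in>set ps. \<zeta> \<notin> K) \<and>
      (\<forall>w\<in>K. cmod ((\<Sum>(a, b)\<leftarrow>xs. contour_integral (linepath a b) (\<lambda>\<zeta>. f \<zeta> / (\<zeta> - w))) - (\<Sum>(c, \<zeta>)\<leftarrow>ps. c / (\<zeta> - w))) \<le> d)"
    if "set xs \<subseteq> set E" "d > 0" for xs d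
    using that
  proof (induction xs arbitrary: d)
    case Nil
    then show ?case by (intro exI[of _ "[]"]) auto
  next
    case (Cons x xs)
    obtain a b where x: "x = (a, b)" by (cases x)
    have ab: "(a, b) \<in> set E" using Cons.prems x by simp
    have "closed_segment a b \<inter> K = {}" using E(1)[OF ab] by blast
    moreover have d2: "d / 2 > 0" using Cons.prems by simp
    ultimately obtain ps1 where ps1: "\<forall>(c, \<zeta>)\<in>set ps1. \<zeta> \<notin> K"
      "\<And>w. w \<in> K \<Longrightarrow> cmod (contour_integral (linepath a b) (\<lambda>\<zeta>. f \<zeta> / (\<zeta> - w)) - (\<Sum>(c, \<zeta>)\<leftarrow>ps1. c / (\<zeta> - w))) \<le> d / 2"
      using linepath_integral_rational_approx[OF _ assms(1) contf[OF ab]] by blast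
    obtain ps2 where ps2: "\<forall>(c, \<zeta>)\<in>set ps2. \<zeta> \<notin> K"
      "\<And>w. w \<in> K \<Longrightarrow> cmod ((\<Sum>(a, b)\<leftarrow>xs. contour_integral (linepath a b) (\<lambda>\<zeta>. f \<zeta> / (\<zeta> - w))) - (\<Sum>(c, \<zeta>)\<leftarrow>ps2. c / (\<zeta> - w))) \<le> d / 2"
      using Cons.IH[OF _ d2] Cons.prems(1) by (meson set_subset_Cons order_trans)
    show ?case
    proof (intro exI[of _ "ps1 @ ps2"] conjI ballI)
      show "case p of (c, \<zeta>) \<Rightarrow> \<zeta> \<notin> K" if "p \<in> set (ps1 @ ps2)" for p
        using that ps1(1) ps2(1) by auto
      show "cmod ((\<Sum>(a, b)\<leftarrow>x # xs. contour_integral (linepath a b) (\<lambda>\<zeta>. f \<zeta> / (\<zeta> - w))) - (\<Sum>(c, \<zeta>)\<leftarrow>ps1 @ ps2. c / (\<zeta> - w))) \<le> d"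
        if "w \<in> K" for w
      proof -
        have "(\<Sum>(a, b)\<leftarrow>x # xs. contour_integral (linepath a b) (\<lambda>\<zeta>. f \<zeta> / (\<zeta> - w))) - (\<Sum>(c, \<zeta>)\<leftarrow>ps1 @ ps2. c / (\<zeta> - w))
           = (contour_integral (linepath a b) (\<lambda>\<zeta>. f \<zeta> / (\<zeta> - w)) - (\<Sum>(c, \<zeta>)\<leftarrow>ps1. c / (\<zeta> - w)))
           + ((\<Sum>(a, b)\<leftarrow>xs. contour_integral (linepath a b) (\<lambda>\<zeta>. f \<zeta> / (\<zeta> - w))) - (\<Sum>(c, \<zeta>)\<leftarrow>ps2. c / (\<zeta> - w)))"
          by (simp add: x)
        then show ?thesis
          using norm_triangle_le[OF order_trans[OF add_mono[OF ps1(2)[OF that] ps2(2)[OF that]], of d]]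
          by (simp only:)
      qed
    qed
  qed
  obtain ps where ps: "\<forall>(c, \<zeta>)\<in>set ps. \<zeta> \<notin> K"
      "\<And>w. w \<in> K \<Longrightarrow> cmod (2 * pi * \<i> * f w - (\<Sum>(c, \<zeta>)\<leftarrow>ps. c / (\<zeta> - w))) \<le> 2 * pi * e"
    using approx[of E "2 * pi * e"] cauchy assms(5) by auto
  show ?thesis
  proof (rule that)
    define qs where "qs = map (\<lambda>(c, \<zeta>). (c / (2 * pi * \<i>), \<zeta>)) ps"
    show "\<forall>(c, \<zeta>)\<in>set qs. \<zeta> \<notin> K" using ps(1) by (auto simp: qs_def)
    show "cmod (f w - (\<Sum>(c, \<zeta>)\<leftarrow>qs. c / (\<zeta> - w))) \<le> e" if "w \<in> K" for w
    proof -
      have "(\<Sum>(c, \<zeta>)\<leftarrow>qs. c / (\<zeta> - w)) = (\<Sum>(c, \<zeta>)\<leftarrow>ps. 1 / (2 * pi * \<i>) * (c / (\<zeta> - w)))"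
        unfolding qs_def map_map by (rule arg_cong[of _ _ sum_list]) (auto simp: field_simps)
      also have "\<dots> = 1 / (2 * pi * \<i>) * (\<Sum>(c, \<zeta>)\<leftarrow>ps. c / (\<zeta> - w))"
        by (simp add: sum_list_const_mult[symmetric] case_prod_unfold)
      finally have "f w - (\<Sum>(c, \<zeta>)\<leftarrow>qs. c / (\<zeta> - w)) =
          (2 * pi * \<i> * f w - (\<Sum>(c, \<zeta>)\<leftarrow>ps. c / (\<zeta> - w))) / (2 * pi * \<i>)"
        by (simp add: field_simps)
      then have "cmod (f w - (\<Sum>(c, \<zeta>)\<leftarrow>qs. c / (\<zeta> - w))) =
          cmod (2 * pi * \<i> * f w - (\<Sum>(c, \<zeta>)\<leftarrow>ps. c / (\<zeta> - w))) / (2 * pi)"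
        by (simp add: norm_divide norm_mult)
      also have "\<dots> \<le> (2 * pi * e) / (2 * pi)"
        using ps(2)[OF that] by (intro divide_right_mono) auto
      finally show ?thesis by simp
    qed
  qed
qed

section \<open>Cauchy's theorem for cycles\<close>

text \<open>
  Cycles are lists of closed paths; integrals and winding numbers are added up along the list.
\<close>

abbreviation cycle_integral :: "(real \<Rightarrow> complex) list \<Rightarrow> (complex \<Rightarrow> complex) \<Rightarrow> complex"
  where "cycle_integral \<Gamma> f \<equiv> (\<Sum>\<gamma>\<leftarrow>\<Gamma>. contour_integral \<gamma> f)"

abbreviation cycle_winding :: "(real \<Rightarrow> complex) list \<Rightarrow> complex \<Rightarrow> complex"
  where "cycle_winding \<Gamma> z \<equiv> (\<Sum>\<gamma>\<leftarrow>\<Gamma>. winding_number \<gamma> z)"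

text \<open>
  A cycle in an open set \<open>U\<close>; openness of \<open>U\<close> is made part of the notion.
\<close>

definition cycle_in :: "(real \<Rightarrow> complex) list \<Rightarrow> complex set \<Rightarrow> bool"
  where "cycle_in \<Gamma> U \<longleftrightarrow> open U \<and>
    (\<forall>\<gamma>\<in>set \<Gamma>. valid_path \<gamma> \<and> pathfinish \<gamma> = pathstart \<gamma> \<and> path_image \<gamma> \<subseteq> U)"

lemma cycle_in_subset: "cycle_in \<Gamma> U \<Longrightarrow> open V \<Longrightarrow> (\<And>\<gamma>. \<gamma> \<in> set \<Gamma> \<Longrightarrow> path_image \<gamma> \<subseteq> V) \<Longrightarrow> cycle_in \<Gamma> V"
  by (auto simp: cycle_in_def)

lemma cycle_contour_integrable:
  assumes "cycle_in \<Gamma> U" "f holomorphic_on U" "\<gamma> \<in> set \<Gamma>"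
  shows "f contour_integrable_on \<gamma>"
  using assms by (intro contour_integrable_holomorphic_simple[of f U]) (auto simp: cycle_in_def)

lemma cycle_integral_add:
  assumes "cycle_in \<Gamma> U" "f holomorphic_on U" "g holomorphic_on U"
  shows "cycle_integral \<Gamma> (\<lambda>z. f z + g z) = cycle_integral \<Gamma> f + cycle_integral \<Gamma> g"
proof -
  have "map (\<lambda>\<gamma>. contour_integral \<gamma> (\<lambda>z. f z + g z)) \<Gamma> = map (\<lambda>\<gamma>. contour_integral \<gamma> f + contour_integral \<gamma> g) \<Gamma>"
    by (rule map_cong[OF refl]) (metis contour_integral_add cycle_contour_integrable assms)
  then show ?thesis by (simp only: sum_list_addf)
qed

lemma cycle_integral_diff:
  assumes "cycle_in \<Gamma> U" "f holomorphic_on U" "g holomorphic_on U"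
  shows "cycle_integral \<Gamma> (\<lambda>z. f z - g z) = cycle_integral \<Gamma> f - cycle_integral \<Gamma> g"
proof -
  have "map (\<lambda>\<gamma>. contour_integral \<gamma> (\<lambda>z. f z - g z)) \<Gamma> = map (\<lambda>\<gamma>. contour_integral \<gamma> f - contour_integral \<gamma> g) \<Gamma>"
    by (rule map_cong[OF refl]) (metis contour_integral_diff cycle_contour_integrable assms)
  then show ?thesis by (simp only: sum_list_subtractf)
qed

lemma cycle_integral_cmult:
  assumes "cycle_in \<Gamma> U" "f holomorphic_on U"
  shows "cycle_integral \<Gamma> (\<lambda>z. c * f z) = c * cycle_integral \<Gamma> f"
proof -
  have "map (\<lambda>\<gamma>. contour_integral \<gamma> (\<lambda>z. c * f z)) \<Gamma> = map (\<lambda>\<gamma>. c * contour_integral \<gamma> f) \<Gamma>"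
    by (rule map_cong[OF refl]) (metis contour_integral_lmul cycle_contour_integrable assms)
  then show ?thesis by (simp only: sum_list_const_mult)
qed

lemma cycle_integral_cong:
  assumes "cycle_in \<Gamma> U" "\<And>z. z \<in> U \<Longrightarrow> f z = g z"
  shows "cycle_integral \<Gamma> f = cycle_integral \<Gamma> g"
proof -
  have "map (\<lambda>\<gamma>. contour_integral \<gamma> f) \<Gamma> = map (\<lambda>\<gamma>. contour_integral \<gamma> g) \<Gamma>"
    by (rule map_cong[OF refl], rule contour_integral_eq) (use assms in \<open>auto simp: cycle_in_def\<close>)
  then show ?thesis by (simp only:)
qed

lemma cycle_integral_inverse_diff:
  assumes "cycle_in \<Gamma> U" "w \<notin> U"
  shows "cycle_integral \<Gamma> (\<lambda>z. 1 / (z - w)) = 2 * pi * \<i> * cycle_winding \<Gamma> w"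
proof -
  have "map (\<lambda>\<gamma>. contour_integral \<gamma> (\<lambda>z. 1 / (z - w))) \<Gamma> = map (\<lambda>\<gamma>. 2 * pi * \<i> * winding_number \<gamma> w) \<Gamma>"
  proof (rule map_cong[OF refl])
    fix \<gamma> assume "\<gamma> \<in> set \<Gamma>"
    then have "valid_path \<gamma>" "w \<notin> path_image \<gamma>" using assms by (auto simp: cycle_in_def)
    then show "contour_integral \<gamma> (\<lambda>z. 1 / (z - w)) = 2 * pi * \<i> * winding_number \<gamma> w"
      by (simp add: winding_number_valid_path)
  qed
  then show ?thesis by (simp only: sum_list_const_mult)
qed

text \<open>
  A valid path need not be rectifiable, because its derivative may be unbounded near finitely many
  points.  An integral is therefore estimated by the supremum of the integrand on a neighbourhood of
  the path, and for holomorphic integrands only.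
\<close>

lemma cycle_integral_bound:
  assumes "cycle_in \<Gamma> U"
  shows "\<exists>L\<ge>0. \<forall>f B. f holomorphic_on U \<and> B \<ge> 0 \<and> (\<forall>z\<in>U. cmod (f z) \<le> B) \<longrightarrow> cmod (cycle_integral \<Gamma> f) \<le> L * B"
  using assms
proof (induction \<Gamma>)
  case Nil
  show ?case by (intro exI[of _ 0]) auto
next
  case (Cons \<gamma> \<Gamma>)
  have "cycle_in \<Gamma> U" using Cons.prems by (auto simp: cycle_in_def)
  then obtain L where L: "L \<ge> 0" "\<And>f B. f holomorphic_on U \<Longrightarrow> B \<ge> 0 \<Longrightarrow> (\<forall>z\<in>U. cmod (f z) \<le> B) \<Longrightarrow> cmod (cycle_integral \<Gamma> f) \<le> L * B"
    using Cons.IH by blast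
  have "\<exists>L. 0 < L \<and> (\<forall>f B. f holomorphic_on U \<and> (\<forall>z \<in> U. norm(f z) \<le> B) \<longrightarrow> norm(contour_integral \<gamma> f) \<le> L*B)"
    using Cons.prems by (intro contour_integral_bound_exists) (auto simp: cycle_in_def)
  then obtain M where M: "0 < M" "\<And>f B. f holomorphic_on U \<Longrightarrow> (\<forall>z \<in> U. norm(f z) \<le> B) \<Longrightarrow> norm(contour_integral \<gamma> f) \<le> M*B"
    by blast
  show ?case
  proof (intro exI[of _ "M + L"] conjI allI impI)
    fix f B assume *: "f holomorphic_on U \<and> 0 \<le> B \<and> (\<forall>z\<in>U. cmod (f z) \<le> B)"
    have "cmod (cycle_integral (\<gamma> # \<Gamma>) f) \<le> cmod (contour_integral \<gamma> f) + cmod (cycle_integral \<Gamma> f)"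
      by (simp add: norm_triangle_ineq)
    also have "\<dots> \<le> M * B + L * B" using * L M by (intro add_mono) auto
    finally show "cmod (cycle_integral (\<gamma> # \<Gamma>) f) \<le> (M + L) * B" by (simp add: algebra_simps)
  qed (use L M in auto)
qed

lemma compact_neighbourhood_in_open:
  fixes I U :: "complex set"
  assumes "compact I" "open U" "I \<subseteq> U"
  obtains N K where "open N" "compact K" "I \<subseteq> N" "N \<subseteq> K" "K \<subseteq> U"
proof -
  obtain e where e: "e > 0" "(\<Union>x\<in>I. cball x e) \<subseteq> U"
    using compact_subset_open_imp_cball_epsilon_subset[OF assms] by blast
  show ?thesis
  proof (rule that)
    show "compact (\<Union>x\<in>I. \<Union>y\<in>cball 0 e. {x + y})"
      by (intro compact_sums' assms compact_cball)
    show "open (\<Union>x\<in>I. ball x e)" by auto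
    show "I \<subseteq> (\<Union>x\<in>I. ball x e)" using e by auto
    show "(\<Union>x\<in>I. ball x e) \<subseteq> (\<Union>x\<in>I. \<Union>y\<in>cball 0 e. {x + y})"
    proof
      fix z assume "z \<in> (\<Union>x\<in>I. ball x e)"
      then obtain x where "x \<in> I" "dist x z < e" by auto
      then show "z \<in> (\<Union>x\<in>I. \<Union>y\<in>cball 0 e. {x + y})"
        by (intro UN_I[of x] UN_I[of "z - x"]) (auto simp: dist_norm norm_minus_commute)
    qed
    show "(\<Union>x\<in>I. \<Union>y\<in>cball 0 e. {x + y}) \<subseteq> U"
    proof
      fix z assume "z \<in> (\<Union>x\<in>I. \<Union>y\<in>cball 0 e. {x + y})"
      then obtain x y where "x \<in> I" "norm y \<le> e" "z = x + y" by auto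
      then have "z \<in> (\<Union>x\<in>I. cball x e)" by (intro UN_I[of x]) (auto simp: dist_norm)
      with e show "z \<in> U" by blast
    qed
  qed
qed

lemma cycle_compact_image:
  assumes "cycle_in \<Gamma> U"
  shows "compact (\<Union>\<gamma>\<in>set \<Gamma>. path_image \<gamma>)"
  using assms by (intro compact_UN) (auto simp: cycle_in_def valid_path_imp_path)

text \<open>
  A cycle that is null-homologous in \<open>S\<close> is so in a compact subset of \<open>S\<close>: a compact neighbourhood of
  its image together with all points of non-zero winding number.
\<close>

lemma null_homologous_hull:
  assumes "cycle_in \<Gamma> S" and zero: "\<And>z. z \<notin> S \<Longrightarrow> cycle_winding \<Gamma> z = 0"
  obtains N K where "cycle_in \<Gamma> N" "compact K" "N \<subseteq> K" "K \<subseteq> S"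
    "\<And>z. z \<notin> K \<Longrightarrow> cycle_winding \<Gamma> z = 0"
proof -
  define I where "I = (\<Union>\<gamma>\<in>set \<Gamma>. path_image \<gamma>)"
  have I: "compact I" "I \<subseteq> S" "open S" 
    using cycle_compact_image[OF assms(1)] assms(1) by (auto simp: I_def cycle_in_def)
  obtain N K where NK: "open N" "compact K" "I \<subseteq> N" "N \<subseteq> K" "K \<subseteq> S"
    using compact_neighbourhood_in_open[OF I(1,3,2)] .
  define W where "W = {z. z \<notin> I \<and> cycle_winding \<Gamma> z = 0}"
  have paths: "path \<gamma>" "pathfinish \<gamma> = pathstart \<gamma>" "path_image \<gamma> \<subseteq> I" if "\<gamma> \<in> set \<Gamma>" for \<gamma>
    using that assms(1) by (auto simp: cycle_in_def valid_path_imp_path I_def)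
  have int: "cycle_winding \<Gamma> z \<in> \<int>" if "z \<notin> I" for z
  proof -
    have "(\<Sum>\<gamma>\<leftarrow>xs. winding_number \<gamma> z) \<in> \<int>" if "set xs \<subseteq> set \<Gamma>" for xs
      using that
    proof (induction xs)
      case (Cons x xs)
      then have "winding_number x z \<in> \<int>"
        using paths[of x] \<open>z \<notin> I\<close> by (intro integer_winding_number) auto
      with Cons show ?case by simp
    qed simp
    then show ?thesis by simp
  qed
  have "continuous_on (- I) (\<lambda>z. \<Sum>\<gamma>\<leftarrow>xs. winding_number \<gamma> z)" if "set xs \<subseteq> set \<Gamma>" for xs
    using that
  proof (induction xs)
    case (Cons x xs)
    then show ?case
      using paths[of x] continuous_on_winding_number[of x]
      by (auto intro!: continuous_intros intro: continuous_on_subset)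
  qed auto
  from this[OF order_refl] have "continuous_on (- I) (cycle_winding \<Gamma>)" .
  then have "open (- I \<inter> cycle_winding \<Gamma> -` ball 0 1)"
    using I(1) by (intro continuous_open_preimage) (auto simp: compact_imp_closed open_Compl)
  also have "- I \<inter> cycle_winding \<Gamma> -` ball 0 1 = W"
  proof -
    have "k = 0" if k: "k \<in> \<int>" "cmod k < 1" for k
    proof -
      obtain n where "k = of_int n" using k(1) by (rule Ints_cases)
      then show ?thesis using k(2) by (simp add: norm_of_int flip: of_int_abs)
    qed
    then show ?thesis using int by (auto simp: W_def)
  qed
  finally have W: "open W" .
  have nzb: "bounded {z. (\<Sum>\<gamma>\<leftarrow>xs. winding_number \<gamma> z) \<noteq> 0}" if "set xs \<subseteq> set \<Gamma>" for xs
    using that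
  proof (induction xs)
    case (Cons x xs)
    have "bounded ({z. winding_number x z \<noteq> 0} \<union> {z. (\<Sum>\<gamma>\<leftarrow>xs. winding_number \<gamma> z) \<noteq> 0})"
      using Cons paths[of x] by (auto intro!: bounded_winding_number_nz simp: bounded_Un)
    then show ?case by (rule bounded_subset) auto
  qed auto
  have "- W \<subseteq> I \<union> {z. cycle_winding \<Gamma> z \<noteq> 0}" by (auto simp: W_def)
  then have "bounded (- W)"
    using nzb[OF order_refl] compact_imp_bounded[OF I(1)] by (auto intro: bounded_subset[rotated])
  then have "compact (- W)" using W by (auto simp: compact_eq_bounded_closed closed_Compl)
  moreover have "- W \<subseteq> S" using zero I by (auto simp: W_def)
  moreover have "cycle_in \<Gamma> N"
    by (rule cycle_in_subset[OF assms(1) NK(1)]) (use paths(3) NK(3) in blast)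
  ultimately show ?thesis
    using NK by (intro that[of N "K \<union> - W"]) (auto simp: W_def)
qed

lemma rational_sum_holomorphic:
  assumes "\<And>c \<zeta>. (c, \<zeta>) \<in> set ps \<Longrightarrow> \<zeta> \<notin> U"
  shows "(\<lambda>w. \<Sum>(c, \<zeta>)\<leftarrow>ps. c / (\<zeta> - w)) holomorphic_on U"
  using assms
proof (induction ps)
  case Nil
  then show ?case by simp
next
  case (Cons p ps)
  obtain c \<zeta> where p: "p = (c, \<zeta>)" by (cases p)
  have "\<zeta> \<notin> U" using Cons.prems p by auto
  with Cons show ?case by (auto simp: p intro!: holomorphic_intros)
qed

text \<open>
  Under the integral along a null-homologous cycle, a holomorphic factor \<open>h\<close> may be replaced in the
  limit by rational functions without poles in the region where the winding number is non-zero.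
  The approximants do not depend on the other factor \<open>u\<close>, which need only be holomorphic near the
  cycle.
\<close>

theorem cycle_rational_approx:
  assumes "cycle_in \<Gamma> S" "\<And>z. z \<notin> S \<Longrightarrow> cycle_winding \<Gamma> z = 0" "h holomorphic_on S"
  obtains Q :: "nat \<Rightarrow> (complex \<times> complex) list" where
    "\<And>n c \<zeta>. (c, \<zeta>) \<in> set (Q n) \<Longrightarrow> \<zeta> \<notin> (\<Union>\<gamma>\<in>set \<Gamma>. path_image \<gamma>)"
    "\<And>n c \<zeta>. (c, \<zeta>) \<in> set (Q n) \<Longrightarrow> cycle_winding \<Gamma> \<zeta> = 0"
    "\<And>U u. cycle_in \<Gamma> U \<Longrightarrow> u holomorphic_on U \<Longrightarrow>
      (\<lambda>n. cycle_integral \<Gamma> (\<lambda>w. (\<Sum>(c, \<zeta>)\<leftarrow>Q n. c / (\<zeta> - w)) * u w)) \<longlonglongrightarrow> cycle_integral \<Gamma> (\<lambda>w. h w * u w)"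
proof -
  obtain N K where NK: "cycle_in \<Gamma> N" "compact K" "N \<subseteq> K" "K \<subseteq> S"
    "\<And>z. z \<notin> K \<Longrightarrow> cycle_winding \<Gamma> z = 0"
    using null_homologous_hull[OF assms(1,2)] by metis
  have S: "open S" using assms(1) by (simp add: cycle_in_def)
  have "\<exists>ps. (\<forall>(c, \<zeta>)\<in>set ps. \<zeta> \<notin> K) \<and> (\<forall>w\<in>K. cmod (h w - (\<Sum>(c, \<zeta>)\<leftarrow>ps. c / (\<zeta> - w))) \<le> inverse (real (Suc n)))" for n
    using runge_rational_approx[OF NK(2) S NK(4) assms(3), of "inverse (real (Suc n))"]
    by (metis inverse_positive_iff_positive of_nat_0_less_iff zero_less_Suc)
  then obtain Q where Q: "\<And>n. \<forall>(c, \<zeta>)\<in>set (Q n). \<zeta> \<notin> K"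
    "\<And>n w. w \<in> K \<Longrightarrow> cmod (h w - (\<Sum>(c, \<zeta>)\<leftarrow>Q n. c / (\<zeta> - w))) \<le> inverse (real (Suc n))"
    by metis
  have Q': "\<zeta> \<notin> K" if "(c, \<zeta>) \<in> set (Q n)" for n c \<zeta> using Q(1) that by blast
  show ?thesis
  proof (rule that)
    show "\<zeta> \<notin> (\<Union>\<gamma>\<in>set \<Gamma>. path_image \<gamma>)" if "(c, \<zeta>) \<in> set (Q n)" for n c \<zeta>
      using Q'[OF that] NK(1,3) by (auto simp: cycle_in_def)
    show "cycle_winding \<Gamma> \<zeta> = 0" if "(c, \<zeta>) \<in> set (Q n)" for n c \<zeta>
      using Q'[OF that] NK(5) by blast
    fix U u assume U: "cycle_in \<Gamma> U" and u: "u holomorphic_on U"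
    define q where "q = (\<lambda>n w. \<Sum>(c, \<zeta>)\<leftarrow>Q n. c / (\<zeta> - w))"
    have "cycle_in \<Gamma> (N \<inter> U)" using U NK(1) by (auto simp: cycle_in_def)
    then obtain N' K' where N': "open N'" "compact K'" "(\<Union>\<gamma>\<in>set \<Gamma>. path_image \<gamma>) \<subseteq> N'" "N' \<subseteq> K'" "K' \<subseteq> N \<inter> U"
      using compact_neighbourhood_in_open[OF cycle_compact_image[OF U], of "N \<inter> U"]
      unfolding cycle_in_def by (metis UN_least)
    have cyc: "cycle_in \<Gamma> N'" using N'(1,3) U by (auto simp: cycle_in_def)
    have "continuous_on K' u" using u N'(5) by (meson continuous_on_subset holomorphic_on_imp_continuous_on le_inf_iff)
    then have "bounded (u ` K')" using N'(2) by (simp add: compact_continuous_image compact_imp_bounded)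
    then obtain M where M: "M > 0" "\<And>z. z \<in> K' \<Longrightarrow> cmod (u z) \<le> M"
      by (auto simp: bounded_pos)
    obtain L where L: "L \<ge> 0" "\<And>f B. f holomorphic_on N' \<Longrightarrow> B \<ge> 0 \<Longrightarrow> \<forall>z\<in>N'. cmod (f z) \<le> B \<Longrightarrow> cmod (cycle_integral \<Gamma> f) \<le> L * B"
      using cycle_integral_bound[OF cyc] by blast
    have sub: "N' \<subseteq> K" "N' \<subseteq> U" "N' \<subseteq> S" using N' NK by blast+
    have hol: "(\<lambda>w. h w * u w) holomorphic_on N'" "(\<lambda>w. q n w * u w) holomorphic_on N'" for n
    proof -
      have "(\<lambda>w. \<Sum>(c, \<zeta>)\<leftarrow>Q n. c / (\<zeta> - w)) holomorphic_on N'"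
        using Q' sub by (intro rational_sum_holomorphic) blast
      then show "(\<lambda>w. h w * u w) holomorphic_on N'" "(\<lambda>w. q n w * u w) holomorphic_on N'"
        unfolding q_def using assms(3) u sub by (auto intro!: holomorphic_intros intro: holomorphic_on_subset)
    qed
    have est: "norm (cycle_integral \<Gamma> (\<lambda>w. q n w * u w) - cycle_integral \<Gamma> (\<lambda>w. h w * u w)) \<le> inverse (real (Suc n)) * (L * M)" for n
    proof -
      have "cmod (q n z * u z - h z * u z) \<le> inverse (real (Suc n)) * M" if "z \<in> N'" for z
      proof -
        have "cmod (q n z * u z - h z * u z) = cmod (h z - q n z) * cmod (u z)"
          by (simp add: norm_mult[symmetric] norm_minus_commute[of "q n z * u z"] left_diff_distrib)
        also have "\<dots> \<le> inverse (real (Suc n)) * M"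
          using Q(2)[of z n] M(2)[of z] that sub(1) N'(4) M(1) unfolding q_def
          by (intro mult_mono) auto
        finally show ?thesis .
      qed
      then have "cmod (cycle_integral \<Gamma> (\<lambda>w. q n w * u w - h w * u w)) \<le> L * (inverse (real (Suc n)) * M)"
        using M(1) by (intro L(2) holomorphic_on_diff hol) auto
      also have "cycle_integral \<Gamma> (\<lambda>w. q n w * u w - h w * u w) =
          cycle_integral \<Gamma> (\<lambda>w. q n w * u w) - cycle_integral \<Gamma> (\<lambda>w. h w * u w)"
        by (rule cycle_integral_diff[OF cyc hol(2) hol(1)])
      finally show ?thesis by (simp add: algebra_simps)
    qed
    have "(\<lambda>n. inverse (real (Suc n)) * (L * M)) \<longlonglongrightarrow> 0 * (L * M)"
      by (intro tendsto_intros LIMSEQ_inverse_real_of_nat)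
    then have "(\<lambda>n. inverse (real (Suc n)) * (L * M)) \<longlonglongrightarrow> 0" by simp
    then have "(\<lambda>n. cycle_integral \<Gamma> (\<lambda>w. q n w * u w) - cycle_integral \<Gamma> (\<lambda>w. h w * u w)) \<longlonglongrightarrow> 0"
      by (rule Lim_null_comparison[rotated]) (use est in auto)
    then show "(\<lambda>n. cycle_integral \<Gamma> (\<lambda>w. (\<Sum>(c, \<zeta>)\<leftarrow>Q n. c / (\<zeta> - w)) * u w)) \<longlonglongrightarrow> cycle_integral \<Gamma> (\<lambda>w. h w * u w)"
      unfolding q_def by (rule LIM_zero_cancel)
  qed
qed

theorem cauchy_cycle:
  assumes "cycle_in \<Gamma> S" "\<And>z. z \<notin> S \<Longrightarrow> cycle_winding \<Gamma> z = 0" "h holomorphic_on S"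
  shows "cycle_integral \<Gamma> h = 0"
proof -
  obtain Q :: "nat \<Rightarrow> (complex \<times> complex) list" where
    Q: "\<And>n c \<zeta>. (c, \<zeta>) \<in> set (Q n) \<Longrightarrow> \<zeta> \<notin> (\<Union>\<gamma>\<in>set \<Gamma>. path_image \<gamma>)"
    "\<And>n c \<zeta>. (c, \<zeta>) \<in> set (Q n) \<Longrightarrow> cycle_winding \<Gamma> \<zeta> = 0"
    "\<And>U u. cycle_in \<Gamma> U \<Longrightarrow> u holomorphic_on U \<Longrightarrow>
      (\<lambda>n. cycle_integral \<Gamma> (\<lambda>w. (\<Sum>(c, \<zeta>)\<leftarrow>Q n. c / (\<zeta> - w)) * u w)) \<longlonglongrightarrow> cycle_integral \<Gamma> (\<lambda>w. h w * u w)"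
    using cycle_rational_approx[OF assms] by blast
  have zero: "cycle_integral \<Gamma> (\<lambda>w. \<Sum>(c, \<zeta>)\<leftarrow>ps. c / (\<zeta> - w)) = 0" if "set ps \<subseteq> set (Q n)" for ps n
    using that
  proof (induction ps)
    case Nil
    then show ?case by (simp add: sum_list_0)
  next
    case (Cons p ps)
    obtain c \<zeta> where p: "p = (c, \<zeta>)" by (cases p)
    define U where "U = - ({\<zeta>} \<union> snd ` set ps)"
    have U: "cycle_in \<Gamma> U"
    proof (rule cycle_in_subset[OF assms(1)])
      show "open U" by (auto simp: U_def intro!: open_Compl finite_imp_closed)
      have "x \<notin> path_image \<gamma>" if x: "x \<in> {\<zeta>} \<union> snd ` set ps" "\<gamma> \<in> set \<Gamma>" for x \<gamma>
      proof -
        obtain d where "(d, x) \<in> set (Q n)" using x(1) Cons.prems p by force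
        then show ?thesis using Q(1) x(2) by blast
      qed
      then show "path_image \<gamma> \<subseteq> U" if "\<gamma> \<in> set \<Gamma>" for \<gamma> using that by (auto simp: U_def)
    qed
    have "cycle_integral \<Gamma> (\<lambda>w. \<Sum>(c, \<zeta>)\<leftarrow>p # ps. c / (\<zeta> - w)) =
        cycle_integral \<Gamma> (\<lambda>w. - c * (1 / (w - \<zeta>)) + (\<Sum>(c, \<zeta>)\<leftarrow>ps. c / (\<zeta> - w)))"
    proof (rule cycle_integral_cong[OF U])
      fix w
      have "c / (\<zeta> - w) = - (c / (w - \<zeta>))" by (subst minus_divide_right) simp
      then show "(\<Sum>(c, \<zeta>)\<leftarrow>p # ps. c / (\<zeta> - w)) = - c * (1 / (w - \<zeta>)) + (\<Sum>(c, \<zeta>)\<leftarrow>ps. c / (\<zeta> - w))"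
        by (simp add: p)
    qed
    also have "\<dots> = cycle_integral \<Gamma> (\<lambda>w. - c * (1 / (w - \<zeta>))) + cycle_integral \<Gamma> (\<lambda>w. \<Sum>(c, \<zeta>)\<leftarrow>ps. c / (\<zeta> - w))"
    proof (rule cycle_integral_add[OF U])
      show "(\<lambda>w. - c * (1 / (w - \<zeta>))) holomorphic_on U"
        by (auto intro!: holomorphic_intros simp: U_def)
      show "(\<lambda>w. \<Sum>(c, \<zeta>)\<leftarrow>ps. c / (\<zeta> - w)) holomorphic_on U"
        by (rule rational_sum_holomorphic) (force simp: U_def)
    qed
    also have "cycle_integral \<Gamma> (\<lambda>w. - c * (1 / (w - \<zeta>))) = - c * cycle_integral \<Gamma> (\<lambda>w. 1 / (w - \<zeta>))"
      by (rule cycle_integral_cmult[OF U]) (auto intro!: holomorphic_intros simp: U_def)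
    also have "cycle_integral \<Gamma> (\<lambda>w. 1 / (w - \<zeta>)) = 0"
      using cycle_integral_inverse_diff[OF U, of \<zeta>] Q(2)[of c \<zeta> n] Cons.prems p by (simp add: U_def)
    finally show ?case using Cons by simp
  qed
  have "(\<lambda>n. cycle_integral \<Gamma> (\<lambda>w. (\<Sum>(c, \<zeta>)\<leftarrow>Q n. c / (\<zeta> - w)) * 1)) \<longlonglongrightarrow> cycle_integral \<Gamma> (\<lambda>w. h w * 1)"
    by (rule Q(3)[OF assms(1)]) auto
  then have "(\<lambda>n. 0) \<longlonglongrightarrow> cycle_integral \<Gamma> h" using zero[OF order_refl] by simp
  then show ?thesis using LIMSEQ_unique tendsto_const by blast
qed

lemma cauchy_cycle_homologous:
  assumes "cycle_in \<Gamma>1 S" "cycle_in \<Gamma>2 S" "\<And>z. z \<notin> S \<Longrightarrow> cycle_winding \<Gamma>1 z = cycle_winding \<Gamma>2 z" "h holomorphic_on S"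
  shows "cycle_integral \<Gamma>1 h = cycle_integral \<Gamma>2 h"
proof -
  define \<Gamma> where "\<Gamma> = \<Gamma>1 @ map reversepath \<Gamma>2"
  have "cycle_in \<Gamma> S" using assms(1,2) by (auto simp: \<Gamma>_def cycle_in_def) blast
  moreover have "cycle_winding \<Gamma> z = 0" if "z \<notin> S" for z
  proof -
    have "map (\<lambda>\<gamma>. winding_number (reversepath \<gamma>) z) \<Gamma>2 = map (\<lambda>\<gamma>. - winding_number \<gamma> z) \<Gamma>2"
      by (rule map_cong[OF refl], rule winding_number_reversepath)
         (use that assms(2) in \<open>auto simp: cycle_in_def valid_path_imp_path\<close>)
    then have "(\<Sum>\<gamma>\<leftarrow>\<Gamma>2. winding_number (reversepath \<gamma>) z) = - cycle_winding \<Gamma>2 z"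
      by (simp only: uminus_sum_list_map o_def)
    then show ?thesis using assms(3)[OF that] by (simp add: \<Gamma>_def o_def)
  qed
  ultimately have zero: "cycle_integral \<Gamma> h = 0" using assms(4) by (rule cauchy_cycle)
  have "map (\<lambda>\<gamma>. contour_integral (reversepath \<gamma>) h) \<Gamma>2 = map (\<lambda>\<gamma>. - contour_integral \<gamma> h) \<Gamma>2"
    by (rule map_cong[OF refl], rule contour_integral_reversepath)
       (use assms(2) in \<open>auto simp: cycle_in_def\<close>)
  then have "(\<Sum>\<gamma>\<leftarrow>\<Gamma>2. contour_integral (reversepath \<gamma>) h) = - cycle_integral \<Gamma>2 h"
    by (simp only: uminus_sum_list_map o_def)
  with zero show ?thesis by (simp add: \<Gamma>_def o_def)
qed

section \<open>Bounded functionals separate points\<close>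

text \<open>
  Sublinear functionals below the norm.  Subhomogeneity for \<open>t > 0\<close> suffices, equality then follows.
\<close>

definition sublinear :: "('a::real_normed_vector \<Rightarrow> real) \<Rightarrow> bool"
  where "sublinear p \<longleftrightarrow> (\<forall>x y. p (x + y) \<le> p x + p y) \<and> (\<forall>t>0. \<forall>x. p (t *\<^sub>R x) \<le> t * p x) \<and> (\<forall>x. p x \<le> norm x)"

lemma sublinear_zero:
  assumes "sublinear p" shows "p 0 = 0"
proof -
  have "p (0 + 0) \<le> p 0 + p 0" using assms unfolding sublinear_def by blast
  then have "p 0 \<ge> 0" by simp
  moreover have "p 0 \<le> norm (0 :: 'a)" using assms unfolding sublinear_def by blast
  ultimately show ?thesis by simp
qed

lemma sublinear_scale:
  assumes "sublinear p" "t \<ge> 0" shows "p (t *\<^sub>R x) = t * p x"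
proof (cases "t = 0")
  case True
  then show ?thesis using sublinear_zero[OF assms(1)] by simp
next
  case False
  then have t: "t > 0" using assms by simp
  have "p (inverse t *\<^sub>R (t *\<^sub>R x)) \<le> inverse t * p (t *\<^sub>R x)"
    using assms positive_imp_inverse_positive[OF t] unfolding sublinear_def by blast
  then have "t * p x \<le> p (t *\<^sub>R x)" using t by (simp add: field_simps)
  moreover have "p (t *\<^sub>R x) \<le> t * p x" using assms t unfolding sublinear_def by blast
  ultimately show ?thesis by simp
qed

lemma sublinear_neg:
  assumes "sublinear p" shows "- p (- x) \<le> p x"
proof -
  have "p (x + - x) \<le> p x + p (- x)" using assms unfolding sublinear_def by blast
  then show ?thesis using sublinear_zero[OF assms] by simp
qed

lemma sublinear_lower:
  assumes "sublinear p" shows "- norm x \<le> p x"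
proof -
  have "p (- x) \<le> norm (- x)" using assms unfolding sublinear_def by blast
  then show ?thesis using sublinear_neg[OF assms, of x] by simp
qed

text \<open>
  The largest sublinear functional below \<open>p\<close> whose value at \<open>- a\<close> is at most \<open>- p a\<close>.  If \<open>p\<close> is minimal,
  it coincides with \<open>p\<close>, which forces \<open>p (- a) = - p a\<close>.
\<close>

definition push_down :: "('a::real_normed_vector \<Rightarrow> real) \<Rightarrow> 'a \<Rightarrow> 'a \<Rightarrow> real"
  where "push_down p a x = (INF t\<in>{0..}. p (x + t *\<^sub>R a) - t * p a)"

lemma sublinear_push_down:
  assumes p: "sublinear p"
  shows "sublinear (push_down p a)" "push_down p a x \<le> p x" "push_down p a (- a) \<le> - p a"
proof -
  have bdd: "bdd_below ((\<lambda>t. p (x + t *\<^sub>R a) - t * p a) ` {0..})" for x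
  proof (rule bdd_belowI2)
    fix t :: real assume t: "t \<in> {0..}"
    have "p ((x + t *\<^sub>R a) + - x) \<le> p (x + t *\<^sub>R a) + p (- x)" using p unfolding sublinear_def by blast
    then show "- p (- x) \<le> p (x + t *\<^sub>R a) - t * p a"
      using sublinear_scale[OF p, of t a] t by simp
  qed
  have le: "push_down p a x \<le> p (x + t *\<^sub>R a) - t * p a" if "t \<ge> 0" for x t
    unfolding push_down_def using that by (intro cINF_lower[OF bdd]) auto
  have ge: "c \<le> push_down p a x" if "\<And>t. t \<ge> 0 \<Longrightarrow> c \<le> p (x + t *\<^sub>R a) - t * p a" for c x
    unfolding push_down_def using that by (intro cINF_greatest) auto
  show lep: "push_down p a x \<le> p x" for x using le[of 0 x] by simp
  show "push_down p a (- a) \<le> - p a" using le[of 1 "- a"] sublinear_zero[OF p] by simp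
  show "sublinear (push_down p a)"
    unfolding sublinear_def
  proof (intro conjI allI impI)
    fix x y
    have "push_down p a (x + y) - (p (x + s *\<^sub>R a) - s * p a) \<le> p (y + t *\<^sub>R a) - t * p a" if "s \<ge> 0" "t \<ge> 0" for s t
    proof -
      have "push_down p a (x + y) \<le> p ((x + y) + (s + t) *\<^sub>R a) - (s + t) * p a" using that by (intro le) auto
      also have "(x + y) + (s + t) *\<^sub>R a = (x + s *\<^sub>R a) + (y + t *\<^sub>R a)" by (simp add: algebra_simps)
      also have "p \<dots> \<le> p (x + s *\<^sub>R a) + p (y + t *\<^sub>R a)" using p unfolding sublinear_def by blast
      finally show ?thesis by (simp add: algebra_simps)
    qed
    then have "push_down p a (x + y) - (p (x + s *\<^sub>R a) - s * p a) \<le> push_down p a y" if "s \<ge> 0" for s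
      using that by (intro ge) auto
    then have "push_down p a (x + y) - push_down p a y \<le> push_down p a x" by (intro ge) (auto simp: algebra_simps)
    then show "push_down p a (x + y) \<le> push_down p a x + push_down p a y" by simp
  next
    fix r :: real and x assume r: "r > 0"
    have "push_down p a (r *\<^sub>R x) / r \<le> push_down p a x"
    proof (rule ge)
      fix t :: real assume t: "t \<ge> 0"
      have "push_down p a (r *\<^sub>R x) \<le> p (r *\<^sub>R x + (r * t) *\<^sub>R a) - (r * t) * p a" using t r by (intro le) auto
      also have "r *\<^sub>R x + (r * t) *\<^sub>R a = r *\<^sub>R (x + t *\<^sub>R a)" by (simp add: algebra_simps)
      also have "p \<dots> = r * p (x + t *\<^sub>R a)" using r by (intro sublinear_scale[OF p]) auto
      finally show "push_down p a (r *\<^sub>R x) / r \<le> p (x + t *\<^sub>R a) - t * p a" using r by (simp add: field_simps)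
    qed
    then show "push_down p a (r *\<^sub>R x) \<le> r * push_down p a x" using r by (simp add: field_simps)
  next
    fix x show "push_down p a x \<le> norm x" using lep[of x] p unfolding sublinear_def by (meson order_trans)
  qed
qed

text \<open>
  The Hahn--Banach theorem in the form that is needed.  A minimal sublinear functional, obtained from
  Zorn's lemma, is odd and hence linear.
\<close>

lemma norming_functional:
  fixes x0 :: "'a::real_normed_vector"
  obtains m :: "'a \<Rightarrow> real" where "bounded_linear m" "m x0 = norm x0"
proof -
  have norm: "sublinear (norm :: 'a \<Rightarrow> real)"
    by (auto simp: sublinear_def norm_triangle_ineq)
  define p0 where "p0 = push_down norm x0"
  define A where "A = {p :: 'a \<Rightarrow> real. sublinear p \<and> p \<le> p0}"
  have "\<exists>m\<in>A. \<forall>a\<in>A. m \<ge> a \<longrightarrow> a = m"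
  proof (rule predicate_Zorn)
    show "partial_order_on A (relation_of (\<lambda>p q. p \<ge> q) A)"
      by (rule partial_order_on_relation_ofI) auto
    fix C assume C: "C \<in> Chains (relation_of (\<lambda>p q. p \<ge> q) A)"
    have CA: "C \<subseteq> A" using C by (rule Chains_relation_of)
    have lin: "p \<le> q \<or> q \<le> p" if "p \<in> C" "q \<in> C" for p q
      using C that by (auto simp: Chains_def relation_of_def)
    show "\<exists>u\<in>A. \<forall>a\<in>C. a \<ge> u"
    proof (cases "C = {}")
      case True
      have "p0 \<in> A" using sublinear_push_down(1)[OF norm] by (auto simp: A_def p0_def)
      with True show ?thesis by blast
    next
      case False
      define u where "u = (\<lambda>x. INF p\<in>C. p x)"
      have bdd: "bdd_below ((\<lambda>p. p x) ` C)" for x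
        using CA sublinear_lower by (intro bdd_belowI2[of _ "- norm x"]) (auto simp: A_def)
      have le: "u x \<le> p x" if "p \<in> C" for p x unfolding u_def using that by (intro cINF_lower[OF bdd])
      have ge: "c \<le> u x" if "\<And>p. p \<in> C \<Longrightarrow> c \<le> p x" for c x
        unfolding u_def using that False by (intro cINF_greatest) auto
      have sub: "sublinear p" if "p \<in> C" for p using CA that by (auto simp: A_def)
      obtain p1 where p1: "p1 \<in> C" using False by blast
      have "sublinear u"
        unfolding sublinear_def
      proof (intro conjI allI impI)
        fix x y
        have "u (x + y) - p x \<le> q y" if pq: "p \<in> C" "q \<in> C" for p q
        proof -
          obtain r where r: "r \<in> C" "r \<le> p" "r \<le> q" using lin[OF pq] pq by auto
          have "u (x + y) \<le> r (x + y)" by (rule le[OF r(1)])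
          also have "\<dots> \<le> r x + r y" using sub[OF r(1)] unfolding sublinear_def by blast
          also have "\<dots> \<le> p x + q y" using r by (intro add_mono) (auto simp: le_fun_def)
          finally show ?thesis by simp
        qed
        then have "u (x + y) - p x \<le> u y" if "p \<in> C" for p using that by (intro ge) auto
        then have "u (x + y) - u y \<le> u x" by (intro ge) (auto simp: algebra_simps)
        then show "u (x + y) \<le> u x + u y" by simp
      next
        fix r :: real and x assume r: "r > 0"
        have "u (r *\<^sub>R x) / r \<le> u x"
        proof (rule ge)
          fix p assume p: "p \<in> C"
          have "u (r *\<^sub>R x) \<le> p (r *\<^sub>R x)" by (rule le[OF p])
          also have "\<dots> = r * p x" using r by (intro sublinear_scale sub p) auto
          finally show "u (r *\<^sub>R x) / r \<le> p x" using r by (simp add: field_simps)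
        qed
        then show "u (r *\<^sub>R x) \<le> r * u x" using r by (simp add: field_simps)
      next
        fix x show "u x \<le> norm x" using le[OF p1, of x] sub[OF p1] unfolding sublinear_def by (meson order_trans)
      qed
      moreover have "p1 \<le> p0" using CA p1 by (auto simp: A_def)
      then have "u \<le> p0" using le[OF p1] by (auto simp: le_fun_def intro: order_trans)
      ultimately show ?thesis using le by (intro bexI[of _ u]) (auto simp: le_fun_def A_def)
    qed
  qed
  then obtain m where m: "m \<in> A" "\<And>a. a \<in> A \<Longrightarrow> a \<le> m \<Longrightarrow> a = m" by blast
  have sm: "sublinear m" and mp: "m \<le> p0" using m(1) by (auto simp: A_def)
  have pm: "push_down m a = m" for a
  proof (rule m(2))
    show *: "push_down m a \<le> m" using sublinear_push_down(2)[OF sm] by (auto simp: le_fun_def)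
    then show "push_down m a \<in> A" using mp sublinear_push_down(1)[OF sm] by (auto simp: A_def)
  qed
  have odd: "m (- a) = - m a" for a
    using sublinear_push_down(3)[OF sm, of a] sublinear_neg[OF sm, of a] unfolding pm by simp
  have add: "m (x + y) = m x + m y" for x y
  proof (rule antisym)
    show "m (x + y) \<le> m x + m y" using sm unfolding sublinear_def by blast
    have "m (- x + - y) \<le> m (- x) + m (- y)" using sm unfolding sublinear_def by blast
    moreover have "- x + - y = - (x + y)" by simp
    ultimately have "m (- (x + y)) \<le> m (- x) + m (- y)" by metis
    then show "m x + m y \<le> m (x + y)" by (simp only: odd)
  qed
  have scale: "m (r *\<^sub>R x) = r * m x" for r x
  proof (cases "r \<ge> 0")
    case True
    then show ?thesis by (rule sublinear_scale[OF sm])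
  next
    case False
    have "m (- ((- r) *\<^sub>R x)) = - ((- r) * m x)"
      unfolding odd using False by (subst sublinear_scale[OF sm]) auto
    then show ?thesis by simp
  qed
  have bnd: "norm (m x) \<le> norm x * 1" for x
    using sm sublinear_lower[OF sm, of x] unfolding sublinear_def by (simp add: abs_le_iff minus_le_iff)
  have "bounded_linear m"
    by (rule bounded_linear_intro[where K = 1]) (use add scale bnd in auto)
  moreover have "m x0 = norm x0"
  proof (rule antisym)
    show "m x0 \<le> norm x0" using sm unfolding sublinear_def by blast
    have "m (- x0) \<le> p0 (- x0)" using mp by (simp add: le_fun_def)
    also have "\<dots> \<le> - norm x0" unfolding p0_def by (rule sublinear_push_down(3)[OF norm])
    finally show "norm x0 \<le> m x0" by (simp add: odd)
  qed
  ultimately show ?thesis using that by blast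
qed

text \<open>
  Bounded complex-linear functionals.
\<close>

definition clinear_functional :: "('a::complex_normed_vector \<Rightarrow> complex) \<Rightarrow> bool"
  where "clinear_functional \<phi> \<longleftrightarrow> bounded_linear \<phi> \<and> (\<forall>c x. \<phi> (c *\<^sub>C x) = c * \<phi> x)"

lemma scaleC_Re_Im: "c *\<^sub>C x = Re c *\<^sub>R x + Im c *\<^sub>R (\<i> *\<^sub>C (x :: 'a::complex_normed_vector))"
proof -
  have "(complex_of_real (Re c) + complex_of_real (Im c) * \<i>) *\<^sub>C x = Re c *\<^sub>R x + Im c *\<^sub>R (\<i> *\<^sub>C x)"
    by (simp only: scaleC_add_left scaleC_scaleC[symmetric] scaleC_of_real)
  moreover have "complex_of_real (Re c) + complex_of_real (Im c) * \<i> = c"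
    by (simp add: complex_eq_iff)
  ultimately show ?thesis by (simp only:)
qed

theorem separating_functional:
  fixes x :: "'a::complex_normed_vector"
  assumes "x \<noteq> 0"
  obtains \<phi> where "clinear_functional \<phi>" "\<phi> x \<noteq> 0"
proof -
  obtain m where m: "bounded_linear m" "m x = norm x" by (rule norming_functional)
  interpret m: bounded_linear m by (rule m(1))
  define \<phi> where "\<phi> = (\<lambda>y. complex_of_real (m y) - \<i> * complex_of_real (m (\<i> *\<^sub>C y)))"
  have "bounded_linear (\<lambda>y. m (\<i> *\<^sub>C y))"
    by (rule bounded_linear_compose[OF m(1) bounded_linear_scaleC])
  then have bl: "bounded_linear \<phi>"
    unfolding \<phi>_def
    by (rule bounded_linear_sub[OF bounded_linear_compose[OF bounded_linear_of_real m(1)]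
          bounded_linear_compose[OF bounded_linear_mult_right bounded_linear_compose[OF bounded_linear_of_real]]])
  interpret p: bounded_linear \<phi> by (rule bl)
  have i: "\<phi> (\<i> *\<^sub>C y) = \<i> * \<phi> y" for y
  proof -
    have "\<i> *\<^sub>C \<i> *\<^sub>C y = - y"
      using scaleC_of_real[of "-1" y] by (simp add: scaleC_scaleC)
    then show ?thesis by (simp add: \<phi>_def m.neg algebra_simps)
  qed
  have "\<phi> (c *\<^sub>C y) = c * \<phi> y" for c y
  proof -
    have "\<phi> (c *\<^sub>C y) = Re c *\<^sub>R \<phi> y + Im c *\<^sub>R (\<i> * \<phi> y)"
      by (subst scaleC_Re_Im) (simp add: p.add p.scaleR i)
    also have "\<dots> = (complex_of_real (Re c) + \<i> * complex_of_real (Im c)) * \<phi> y"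
      by (simp add: scaleR_conv_of_real algebra_simps)
    also have "complex_of_real (Re c) + \<i> * complex_of_real (Im c) = c"
      by (simp add: complex_eq_iff)
    finally show ?thesis .
  qed
  moreover have "Re (\<phi> x) = norm x" by (simp add: \<phi>_def m(2))
  then have "\<phi> x \<noteq> 0" using assms by auto
  ultimately show ?thesis using bl that unfolding clinear_functional_def by blast
qed

section \<open>Spectrum and resolvent\<close>

lemma scaleC_zero_left [simp]: "0 *\<^sub>C (x :: 'a::complex_normed_vector) = 0"
  by (rule complex_vector.scale_zero_left)

lemma scaleC_zero_right [simp]: "c *\<^sub>C (0 :: 'a::complex_normed_vector) = 0"
  by (rule complex_vector.scale_zero_right)

lemma scaleC_diff_right: "c *\<^sub>C (x - y) = c *\<^sub>C x - c *\<^sub>C (y :: 'a::complex_normed_vector)"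
  by (rule complex_vector.scale_right_diff_distrib)

lemma scaleC_diff_left: "(c - d) *\<^sub>C x = c *\<^sub>C x - d *\<^sub>C (x :: 'a::complex_normed_vector)"
  by (rule complex_vector.scale_left_diff_distrib)

lemma scaleC_minus_left: "(- c) *\<^sub>C x = - (c *\<^sub>C (x :: 'a::complex_normed_vector))"
  by (rule complex_vector.scale_minus_left)

lemma bounded_linear_scaleC_left: "bounded_linear (\<lambda>c. c *\<^sub>C (x :: 'a::complex_normed_vector))"
proof (rule bounded_linear_intro[where K = "norm x"])
  show "(r *\<^sub>R c) *\<^sub>C x = r *\<^sub>R c *\<^sub>C x" for r c
    by (simp only: scaleR_conv_of_real scaleC_scaleC[symmetric] scaleC_of_real)
qed (simp_all add: scaleC_add_left norm_scaleC)

lemma complex_linear_opD: "complex_linear_op T \<Longrightarrow> blinfun_apply T (c *\<^sub>C x) = c *\<^sub>C blinfun_apply T x"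
  by (simp add: complex_linear_op_def)

lemma complex_linear_op_id: "complex_linear_op id_blinfun"
  by (simp add: complex_linear_op_def)

lemma complex_linear_op_compose: "complex_linear_op S \<Longrightarrow> complex_linear_op T \<Longrightarrow> complex_linear_op (S o\<^sub>L T)"
  by (simp add: complex_linear_op_def)

lemma complex_linear_op_scale: "complex_linear_op S \<Longrightarrow> complex_linear_op (c *\<^sub>C S)"
  by (simp add: complex_linear_op_def scaleC_blinfun.rep_eq scaleC_scaleC mult.commute)

lemma scaleC_compose_left: "(c *\<^sub>C S) o\<^sub>L T = c *\<^sub>C (S o\<^sub>L T)"
  by (rule blinfun_eqI) (simp add: scaleC_blinfun.rep_eq)

lemma scaleC_compose_right: "complex_linear_op S \<Longrightarrow> S o\<^sub>L (c *\<^sub>C T) = c *\<^sub>C (S o\<^sub>L T)"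
  by (rule blinfun_eqI) (simp add: scaleC_blinfun.rep_eq complex_linear_opD)

lemma compose_add_right: "T o\<^sub>L (S1 + S2) = (T o\<^sub>L S1) + (T o\<^sub>L S2)"
  by (rule blinfun_eqI) (simp add: blinfun.bilinear_simps)

lemma compose_diff_left: "(S1 - S2) o\<^sub>L T = (S1 o\<^sub>L T) - (S2 o\<^sub>L T)"
  by (rule blinfun_eqI) (simp add: blinfun.bilinear_simps)

lemma compose_diff_right: "T o\<^sub>L (S1 - S2) = (T o\<^sub>L S1) - (T o\<^sub>L S2)"
  by (rule blinfun_eqI) (simp add: blinfun.bilinear_simps)

lemma blinfun_compose_assoc: "(R o\<^sub>L S) o\<^sub>L T = R o\<^sub>L (S o\<^sub>L T)"
  by (rule blinfun_eqI) simp

lemma compose_id: "id_blinfun o\<^sub>L T = T" "T o\<^sub>L id_blinfun = T"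
  by (rule blinfun_eqI, simp)+

text \<open>
  Powers of an operator with respect to composition.
\<close>

definition blinfun_power :: "('a::real_normed_vector \<Rightarrow>\<^sub>L 'a) \<Rightarrow> nat \<Rightarrow> 'a \<Rightarrow>\<^sub>L 'a"
  where "blinfun_power A n = (((o\<^sub>L) A) ^^ n) id_blinfun"

lemma blinfun_power_0 [simp]: "blinfun_power A 0 = id_blinfun"
  by (simp add: blinfun_power_def)

lemma blinfun_power_Suc: "blinfun_power A (Suc n) = A o\<^sub>L blinfun_power A n"
  by (simp add: blinfun_power_def)

lemma blinfun_power_Suc_right: "blinfun_power A (Suc n) = blinfun_power A n o\<^sub>L A"
  by (induction n) (simp_all add: blinfun_power_Suc compose_id flip: blinfun_compose_assoc)

lemma norm_blinfun_power: "norm (blinfun_power A n) \<le> norm A ^ n"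
proof (induction n)
  case 0
  then show ?case by (simp add: norm_blinfun_id_le)
next
  case (Suc n)
  have "norm (blinfun_power A (Suc n)) \<le> norm A * norm (blinfun_power A n)"
    unfolding blinfun_power_Suc by (rule norm_blinfun_compose)
  also have "\<dots> \<le> norm A * norm A ^ n" using Suc by (intro mult_left_mono) auto
  finally show ?case by simp
qed

lemma complex_linear_op_power: "complex_linear_op A \<Longrightarrow> complex_linear_op (blinfun_power A n)"
  by (induction n) (simp_all add: blinfun_power_Suc complex_linear_op_id complex_linear_op_compose)

lemma neumann_series:
  fixes A :: "'a::complex_banach \<Rightarrow>\<^sub>L 'a"
  assumes A: "complex_linear_op A" "norm A < 1"
  obtains S where "is_inverse_op (id_blinfun - A) S" "norm S \<le> 1 / (1 - norm A)"
proof -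
  define P where "P = blinfun_power A"
  have sumP: "summable P"
    by (rule summable_comparison_test'[where g = "\<lambda>n. norm A ^ n" and N = 0])
       (use A norm_blinfun_power in \<open>auto simp: P_def summable_geometric\<close>)
  define S where "S = suminf P"
  have shift: "(\<Sum>n. P (Suc n)) = S - id_blinfun"
    using suminf_split_head[OF sumP] by (simp add: S_def P_def)
  have "A o\<^sub>L S = (\<Sum>n. A o\<^sub>L P n)"
    unfolding S_def
    by (rule bounded_linear.suminf[OF bounded_bilinear.bounded_linear_right[OF bounded_bilinear_blinfun_compose] sumP])
  then have AS: "A o\<^sub>L S = S - id_blinfun"
    using shift by (simp add: P_def blinfun_power_Suc)
  have "S o\<^sub>L A = (\<Sum>n. P n o\<^sub>L A)"
    unfolding S_def
    by (rule bounded_linear.suminf[OF bounded_bilinear.bounded_linear_left[OF bounded_bilinear_blinfun_compose] sumP])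
  then have SA: "S o\<^sub>L A = S - id_blinfun"
    using shift by (simp add: P_def blinfun_power_Suc_right)
  have "complex_linear_op S"
    unfolding complex_linear_op_def
  proof (intro allI)
    fix c x
    have app: "blinfun_apply S y = (\<Sum>n. blinfun_apply (P n) y)" for y
      unfolding S_def by (rule bounded_linear.suminf[OF blinfun.bounded_linear_left sumP])
    have "summable (\<lambda>n. blinfun_apply (P n) x)"
      by (rule bounded_linear.summable[OF blinfun.bounded_linear_left sumP])
    then have "c *\<^sub>C blinfun_apply S x = (\<Sum>n. c *\<^sub>C blinfun_apply (P n) x)"
      unfolding app by (rule bounded_linear.suminf[OF bounded_linear_scaleC])
    then show "blinfun_apply S (c *\<^sub>C x) = c *\<^sub>C blinfun_apply S x"
      unfolding app[of "c *\<^sub>C x"] using complex_linear_op_power[OF A(1)] by (simp add: P_def complex_linear_opD)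
  qed
  then have inv: "is_inverse_op (id_blinfun - A) S"
    using AS SA by (simp add: is_inverse_op_def compose_diff_left compose_diff_right compose_id)
  have "norm S \<le> norm (id_blinfun :: 'a \<Rightarrow>\<^sub>L 'a) + norm (S o\<^sub>L A)"
    using norm_triangle_ineq[of id_blinfun "S o\<^sub>L A"] SA by simp
  also have "\<dots> \<le> 1 + norm S * norm A"
    by (intro add_mono norm_blinfun_id_le norm_blinfun_compose)
  finally have "norm S \<le> 1 / (1 - norm A)" using A(2) by (simp add: field_simps)
  with inv that show ?thesis by blast
qed

lemma is_inverse_op_unique:
  assumes "is_inverse_op T S1" "is_inverse_op T S2"
  shows "S1 = S2"
proof -
  have "S1 = S1 o\<^sub>L (T o\<^sub>L S2)" using assms by (simp add: is_inverse_op_def compose_id)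
  also have "\<dots> = (S1 o\<^sub>L T) o\<^sub>L S2" by (simp add: blinfun_compose_assoc)
  finally show ?thesis using assms by (simp add: is_inverse_op_def compose_id)
qed

lemma resolvent_inverse:
  assumes "z \<notin> op_spectrum T"
  shows "is_inverse_op (z *\<^sub>C id_blinfun - T) (resolvent T z)"
proof -
  obtain S where S: "is_inverse_op (z *\<^sub>C id_blinfun - T) S" using assms by (auto simp: op_spectrum_def)
  show ?thesis
    unfolding resolvent_def by (rule theI[of _ S]) (use S is_inverse_op_unique in blast)+
qed

lemma resolvent_eqI:
  assumes "is_inverse_op (z *\<^sub>C id_blinfun - T) S"
  shows "z \<notin> op_spectrum T" "resolvent T z = S"
proof -
  show "z \<notin> op_spectrum T" using assms by (auto simp: op_spectrum_def)
  then show "resolvent T z = S" using resolvent_inverse is_inverse_op_unique assms by blast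
qed

lemma is_inverse_op_compose:
  assumes "is_inverse_op X S1" "is_inverse_op Y S2"
  shows "is_inverse_op (X o\<^sub>L Y) (S2 o\<^sub>L S1)"
proof -
  have "(S2 o\<^sub>L S1) o\<^sub>L (X o\<^sub>L Y) = S2 o\<^sub>L ((S1 o\<^sub>L X) o\<^sub>L Y)"
    "(X o\<^sub>L Y) o\<^sub>L (S2 o\<^sub>L S1) = X o\<^sub>L ((Y o\<^sub>L S2) o\<^sub>L S1)"
    by (simp_all add: blinfun_compose_assoc)
  then show ?thesis using assms
    by (simp add: is_inverse_op_def compose_id complex_linear_op_compose)
qed

lemma resolvent_complex_linear: "z \<notin> op_spectrum T \<Longrightarrow> complex_linear_op (resolvent T z)"
  using resolvent_inverse by (auto simp: is_inverse_op_def)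

lemma resolvent_left:
  assumes "z \<notin> op_spectrum T"
  shows "blinfun_apply (resolvent T z) (blinfun_apply T x) = z *\<^sub>C blinfun_apply (resolvent T z) x - x"
proof -
  have "blinfun_apply (resolvent T z o\<^sub>L (z *\<^sub>C id_blinfun - T)) x = x"
    using resolvent_inverse[OF assms] by (simp add: is_inverse_op_def)
  then show ?thesis
    by (simp add: blinfun.bilinear_simps scaleC_blinfun.rep_eq complex_linear_opD[OF resolvent_complex_linear[OF assms]] algebra_simps)
qed

lemma resolvent_right:
  assumes "z \<notin> op_spectrum T"
  shows "blinfun_apply T (blinfun_apply (resolvent T z) x) = z *\<^sub>C blinfun_apply (resolvent T z) x - x"
proof -
  have "blinfun_apply ((z *\<^sub>C id_blinfun - T) o\<^sub>L resolvent T z) x = x"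
    using resolvent_inverse[OF assms] by (simp add: is_inverse_op_def)
  then show ?thesis
    by (simp add: blinfun.bilinear_simps scaleC_blinfun.rep_eq algebra_simps)
qed

lemma resolvent_identity:
  assumes z: "z \<notin> op_spectrum T" and w: "w \<notin> op_spectrum T"
  shows "resolvent T z - resolvent T w = (w - z) *\<^sub>C (resolvent T z o\<^sub>L resolvent T w)"
proof (rule blinfun_eqI)
  fix x
  let ?y = "blinfun_apply (resolvent T w) x"
  have "blinfun_apply (resolvent T z) (blinfun_apply T ?y) = w *\<^sub>C blinfun_apply (resolvent T z) ?y - blinfun_apply (resolvent T z) x"
    unfolding resolvent_right[OF w] by (simp add: blinfun.bilinear_simps complex_linear_opD[OF resolvent_complex_linear[OF z]])
  then show "blinfun_apply (resolvent T z - resolvent T w) x = blinfun_apply ((w - z) *\<^sub>C (resolvent T z o\<^sub>L resolvent T w)) x"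
    unfolding resolvent_left[OF z] by (simp add: blinfun.bilinear_simps scaleC_blinfun.rep_eq scaleC_diff_left algebra_simps)
qed

lemma resolvent_nearby:
  fixes T :: "'a::complex_banach \<Rightarrow>\<^sub>L 'a"
  assumes z: "z \<notin> op_spectrum T" and w: "cmod (w - z) * norm (resolvent T z) \<le> 1/2"
  shows "w \<notin> op_spectrum T" "norm (resolvent T w) \<le> 2 * norm (resolvent T z)"
proof -
  let ?R = "resolvent T z"
  \<comment> \<open>\<open>w - T = (1 - A) (z - T)\<close> for this \<open>A\<close>.\<close>
  define A where "A = (z - w) *\<^sub>C ?R"
  have R: "complex_linear_op ?R" by (rule resolvent_complex_linear[OF z])
  have A: "complex_linear_op A" "norm A \<le> 1/2"
    using R w by (auto simp: A_def complex_linear_op_scale norm_scaleC norm_minus_commute)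
  then obtain S where S: "is_inverse_op (id_blinfun - A) S" "norm S \<le> 1 / (1 - norm A)"
    using neumann_series[of A] by auto
  have inv: "is_inverse_op (z *\<^sub>C id_blinfun - T) ?R" by (rule resolvent_inverse[OF z])
  have "A o\<^sub>L (z *\<^sub>C id_blinfun - T) = (z - w) *\<^sub>C id_blinfun"
    using inv by (simp add: A_def scaleC_compose_left is_inverse_op_def)
  then have "(id_blinfun - A) o\<^sub>L (z *\<^sub>C id_blinfun - T) = w *\<^sub>C id_blinfun - T"
    unfolding compose_diff_left[of id_blinfun] by (simp add: compose_id scaleC_diff_left)
  then have "is_inverse_op (w *\<^sub>C id_blinfun - T) (?R o\<^sub>L S)"
    using is_inverse_op_compose[OF S(1) inv] by simp
  note * = resolvent_eqI[OF this]
  show "w \<notin> op_spectrum T" by (rule *(1))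
  have "norm S \<le> 2"
    using S(2) A(2) by (rule_tac order_trans[OF S(2)]) (simp add: field_simps)
  then have "norm ?R * norm S \<le> norm ?R * 2" by (intro mult_left_mono) auto
  then show "norm (resolvent T w) \<le> 2 * norm ?R"
    unfolding *(2) using norm_blinfun_compose[of ?R S] by simp
qed

lemma resolvent_far:
  fixes T :: "'a::complex_banach \<Rightarrow>\<^sub>L 'a"
  assumes T: "complex_linear_op T" and z: "cmod z > norm T"
  shows "z \<notin> op_spectrum T" "norm (resolvent T z) \<le> 1 / (cmod z - norm T)"
proof -
  have z0: "z \<noteq> 0" using z norm_ge_zero[of T] by auto
  define A where "A = inverse z *\<^sub>C T"
  have nA: "norm A = norm T / cmod z" by (simp add: A_def norm_scaleC norm_inverse divide_inverse)
  then have A: "complex_linear_op A" "norm A < 1"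
    using T z z0 by (simp add: A_def complex_linear_op_scale, simp)
  obtain S where S: "is_inverse_op (id_blinfun - A) S" "norm S \<le> 1 / (1 - norm A)"
    using neumann_series[OF A] .
  have "is_inverse_op (z *\<^sub>C (id_blinfun :: 'a \<Rightarrow>\<^sub>L 'a)) (inverse z *\<^sub>C id_blinfun)"
    using z0 by (auto simp: is_inverse_op_def complex_linear_op_scale complex_linear_op_id
        intro!: blinfun_eqI simp: scaleC_blinfun.rep_eq scaleC_scaleC scaleC_one)
  from is_inverse_op_compose[OF this S(1)]
  have "is_inverse_op ((z *\<^sub>C id_blinfun) o\<^sub>L (id_blinfun - A)) (S o\<^sub>L (inverse z *\<^sub>C id_blinfun))" .
  moreover have "(z *\<^sub>C id_blinfun) o\<^sub>L (id_blinfun - A) = z *\<^sub>C id_blinfun - T"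
    using z0 by (simp add: A_def scaleC_compose_left compose_id scaleC_diff_right scaleC_scaleC scaleC_one)
  moreover have "S o\<^sub>L (inverse z *\<^sub>C id_blinfun) = inverse z *\<^sub>C S"
    using S(1) by (simp add: scaleC_compose_right compose_id is_inverse_op_def)
  ultimately have "is_inverse_op (z *\<^sub>C id_blinfun - T) (inverse z *\<^sub>C S)" by simp
  note * = resolvent_eqI[OF this]
  show "z \<notin> op_spectrum T" by (rule *(1))
  have "norm (resolvent T z) = inverse (cmod z) * norm S"
    by (simp add: *(2) norm_scaleC norm_inverse)
  also have "\<dots> \<le> inverse (cmod z) * (1 / (1 - norm A))"
    using S(2) by (intro mult_left_mono) auto
  also have "\<dots> = 1 / (cmod z - norm T)"
    using z0 z by (simp add: nA field_simps)
  finally show "norm (resolvent T z) \<le> 1 / (cmod z - norm T)" .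
qed

lemma open_resolvent_set:
  fixes T :: "'a::complex_banach \<Rightarrow>\<^sub>L 'a"
  shows "open (- op_spectrum T)"
proof (rule openI)
  fix z assume "z \<in> - op_spectrum T"
  then have z: "z \<notin> op_spectrum T" by simp
  define e where "e = 1 / (2 * (norm (resolvent T z) + 1))"
  have e: "e > 0" by (simp add: e_def add_nonneg_pos)
  have "w \<in> - op_spectrum T" if "w \<in> ball z e" for w
  proof -
    have "cmod (w - z) * norm (resolvent T z) \<le> e * (norm (resolvent T z) + 1)"
      using that e by (intro mult_mono) (auto simp: dist_norm norm_minus_commute)
    also have "\<dots> = 1/2" by (simp add: e_def add_nonneg_eq_0_iff field_simps add_pos_nonneg)
    finally show ?thesis using resolvent_nearby(1)[OF z] by simp
  qed
  with e show "\<exists>e>0. ball z e \<subseteq> - op_spectrum T" by blast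
qed

lemma compact_op_spectrum:
  fixes T :: "'a::complex_banach \<Rightarrow>\<^sub>L 'a"
  assumes "complex_linear_op T"
  shows "compact (op_spectrum T)"
proof -
  have "op_spectrum T \<subseteq> cball 0 (norm T)"
    using resolvent_far(1)[OF assms] by (auto simp: not_less[symmetric])
  then have "bounded (op_spectrum T)" by (rule bounded_subset[OF bounded_cball])
  then show ?thesis using open_resolvent_set[of T] by (simp add: compact_eq_bounded_closed closed_def)
qed

lemma resolvent_local_bound:
  fixes T :: "'a::complex_banach \<Rightarrow>\<^sub>L 'a"
  assumes z: "z \<notin> op_spectrum T"
  obtains e where "e > 0" "e * norm (resolvent T z) \<le> 1/2"
    "\<And>w. w \<in> ball z e \<Longrightarrow> w \<notin> op_spectrum T"
    "\<And>w. w \<in> ball z e \<Longrightarrow> norm (resolvent T w) \<le> 2 * norm (resolvent T z)"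
proof -
  define e where "e = 1 / (2 * (norm (resolvent T z) + 1))"
  have pos: "norm (resolvent T z) + 1 > 0" by (simp add: add_nonneg_pos)
  have e: "e > 0" using pos by (simp add: e_def)
  have eR: "e * norm (resolvent T z) \<le> 1/2"
    using pos by (simp add: e_def field_simps)
  have "cmod (w - z) * norm (resolvent T z) \<le> 1/2" if "w \<in> ball z e" for w
  proof -
    have "cmod (w - z) * norm (resolvent T z) \<le> e * norm (resolvent T z)"
      using that by (intro mult_right_mono) (auto simp: dist_norm norm_minus_commute)
    with eR show ?thesis by simp
  qed
  with resolvent_nearby[OF z] e eR that show ?thesis by blast
qed

lemma isCont_resolvent:
  fixes T :: "'a::complex_banach \<Rightarrow>\<^sub>L 'a"
  assumes z: "z \<notin> op_spectrum T"
  shows "isCont (resolvent T) z"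
proof -
  obtain e where e: "e > 0" "\<And>w. w \<in> ball z e \<Longrightarrow> w \<notin> op_spectrum T"
    "\<And>w. w \<in> ball z e \<Longrightarrow> norm (resolvent T w) \<le> 2 * norm (resolvent T z)"
    using resolvent_local_bound[OF z] by metis
  let ?M = "norm (resolvent T z)"
  have ev: "eventually (\<lambda>w. norm (resolvent T w - resolvent T z) \<le> cmod (z - w) * (2 * ?M * ?M)) (at z)"
  proof (rule eventually_at_ball'[THEN eventually_mono, OF e(1)])
    fix w assume "w \<in> ball z e \<and> w \<noteq> z \<and> w \<in> UNIV"
    then have w: "w \<in> ball z e" by blast
    have "norm (resolvent T w o\<^sub>L resolvent T z) \<le> norm (resolvent T w) * ?M"
      by (rule norm_blinfun_compose)
    also have "\<dots> \<le> 2 * ?M * ?M" using e(3)[OF w] by (intro mult_right_mono) auto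
    finally show "norm (resolvent T w - resolvent T z) \<le> cmod (z - w) * (2 * ?M * ?M)"
      unfolding resolvent_identity[OF e(2)[OF w] z] norm_scaleC by (intro mult_left_mono) auto
  qed
  have "((\<lambda>w. cmod (z - w) * (2 * ?M * ?M)) \<longlongrightarrow> cmod (z - z) * (2 * ?M * ?M)) (at z)"
    by (intro tendsto_intros)
  then have "((\<lambda>w. cmod (z - w) * (2 * ?M * ?M)) \<longlongrightarrow> 0) (at z)" by simp
  then have "((\<lambda>w. resolvent T w - resolvent T z) \<longlongrightarrow> 0) (at z)"
    by (rule Lim_null_comparison[OF ev])
  then show ?thesis unfolding isCont_def by (rule LIM_zero_cancel)
qed

lemma clinear_functionalD:
  assumes "clinear_functional \<phi>"
  shows "bounded_linear \<phi>" "\<phi> (c *\<^sub>C x) = c * \<phi> x" "\<phi> (x + y) = \<phi> x + \<phi> y" "\<phi> (x - y) = \<phi> x - \<phi> y" "\<phi> 0 = 0"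
proof -
  show bl: "bounded_linear \<phi>" "\<phi> (c *\<^sub>C x) = c * \<phi> x" using assms by (auto simp: clinear_functional_def)
  interpret bounded_linear \<phi> by (rule bl)
  show "\<phi> (x + y) = \<phi> x + \<phi> y" "\<phi> (x - y) = \<phi> x - \<phi> y" "\<phi> 0 = 0" by (simp_all add: add diff zero)
qed

lemma functional_resolvent_holomorphic:
  fixes T :: "'a::complex_banach \<Rightarrow>\<^sub>L 'a"
  assumes \<phi>: "clinear_functional \<phi>"
  shows "(\<lambda>z. \<phi> (blinfun_apply (resolvent T z) x)) holomorphic_on - op_spectrum T"
proof (rule holomorphic_onI)
  fix z assume "z \<in> - op_spectrum T"
  then have z: "z \<notin> op_spectrum T" by simp
  define F where "F = (\<lambda>z. \<phi> (blinfun_apply (resolvent T z) x))"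
  let ?y = "blinfun_apply (resolvent T z) x"
  have "((\<lambda>w. - \<phi> (blinfun_apply (resolvent T w) ?y)) \<longlongrightarrow> - \<phi> (blinfun_apply (resolvent T z) ?y)) (at z)"
    using isCont_resolvent[OF z] unfolding isCont_def
    by (intro tendsto_intros bounded_linear.tendsto[OF clinear_functionalD(1)[OF \<phi>]])
  moreover have "eventually (\<lambda>w. (F w - F z) / (w - z) = - \<phi> (blinfun_apply (resolvent T w) ?y)) (at z)"
  proof -
    obtain e where e: "e > 0" "\<And>w. w \<in> ball z e \<Longrightarrow> w \<notin> op_spectrum T"
      using resolvent_local_bound[OF z] by metis
    show ?thesis
    proof (rule eventually_at_ball'[THEN eventually_mono, OF e(1)])
      fix w assume w: "w \<in> ball z e \<and> w \<noteq> z \<and> w \<in> UNIV"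
      have "F w - F z = \<phi> (blinfun_apply (resolvent T w - resolvent T z) x)"
        by (simp add: F_def blinfun.bilinear_simps clinear_functionalD[OF \<phi>])
      also have "\<dots> = (z - w) * \<phi> (blinfun_apply (resolvent T w) ?y)"
        using resolvent_identity[OF e(2) z, of w] w
        by (simp add: scaleC_blinfun.rep_eq clinear_functionalD[OF \<phi>])
      finally show "(F w - F z) / (w - z) = - \<phi> (blinfun_apply (resolvent T w) ?y)"
        using w by (simp add: field_simps)
    qed
  qed
  ultimately have "((\<lambda>w. (F w - F z) / (w - z)) \<longlongrightarrow> - \<phi> (blinfun_apply (resolvent T z) ?y)) (at z)"
    by (rule Lim_transform_eventually[OF _ eventually_mono]) simp
  then have "(F has_field_derivative - \<phi> (blinfun_apply (resolvent T z) ?y)) (at z)"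
    unfolding has_field_derivative_iff .
  then show "(\<lambda>z. \<phi> (blinfun_apply (resolvent T z) x)) field_differentiable at z within - op_spectrum T"
    unfolding F_def field_differentiable_def by (meson has_field_derivative_at_within)
qed

section \<open>The Dunford integral tested by functionals\<close>

lemma resolvent_taylor_remainder:
  fixes T :: "'a::complex_banach \<Rightarrow>\<^sub>L 'a"
  assumes z: "z \<notin> op_spectrum T" and w: "w \<notin> op_spectrum T"
  shows "resolvent T w - (\<Sum>i<n. (z - w) ^ i *\<^sub>C blinfun_power (resolvent T z) (Suc i))
    = (z - w) ^ n *\<^sub>C (blinfun_power (resolvent T z) n o\<^sub>L resolvent T w)"
proof (induction n)
  case 0
  then show ?case by (simp add: compose_id scaleC_one)
next
  case (Suc n)
  let ?R = "resolvent T z" and ?P = "blinfun_power (resolvent T z)"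
  have P: "complex_linear_op (?P n)" by (intro complex_linear_op_power resolvent_complex_linear z)
  have "resolvent T w = ?R + (z - w) *\<^sub>C (?R o\<^sub>L resolvent T w)"
    using resolvent_identity[OF z w] by (simp add: scaleC_diff_left algebra_simps)
  then have "?P n o\<^sub>L resolvent T w = ?P n o\<^sub>L (?R + (z - w) *\<^sub>C (?R o\<^sub>L resolvent T w))" by simp
  also have "\<dots> = ?P (Suc n) + (z - w) *\<^sub>C (?P (Suc n) o\<^sub>L resolvent T w)"
    by (simp add: compose_add_right scaleC_compose_right[OF P] blinfun_power_Suc_right blinfun_compose_assoc)
  finally have "(z - w) ^ n *\<^sub>C (?P n o\<^sub>L resolvent T w) =
      (z - w) ^ n *\<^sub>C ?P (Suc n) + (z - w) ^ Suc n *\<^sub>C (?P (Suc n) o\<^sub>L resolvent T w)"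
    by (simp add: scaleC_add_right scaleC_scaleC mult.commute)
  with Suc show ?case by (simp add: algebra_simps)
qed

text \<open>
  The operator-valued function \<open>f(w) R(w)\<close> has local primitives: expand \<open>R\<close> in powers of \<open>z - w\<close> and
  integrate the scalar coefficients \<open>f(w) (z - w)\<^sup>n\<close>.
\<close>

lemma resolvent_local_primitive:
  fixes T :: "'a::complex_banach \<Rightarrow>\<^sub>L 'a"
  assumes U: "open U" "f holomorphic_on U" "U \<inter> op_spectrum T = {}" and z: "z \<in> U"
  obtains e H where "e > 0" "ball z e \<subseteq> U"
    "\<And>w. w \<in> ball z e \<Longrightarrow> (H has_derivative (\<lambda>h. h *\<^sub>C f w *\<^sub>C resolvent T w)) (at w)"
proof -
  have zs: "z \<notin> op_spectrum T" using U z by auto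
  let ?R = "resolvent T z" and ?P = "blinfun_power (resolvent T z)"
  obtain e1 where e1: "e1 > 0" "e1 * norm ?R \<le> 1/2"
    "\<And>w. w \<in> ball z e1 \<Longrightarrow> norm (resolvent T w) \<le> 2 * norm ?R"
    using resolvent_local_bound[OF zs] by metis
  obtain e2 where e2: "e2 > 0" "cball z e2 \<subseteq> U" using U(1) z by (meson open_contains_cball)
  define e where "e = min e1 e2"
  have e: "e > 0" "e \<le> e1" "ball z e \<subseteq> U" "ball z e \<subseteq> cball z e2"
    using e1(1) e2 by (auto simp: e_def)
  have "bounded (f ` cball z e2)"
    by (intro compact_imp_bounded compact_continuous_image compact_cball
        holomorphic_on_imp_continuous_on holomorphic_on_subset[OF U(2) e2(2)])
  then obtain B where B: "B > 0" "\<And>w. w \<in> cball z e2 \<Longrightarrow> cmod (f w) \<le> B" by (auto simp: bounded_pos)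
  have "\<exists>g. (\<forall>w\<in>ball z e. (g has_field_derivative f w * (z - w) ^ n) (at w within ball z e)) \<and> g z = 0" for n :: nat
  proof -
    have "(\<lambda>w. f w * (z - w) ^ n) holomorphic_on ball z e"
      by (intro holomorphic_intros holomorphic_on_subset[OF U(2) e(3)])
    then obtain g where g: "\<And>w. w \<in> ball z e \<Longrightarrow> (g has_field_derivative f w * (z - w) ^ n) (at w within ball z e)"
      using holomorphic_convex_primitive'[OF convex_ball open_ball] by blast
    show ?thesis
    proof (intro exI[of _ "\<lambda>w. g w - g z"] conjI ballI)
      fix w assume "w \<in> ball z e"
      from DERIV_diff[OF g[OF this] DERIV_const]
      show "((\<lambda>w. g w - g z) has_field_derivative f w * (z - w) ^ n) (at w within ball z e)" by simp
    qed simp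
  qed
  then have "\<forall>n. \<exists>g. (\<forall>w\<in>ball z e. (g has_field_derivative f w * (z - w) ^ n) (at w within ball z e)) \<and> g z = 0"
    by blast
  from choice[OF this] obtain g where g: "\<And>n w. w \<in> ball z e \<Longrightarrow> (g n has_field_derivative f w * (z - w) ^ n) (at w within ball z e)"
    "\<And>n. g n z = 0"
    by blast
  define F where "F = (\<lambda>n w. g n w *\<^sub>C ?P (Suc n))"
  define F' where "F' = (\<lambda>n w h. (f w * (z - w) ^ n * h) *\<^sub>C ?P (Suc n))"
  have "\<exists>H. \<forall>w\<in>ball z e. (\<lambda>n. F n w) sums (H w) \<and> (H has_derivative (\<lambda>h. h *\<^sub>C f w *\<^sub>C resolvent T w)) (at w within ball z e)"
  proof (rule has_derivative_series[where f' = F'])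
    show "convex (ball z e)" by simp
    show "(F n has_derivative F' n w) (at w within ball z e)" if "w \<in> ball z e" for n w
      unfolding F_def F'_def
      by (rule bounded_linear.has_derivative[OF bounded_linear_scaleC_left])
         (use g(1)[OF that] in \<open>simp add: has_field_derivative_def\<close>)
    show "z \<in> ball z e" using e by simp
    show "(\<lambda>n. F n z) sums 0" by (simp add: F_def g(2))
    fix \<epsilon> :: real assume \<epsilon>: "\<epsilon> > 0"
    have "(\<lambda>n. B * ((1/2) ^ n * (2 * norm ?R))) \<longlonglongrightarrow> B * (0 * (2 * norm ?R))"
      by (intro tendsto_intros LIMSEQ_power_zero) auto
    then have "\<forall>\<^sub>F n in sequentially. B * ((1/2) ^ n * (2 * norm ?R)) < \<epsilon>"
      using \<epsilon> by (intro order_tendstoD(2)) auto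
    then show "\<forall>\<^sub>F n in sequentially. \<forall>w\<in>ball z e. \<forall>h. norm ((\<Sum>i<n. F' i w h) - h *\<^sub>C f w *\<^sub>C resolvent T w) \<le> \<epsilon> * norm h"
    proof (rule eventually_mono, intro ballI allI)
      fix n w h assume n: "B * ((1/2) ^ n * (2 * norm ?R)) < \<epsilon>" and w: "w \<in> ball z e"
      have ws: "w \<notin> op_spectrum T" using w e(3) U(3) by blast
      have "(\<Sum>i<n. F' i w h) = (h * f w) *\<^sub>C (\<Sum>i<n. (z - w) ^ i *\<^sub>C ?P (Suc i))"
        by (simp add: F'_def complex_vector.scale_sum_right scaleC_scaleC mult_ac)
      then have "h *\<^sub>C f w *\<^sub>C resolvent T w - (\<Sum>i<n. F' i w h) =
          (h * f w) *\<^sub>C (resolvent T w - (\<Sum>i<n. (z - w) ^ i *\<^sub>C ?P (Suc i)))"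
        by (simp add: scaleC_diff_right scaleC_scaleC)
      also have "\<dots> = (h * f w) *\<^sub>C (z - w) ^ n *\<^sub>C (?P n o\<^sub>L resolvent T w)"
        by (subst resolvent_taylor_remainder[OF zs ws]) simp
      finally have "norm ((\<Sum>i<n. F' i w h) - h *\<^sub>C f w *\<^sub>C resolvent T w) =
          cmod h * (cmod (f w) * (cmod (z - w) ^ n * norm (?P n o\<^sub>L resolvent T w)))"
        by (subst norm_minus_commute) (simp add: norm_scaleC norm_mult norm_power mult_ac)
      also have "\<dots> \<le> cmod h * (B * ((1/2) ^ n * (2 * norm ?R)))"
      proof (rule mult_left_mono[OF mult_mono])
        show "cmod (f w) \<le> B" using w e(4) B(2) by blast
        have "norm (?P n o\<^sub>L resolvent T w) \<le> norm ?R ^ n * (2 * norm ?R)"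
          using e1(3)[of w] w e(2) norm_blinfun_power[of ?R n]
          by (intro order_trans[OF norm_blinfun_compose] mult_mono) auto
        then have "cmod (z - w) ^ n * norm (?P n o\<^sub>L resolvent T w) \<le> e1 ^ n * (norm ?R ^ n * (2 * norm ?R))"
          using w e(2) e1(1) by (intro mult_mono power_mono) (auto simp: dist_norm)
        also have "\<dots> = (e1 * norm ?R) ^ n * (2 * norm ?R)" by (simp add: power_mult_distrib mult.assoc)
        also have "\<dots> \<le> (1/2) ^ n * (2 * norm ?R)"
          using e1(1,2) by (intro mult_right_mono power_mono) auto
        finally show "cmod (z - w) ^ n * norm (?P n o\<^sub>L resolvent T w) \<le> (1/2) ^ n * (2 * norm ?R)" .
      qed (use B in auto)
      also have "\<dots> \<le> cmod h * \<epsilon>" using n by (intro mult_left_mono) auto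
      finally show "norm ((\<Sum>i<n. F' i w h) - h *\<^sub>C f w *\<^sub>C resolvent T w) \<le> \<epsilon> * norm h"
        by (simp add: mult.commute)
    qed
  qed
  then obtain H where H: "\<And>w. w \<in> ball z e \<Longrightarrow> (H has_derivative (\<lambda>h. h *\<^sub>C f w *\<^sub>C resolvent T w)) (at w within ball z e)"
    by blast
  show ?thesis
    by (rule that[OF e(1,3), of H]) (metis H at_within_open open_ball)
qed

text \<open>
  Since the derivative of a valid path may be unbounded, continuity of the integrand is not enough
  here; integrability comes from local primitives and the fundamental theorem of calculus.
\<close>

lemma vector_contour_integrable:
  fixes T :: "'a::complex_banach \<Rightarrow>\<^sub>L 'a"
  assumes \<gamma>: "valid_path \<gamma>" "path_image \<gamma> \<subseteq> U" and U: "open U" "f holomorphic_on U" "U \<inter> op_spectrum T = {}"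
  shows "(\<lambda>t. vector_derivative \<gamma> (at t within {0..1}) *\<^sub>C f (\<gamma> t) *\<^sub>C resolvent T (\<gamma> t)) integrable_on {0..1}"
proof -
  let ?g = "\<lambda>t. vector_derivative \<gamma> (at t within {0..1}) *\<^sub>C f (\<gamma> t) *\<^sub>C resolvent T (\<gamma> t)"
  obtain D where D: "finite D" "\<gamma> C1_differentiable_on ({0..1} - D)"
    using \<gamma>(1) unfolding valid_path_def piecewise_C1_differentiable_on_def by blast
  have cont: "continuous_on {0..1} \<gamma>" using \<gamma>(1) valid_path_imp_path path_def by blast
  have "?g integrable_on cbox 0 1"
  proof (rule integrable_on_little_subintervals, rule ballI)
    fix x :: real assume x: "x \<in> cbox 0 1"
    then have "\<gamma> x \<in> U" using \<gamma>(2) by (auto simp: path_image_def)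
    then obtain e H where e: "e > 0" "ball (\<gamma> x) e \<subseteq> U"
      "\<And>w. w \<in> ball (\<gamma> x) e \<Longrightarrow> (H has_derivative (\<lambda>h. h *\<^sub>C f w *\<^sub>C resolvent T w)) (at w)"
      using resolvent_local_primitive[OF U] by metis
    obtain d where d: "d > 0" "\<And>y. y \<in> {0..1} \<Longrightarrow> dist y x < d \<Longrightarrow> dist (\<gamma> y) (\<gamma> x) < e"
      using cont e(1) x unfolding continuous_on_iff by (metis cbox_interval)
    show "\<exists>d>0. \<forall>u v. x \<in> cbox u v \<and> cbox u v \<subseteq> ball x d \<and> cbox u v \<subseteq> cbox 0 1 \<longrightarrow> ?g integrable_on cbox u v"
    proof (intro exI[of _ d] conjI allI impI d(1))
      fix u v assume uv: "x \<in> cbox u v \<and> cbox u v \<subseteq> ball x d \<and> cbox u v \<subseteq> cbox 0 1"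
      then have uv': "u \<le> v" "{u..v} \<subseteq> ball x d" "{u..v} \<subseteq> {0..1}" by auto
      have inb: "\<gamma> t \<in> ball (\<gamma> x) e" if "t \<in> {u..v}" for t
      proof -
        have "t \<in> {0..1}" "dist t x < d" using that uv'(2,3) by (auto simp: dist_commute)
        then show ?thesis using d(2) by (simp add: dist_commute)
      qed
      have "(?g has_integral (H (\<gamma> v) - H (\<gamma> u))) {u..v}"
      proof (rule fundamental_theorem_of_calculus_interior_strong[OF D(1) uv'(1), where f = "\<lambda>t. H (\<gamma> t)"])
        fix t assume t: "t \<in> {u<..<v} - D"
        then have t01: "t \<in> {0<..<1}" using uv' by (auto simp: subset_iff) (metis atLeastAtMost_iff less_eq_real_def order_less_le_trans order_le_less_trans greaterThanLessThan_iff)+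
        have "\<gamma> differentiable (at t)"
          using D(2) t t01 by (auto simp: C1_differentiable_on_eq)
        then have "(\<gamma> has_vector_derivative vector_derivative \<gamma> (at t)) (at t)"
          by (simp add: vector_derivative_works)
        also have "vector_derivative \<gamma> (at t) = vector_derivative \<gamma> (at t within {0..1})"
          using t01 by (subst at_within_interior[of t "{0..1}"]) auto
        finally have der: "(\<gamma> has_vector_derivative vector_derivative \<gamma> (at t within {0..1})) (at t)" .
        have "(H has_derivative (\<lambda>h. h *\<^sub>C f (\<gamma> t) *\<^sub>C resolvent T (\<gamma> t))) (at (\<gamma> t))"
          using t by (intro e(3) inb) auto
        from has_derivative_compose[OF der[unfolded has_vector_derivative_def] this]
        show "((\<lambda>t. H (\<gamma> t)) has_vector_derivative ?g t) (at t)"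
          unfolding has_vector_derivative_def
          by (simp add: linear_cmul[OF bounded_linear.linear[OF bounded_linear_scaleC_left]])
      next
        show "continuous_on {u..v} (\<lambda>t. H (\<gamma> t))"
        proof (rule continuous_on_compose2[of "ball (\<gamma> x) e" H])
          show "continuous_on (ball (\<gamma> x) e) H"
            using e(3) by (meson continuous_at_imp_continuous_on has_derivative_continuous)
          show "continuous_on {u..v} \<gamma>" using cont uv'(3) by (rule continuous_on_subset)
        qed (use inb in auto)
      qed
      then show "?g integrable_on cbox u v" by auto
    qed
  qed
  then show ?thesis by simp
qed

lemma functional_contour_integral:
  fixes T :: "'a::complex_banach \<Rightarrow>\<^sub>L 'a"
  assumes \<gamma>: "valid_path \<gamma>" "path_image \<gamma> \<subseteq> U" and U: "open U" "f holomorphic_on U" "U \<inter> op_spectrum T = {}"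
    and \<phi>: "clinear_functional \<phi>"
  shows "\<phi> (blinfun_apply (vector_contour_integral \<gamma> (\<lambda>z. f z *\<^sub>C resolvent T z)) x)
    = contour_integral \<gamma> (\<lambda>z. f z * \<phi> (blinfun_apply (resolvent T z) x))"
proof -
  let ?g = "\<lambda>t. vector_derivative \<gamma> (at t within {0..1}) *\<^sub>C f (\<gamma> t) *\<^sub>C resolvent T (\<gamma> t)"
  have bl: "bounded_linear (\<lambda>A. \<phi> (blinfun_apply A x))"
    by (rule bounded_linear_compose[OF clinear_functionalD(1)[OF \<phi>] blinfun.bounded_linear_left])
  have "\<phi> (blinfun_apply (integral {0..1} ?g) x) = integral {0..1} ((\<lambda>A. \<phi> (blinfun_apply A x)) \<circ> ?g)"
    using integral_linear[OF vector_contour_integrable[OF \<gamma> U] bl] by simp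
  also have "\<dots> = integral {0..1} (\<lambda>t. f (\<gamma> t) * \<phi> (blinfun_apply (resolvent T (\<gamma> t)) x) * vector_derivative \<gamma> (at t))"
  proof (rule integral_spike[of "{0, 1}"])
    fix t :: real assume "t \<in> {0..1} - {0, 1}"
    then have "t \<in> interior {0..1}" by auto
    then have "at t within {0..1} = at t" by (rule at_within_interior)
    then show "f (\<gamma> t) * \<phi> (blinfun_apply (resolvent T (\<gamma> t)) x) * vector_derivative \<gamma> (at t) = ((\<lambda>A. \<phi> (blinfun_apply A x)) \<circ> ?g) t"
      by (simp add: scaleC_blinfun.rep_eq clinear_functionalD[OF \<phi>])
  qed auto
  finally show ?thesis
    unfolding vector_contour_integral_def contour_integral_integral .
qed

text \<open>
  This formula reduces statements about \<open>f(T)\<close> to complex contour integrals.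
\<close>

lemma functional_dunford_integral:
  fixes T :: "'a::complex_banach \<Rightarrow>\<^sub>L 'a"
  assumes \<Gamma>: "cycle_in \<Gamma> U" and U: "f holomorphic_on U" "U \<inter> op_spectrum T = {}" and \<phi>: "clinear_functional \<phi>"
  shows "\<phi> (blinfun_apply (dunford_integral \<Gamma> f T) x)
    = 1 / (2 * pi * \<i>) * cycle_integral \<Gamma> (\<lambda>z. f z * \<phi> (blinfun_apply (resolvent T z) x))"
proof -
  have "\<phi> (blinfun_apply (\<Sum>\<gamma>\<leftarrow>\<Gamma>. vector_contour_integral \<gamma> (\<lambda>z. f z *\<^sub>C resolvent T z)) x)
     = cycle_integral \<Gamma> (\<lambda>z. f z * \<phi> (blinfun_apply (resolvent T z) x))"
    using \<Gamma>
  proof (induction \<Gamma>)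
    case Nil
    then show ?case by (simp add: clinear_functionalD[OF \<phi>])
  next
    case (Cons \<gamma> \<Gamma>)
    have "cycle_in \<Gamma> U" using Cons.prems by (auto simp: cycle_in_def)
    moreover have "valid_path \<gamma>" "path_image \<gamma> \<subseteq> U" "open U" using Cons.prems by (auto simp: cycle_in_def)
    ultimately show ?case
      using Cons.IH functional_contour_integral[of \<gamma> U f T \<phi> x] U \<phi>
      by (simp add: blinfun.bilinear_simps clinear_functionalD[OF \<phi>])
  qed
  then show ?thesis
    by (simp add: dunford_integral_def scaleC_blinfun.rep_eq clinear_functionalD[OF \<phi>])
qed

lemma eq_by_functionals:
  fixes x y :: "'a::complex_normed_vector"
  assumes "\<And>\<phi>. clinear_functional \<phi> \<Longrightarrow> \<phi> x = \<phi> y"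
  shows "x = y"
proof (rule ccontr)
  assume "x \<noteq> y"
  then have "x - y \<noteq> 0" by simp
  then obtain \<phi> where "clinear_functional \<phi>" "\<phi> (x - y) \<noteq> 0" by (rule separating_functional)
  with assms clinear_functionalD(4) show False by fastforce
qed

section \<open>The functional calculus\<close>

text \<open>
  The situation in which \<^term>\<open>dunford_integral \<Gamma> f T\<close> represents \<open>f(T)\<close> for all \<open>f\<close> holomorphic on \<open>\<Omega>\<close>.
  The cycle is kept as a parameter, so that the same one can be used with different open sets.
\<close>

definition admissible :: "('a::complex_banach \<Rightarrow>\<^sub>L 'a) \<Rightarrow> (real \<Rightarrow> complex) list \<Rightarrow> complex set \<Rightarrow> bool"
  where "admissible T \<Gamma> \<Omega> \<longleftrightarrow> complex_linear_op T \<and> open \<Omega> \<and> encloses \<Gamma> (op_spectrum T) \<Omega>"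

lemma admissibleD:
  assumes "admissible T \<Gamma> \<Omega>"
  shows "complex_linear_op T" "open \<Omega>" "cycle_in \<Gamma> \<Omega>" "cycle_in \<Gamma> (\<Omega> - op_spectrum T)"
    "op_spectrum T \<subseteq> \<Omega>"
    "\<And>z. z \<in> op_spectrum T \<Longrightarrow> cycle_winding \<Gamma> z = 1"
    "\<And>z. z \<notin> \<Omega> \<Longrightarrow> cycle_winding \<Gamma> z = 0"
proof -
  show T: "complex_linear_op T" "open \<Omega>" using assms by (simp_all add: admissible_def)
  have enc: "encloses \<Gamma> (op_spectrum T) \<Omega>" using assms by (simp add: admissible_def)
  then have \<Gamma>: "valid_path \<gamma> \<and> pathfinish \<gamma> = pathstart \<gamma> \<and> path_image \<gamma> \<subseteq> \<Omega> - op_spectrum T" if "\<gamma> \<in> set \<Gamma>" for \<gamma>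
    using that by (simp add: encloses_def)
  from enc show w: "cycle_winding \<Gamma> z = 1" if "z \<in> op_spectrum T" for z
    using that by (simp add: encloses_def)
  from enc show w0: "cycle_winding \<Gamma> z = 0" if "z \<notin> \<Omega>" for z
    using that by (simp add: encloses_def)
  show "op_spectrum T \<subseteq> \<Omega>"
  proof
    fix z assume "z \<in> op_spectrum T"
    then have "cycle_winding \<Gamma> z \<noteq> 0" using w by simp
    then show "z \<in> \<Omega>" using w0 by blast
  qed
  have op: "open (\<Omega> - op_spectrum T)"
    by (intro open_Diff T compact_imp_closed compact_op_spectrum)
  then show "cycle_in \<Gamma> (\<Omega> - op_spectrum T)"
    using \<Gamma> by (simp add: cycle_in_def)
  then show "cycle_in \<Gamma> \<Omega>"
    using T(2) by (rule cycle_in_subset) (use \<Gamma> in blast)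
qed

lemma admissible_mono:
  assumes "admissible T \<Gamma> \<Omega>" "\<Omega> \<subseteq> \<Omega>'" "open \<Omega>'"
  shows "admissible T \<Gamma> \<Omega>'"
  using assms unfolding admissible_def encloses_def by (meson Diff_mono order_refl order_trans subsetD)

text \<open>
  A point off the cycle with winding number zero, such as a pole, may be removed from the domain.
\<close>

lemma admissible_remove:
  assumes "admissible T \<Gamma> \<Omega>" "\<zeta> \<notin> (\<Union>\<gamma>\<in>set \<Gamma>. path_image \<gamma>)" "cycle_winding \<Gamma> \<zeta> = 0"
  shows "admissible T \<Gamma> (\<Omega> - {\<zeta>})"
proof -
  have "open (\<Omega> - {\<zeta>})" using assms(1) by (auto simp: admissible_def)
  moreover have "path_image \<gamma> \<subseteq> \<Omega> - {\<zeta>} - op_spectrum T" if "\<gamma> \<in> set \<Gamma>" for \<gamma>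
    using that admissibleD(4)[OF assms(1)] assms(2) by (auto simp: cycle_in_def)
  moreover have "cycle_winding \<Gamma> z = 0" if "z \<notin> \<Omega> - {\<zeta>}" for z
    using that admissibleD(7)[OF assms(1)] assms(3) by auto
  ultimately show ?thesis using assms(1) unfolding admissible_def encloses_def by simp
qed

lemma functional_calculus:
  assumes "admissible T \<Gamma> \<Omega>" "f holomorphic_on \<Omega>" "clinear_functional \<phi>"
  shows "\<phi> (blinfun_apply (dunford_integral \<Gamma> f T) x)
    = 1 / (2 * pi * \<i>) * cycle_integral \<Gamma> (\<lambda>z. f z * \<phi> (blinfun_apply (resolvent T z) x))"
proof (rule functional_dunford_integral)
  show "cycle_in \<Gamma> (\<Omega> - op_spectrum T)" by (rule admissibleD(4)[OF assms(1)])
  show "f holomorphic_on \<Omega> - op_spectrum T" using assms(2) by (rule holomorphic_on_subset) auto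
qed (use assms in auto)

lemma calculus_integrand_holomorphic:
  assumes "f holomorphic_on \<Omega>" "clinear_functional \<phi>"
  shows "(\<lambda>z. f z * \<phi> (blinfun_apply (resolvent T z) x)) holomorphic_on \<Omega> - op_spectrum (T :: 'a::complex_banach \<Rightarrow>\<^sub>L 'a)"
proof (intro holomorphic_on_mult)
  show "f holomorphic_on \<Omega> - op_spectrum T" using assms(1) by (rule holomorphic_on_subset) auto
  show "(\<lambda>z. \<phi> (blinfun_apply (resolvent T z) x)) holomorphic_on \<Omega> - op_spectrum T"
    by (rule holomorphic_on_subset[OF functional_resolvent_holomorphic[OF assms(2)]]) auto
qed

lemma calculus_add:
  assumes "admissible T \<Gamma> \<Omega>" "f holomorphic_on \<Omega>" "g holomorphic_on \<Omega>"
  shows "blinfun_apply (dunford_integral \<Gamma> (\<lambda>z. f z + g z) T) x =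
    blinfun_apply (dunford_integral \<Gamma> f T) x + blinfun_apply (dunford_integral \<Gamma> g T) x"
proof (rule eq_by_functionals)
  fix \<phi> :: "'a \<Rightarrow> complex" assume \<phi>: "clinear_functional \<phi>"
  have fg: "(\<lambda>z. f z + g z) holomorphic_on \<Omega>" using assms by (intro holomorphic_intros)
  have "cycle_integral \<Gamma> (\<lambda>z. (f z + g z) * \<phi> (blinfun_apply (resolvent T z) x))
    = cycle_integral \<Gamma> (\<lambda>z. f z * \<phi> (blinfun_apply (resolvent T z) x)) + cycle_integral \<Gamma> (\<lambda>z. g z * \<phi> (blinfun_apply (resolvent T z) x))"
    unfolding distrib_right
    by (rule cycle_integral_add[OF admissibleD(4)[OF assms(1)]]) (intro calculus_integrand_holomorphic assms \<phi>)+
  then show "\<phi> (blinfun_apply (dunford_integral \<Gamma> (\<lambda>z. f z + g z) T) x) =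
      \<phi> (blinfun_apply (dunford_integral \<Gamma> f T) x + blinfun_apply (dunford_integral \<Gamma> g T) x)"
    unfolding clinear_functionalD(3)[OF \<phi>] functional_calculus[OF assms(1,2) \<phi>]
      functional_calculus[OF assms(1,3) \<phi>] functional_calculus[OF assms(1) fg \<phi>]
    by (simp only: distrib_left)
qed

lemma calculus_cmult:
  assumes "admissible T \<Gamma> \<Omega>" "f holomorphic_on \<Omega>"
  shows "blinfun_apply (dunford_integral \<Gamma> (\<lambda>z. c * f z) T) x = c *\<^sub>C blinfun_apply (dunford_integral \<Gamma> f T) x"
proof (rule eq_by_functionals)
  fix \<phi> :: "'a \<Rightarrow> complex" assume \<phi>: "clinear_functional \<phi>"
  have cf: "(\<lambda>z. c * f z) holomorphic_on \<Omega>" using assms by (intro holomorphic_intros)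
  have "cycle_integral \<Gamma> (\<lambda>z. c * f z * \<phi> (blinfun_apply (resolvent T z) x))
    = c * cycle_integral \<Gamma> (\<lambda>z. f z * \<phi> (blinfun_apply (resolvent T z) x))"
    unfolding mult.assoc
    by (rule cycle_integral_cmult[OF admissibleD(4)[OF assms(1)]]) (intro calculus_integrand_holomorphic assms \<phi>)
  then show "\<phi> (blinfun_apply (dunford_integral \<Gamma> (\<lambda>z. c * f z) T) x) = \<phi> (c *\<^sub>C blinfun_apply (dunford_integral \<Gamma> f T) x)"
    unfolding clinear_functionalD(2)[OF \<phi>] functional_calculus[OF assms \<phi>] functional_calculus[OF assms(1) cf \<phi>]
    by (simp only: mult.left_commute)
qed

lemma calculus_cong:
  assumes "admissible T \<Gamma> \<Omega>" "f holomorphic_on \<Omega>" "\<And>z. z \<in> \<Omega> \<Longrightarrow> f z = g z"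
  shows "blinfun_apply (dunford_integral \<Gamma> f T) x = blinfun_apply (dunford_integral \<Gamma> g T) x"
proof (rule eq_by_functionals)
  fix \<phi> :: "'a \<Rightarrow> complex" assume \<phi>: "clinear_functional \<phi>"
  have g: "g holomorphic_on \<Omega>" by (rule holomorphic_transform[OF assms(2,3)])
  have "cycle_integral \<Gamma> (\<lambda>z. f z * \<phi> (blinfun_apply (resolvent T z) x)) = cycle_integral \<Gamma> (\<lambda>z. g z * \<phi> (blinfun_apply (resolvent T z) x))"
    by (rule cycle_integral_cong[OF admissibleD(3)[OF assms(1)]]) (simp add: assms)
  then show "\<phi> (blinfun_apply (dunford_integral \<Gamma> f T) x) = \<phi> (blinfun_apply (dunford_integral \<Gamma> g T) x)"
    unfolding functional_calculus[OF assms(1,2) \<phi>] functional_calculus[OF assms(1) g \<phi>] by (simp only:)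
qed

lemma calculus_complex_linear:
  assumes "admissible T \<Gamma> \<Omega>" "f holomorphic_on \<Omega>"
  shows "complex_linear_op (dunford_integral \<Gamma> f T)"
  unfolding complex_linear_op_def
proof (intro allI, rule eq_by_functionals)
  fix c x and \<phi> :: "'a \<Rightarrow> complex" assume \<phi>: "clinear_functional \<phi>"
  have "cycle_integral \<Gamma> (\<lambda>z. f z * \<phi> (blinfun_apply (resolvent T z) (c *\<^sub>C x)))
    = cycle_integral \<Gamma> (\<lambda>z. c * (f z * \<phi> (blinfun_apply (resolvent T z) x)))"
    by (rule cycle_integral_cong[OF admissibleD(4)[OF assms(1)]])
       (simp add: complex_linear_opD[OF resolvent_complex_linear] clinear_functionalD[OF \<phi>])
  also have "\<dots> = c * cycle_integral \<Gamma> (\<lambda>z. f z * \<phi> (blinfun_apply (resolvent T z) x))"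
    by (rule cycle_integral_cmult[OF admissibleD(4)[OF assms(1)]]) (intro calculus_integrand_holomorphic assms \<phi>)
  finally show "\<phi> (blinfun_apply (dunford_integral \<Gamma> f T) (c *\<^sub>C x)) = \<phi> (c *\<^sub>C blinfun_apply (dunford_integral \<Gamma> f T) x)"
    unfolding clinear_functionalD(2)[OF \<phi>] functional_calculus[OF assms \<phi>]
    by (simp only: mult.left_commute)
qed

lemma functional_compose_op:
  assumes "clinear_functional \<phi>" "complex_linear_op T"
  shows "clinear_functional (\<lambda>x. \<phi> (blinfun_apply T x))"
  unfolding clinear_functional_def
proof (intro conjI allI)
  show "bounded_linear (\<lambda>x. \<phi> (blinfun_apply T x))"
    by (rule bounded_linear_compose[OF clinear_functionalD(1)[OF assms(1)] blinfun.bounded_linear_right])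
  show "\<phi> (blinfun_apply T (c *\<^sub>C x)) = c * \<phi> (blinfun_apply T x)" for c x
    by (simp add: complex_linear_opD[OF assms(2)] clinear_functionalD[OF assms(1)])
qed

text \<open>
  From \<open>T R(z) = z R(z) - 1\<close>; the additional term vanishes by Cauchy's theorem for \<open>f\<close>.
\<close>

lemma calculus_mult_var:
  assumes "admissible T \<Gamma> \<Omega>" "f holomorphic_on \<Omega>"
  shows "blinfun_apply (dunford_integral \<Gamma> (\<lambda>z. z * f z) T) x = blinfun_apply T (blinfun_apply (dunford_integral \<Gamma> f T) x)"
proof (rule eq_by_functionals)
  fix \<phi> :: "'a \<Rightarrow> complex" assume \<phi>: "clinear_functional \<phi>"
  have T: "complex_linear_op T" by (rule admissibleD(1)[OF assms(1)])
  note cyc = admissibleD(4)[OF assms(1)]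
  have zf: "(\<lambda>z. z * f z) holomorphic_on \<Omega>" using assms by (intro holomorphic_intros)
  have fx: "(\<lambda>z. \<phi> x * f z) holomorphic_on \<Omega> - op_spectrum T"
    by (rule holomorphic_on_subset[of _ \<Omega>]) (use assms(2) in \<open>auto intro!: holomorphic_intros\<close>)
  have "cycle_integral \<Gamma> (\<lambda>z. f z * \<phi> (blinfun_apply T (blinfun_apply (resolvent T z) x)))
    = cycle_integral \<Gamma> (\<lambda>z. z * f z * \<phi> (blinfun_apply (resolvent T z) x) - \<phi> x * f z)"
    by (rule cycle_integral_cong[OF cyc])
       (simp add: resolvent_right clinear_functionalD[OF \<phi>] algebra_simps)
  also have "\<dots> = cycle_integral \<Gamma> (\<lambda>z. z * f z * \<phi> (blinfun_apply (resolvent T z) x)) - cycle_integral \<Gamma> (\<lambda>z. \<phi> x * f z)"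
    by (rule cycle_integral_diff[OF cyc calculus_integrand_holomorphic[OF zf \<phi>] fx])
  also have "cycle_integral \<Gamma> (\<lambda>z. \<phi> x * f z) = 0"
    by (rule cauchy_cycle[OF admissibleD(3,7)[OF assms(1)]]) (use assms(2) in \<open>auto intro!: holomorphic_intros\<close>)
  finally show "\<phi> (blinfun_apply (dunford_integral \<Gamma> (\<lambda>z. z * f z) T) x) = \<phi> (blinfun_apply T (blinfun_apply (dunford_integral \<Gamma> f T) x))"
    unfolding functional_calculus[OF assms functional_compose_op[OF \<phi> T]] functional_calculus[OF assms(1) zf \<phi>]
    by simp
qed

lemma calculus_commute:
  assumes "admissible T \<Gamma> \<Omega>" "f holomorphic_on \<Omega>"
  shows "blinfun_apply (dunford_integral \<Gamma> f T) (blinfun_apply T x) = blinfun_apply T (blinfun_apply (dunford_integral \<Gamma> f T) x)"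
proof (rule eq_by_functionals)
  fix \<phi> :: "'a \<Rightarrow> complex" assume \<phi>: "clinear_functional \<phi>"
  have T: "complex_linear_op T" by (rule admissibleD(1)[OF assms(1)])
  have "cycle_integral \<Gamma> (\<lambda>z. f z * \<phi> (blinfun_apply (resolvent T z) (blinfun_apply T x)))
    = cycle_integral \<Gamma> (\<lambda>z. f z * \<phi> (blinfun_apply T (blinfun_apply (resolvent T z) x)))"
    by (rule cycle_integral_cong[OF admissibleD(4)[OF assms(1)]]) (simp add: resolvent_right resolvent_left)
  then show "\<phi> (blinfun_apply (dunford_integral \<Gamma> f T) (blinfun_apply T x)) = \<phi> (blinfun_apply T (blinfun_apply (dunford_integral \<Gamma> f T) x))"
    unfolding functional_calculus[OF assms functional_compose_op[OF \<phi> T]] functional_calculus[OF assms \<phi>]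
    by simp
qed

lemma calculus_independent:
  assumes "admissible T \<Gamma>1 \<Omega>" "admissible T \<Gamma>2 \<Omega>" "f holomorphic_on \<Omega>"
  shows "blinfun_apply (dunford_integral \<Gamma>1 f T) x = blinfun_apply (dunford_integral \<Gamma>2 f T) x"
proof (rule eq_by_functionals)
  fix \<phi> :: "'a \<Rightarrow> complex" assume \<phi>: "clinear_functional \<phi>"
  have "cycle_integral \<Gamma>1 (\<lambda>z. f z * \<phi> (blinfun_apply (resolvent T z) x)) = cycle_integral \<Gamma>2 (\<lambda>z. f z * \<phi> (blinfun_apply (resolvent T z) x))"
  proof (rule cauchy_cycle_homologous[OF admissibleD(4)[OF assms(1)] admissibleD(4)[OF assms(2)]])
    fix z assume "z \<notin> \<Omega> - op_spectrum T"
    then show "cycle_winding \<Gamma>1 z = cycle_winding \<Gamma>2 z"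
      using admissibleD(6,7)[OF assms(1)] admissibleD(6,7)[OF assms(2)] by (cases "z \<in> op_spectrum T") auto
  qed (rule calculus_integrand_holomorphic[OF assms(3) \<phi>])
  then show "\<phi> (blinfun_apply (dunford_integral \<Gamma>1 f T) x) = \<phi> (blinfun_apply (dunford_integral \<Gamma>2 f T) x)"
    unfolding functional_calculus[OF assms(1,3) \<phi>] functional_calculus[OF assms(2,3) \<phi>] by (simp only:)
qed

text \<open>
  The cycle is replaced by a circle of large radius \<open>r\<close>, on which the resolvent is \<open>1/z\<close> up to
  an error of order \<open>1/r\<^sup>2\<close>.
\<close>

lemma calculus_one:
  assumes "admissible T \<Gamma> \<Omega>"
  shows "blinfun_apply (dunford_integral \<Gamma> (\<lambda>z. 1) T) x = x"
proof (rule eq_by_functionals)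
  fix \<phi> :: "'a \<Rightarrow> complex" assume \<phi>: "clinear_functional \<phi>"
  have T: "complex_linear_op T" by (rule admissibleD(1)[OF assms])
  have spec: "cmod z \<le> norm T" if "z \<in> op_spectrum T" for z
    using resolvent_far(1)[OF T, of z] that by force
  obtain K where K: "K > 0" "\<And>y. cmod (\<phi> y) \<le> norm y * K"
    using bounded_linear.pos_bounded[OF clinear_functionalD(1)[OF \<phi>]] by blast
  define d where "d = cmod (\<phi> (blinfun_apply (dunford_integral \<Gamma> (\<lambda>z. 1) T) x) - \<phi> x)"
  have bound: "d * (r - norm T) \<le> norm T * norm x * K" if r: "r > norm T" for r
  proof -
    let ?C = "circlepath 0 r"
    have r0: "r > 0" using r norm_ge_zero[of T] by linarith
    have img: "path_image ?C \<subseteq> - op_spectrum T"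
    proof
      fix z assume "z \<in> path_image ?C"
      then have "cmod z = r" using r0 by simp
      then show "z \<in> - op_spectrum T" using spec[of z] r by auto
    qed
    have wind: "winding_number ?C z = 1" if "z \<in> op_spectrum T" for z
      using spec[OF that] r by (intro winding_number_circlepath) simp
    have adm: "admissible T [?C] UNIV"
      using img wind T by (simp add: admissible_def encloses_def Compl_eq_Diff_UNIV)
    define u where "u = (\<lambda>z. \<phi> (blinfun_apply (resolvent T z) x))"
    have "\<phi> (blinfun_apply (dunford_integral \<Gamma> (\<lambda>z. 1) T) x) = \<phi> (blinfun_apply (dunford_integral [?C] (\<lambda>z. 1) T) x)"
      using calculus_independent[OF admissible_mono[OF assms] adm, of "\<lambda>z. 1"] by simp
    also have "\<dots> = 1 / (2 * pi * \<i>) * contour_integral ?C u"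
      using functional_calculus[OF adm, of "\<lambda>z. 1" \<phi> x] \<phi> by (simp add: u_def)
    finally have e1: "\<phi> (blinfun_apply (dunford_integral \<Gamma> (\<lambda>z. 1) T) x) = 1 / (2 * pi * \<i>) * contour_integral ?C u" .
    have "u holomorphic_on - op_spectrum T"
      unfolding u_def by (rule functional_resolvent_holomorphic[OF \<phi>])
    then have ui: "(u has_contour_integral contour_integral ?C u) ?C"
      by (intro has_contour_integral_integral contour_integrable_holomorphic_simple[of u "- op_spectrum T"]
          open_resolvent_set img valid_path_circlepath)
    have "((\<lambda>z. 1 / (z - 0)) has_contour_integral 2 * pi * \<i> * winding_number ?C 0) ?C"
      using r0 by (intro has_contour_integral_winding_number) auto
    then have "((\<lambda>z. 1 / z) has_contour_integral 2 * pi * \<i>) ?C"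
      using r0 by (simp add: winding_number_circlepath)
    from has_contour_integral_diff[OF ui has_contour_integral_lmul[OF this, of "\<phi> x"]]
    have di: "((\<lambda>z. u z - \<phi> x * (1 / z)) has_contour_integral (contour_integral ?C u - \<phi> x * (2 * pi * \<i>))) ?C" .
    have "cmod (contour_integral ?C u - \<phi> x * (2 * pi * \<i>)) \<le> norm T * norm x * K / (r * (r - norm T)) * (2 * pi * r)"
    proof (rule has_contour_integral_bound_circlepath[OF di])
      fix z assume z: "cmod (z - 0) = r"
      then have zr: "cmod z = r" "z \<noteq> 0" using r0 by auto
      have zs: "z \<notin> op_spectrum T" and zn: "norm (resolvent T z) \<le> 1 / (r - norm T)"
        using resolvent_far[OF T, of z] r zr by auto
      let ?y = "blinfun_apply (resolvent T z) x"
      have "z * (u z - \<phi> x * (1 / z)) = \<phi> (blinfun_apply T ?y)"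
        using zr by (simp add: resolvent_right[OF zs] u_def clinear_functionalD[OF \<phi>] right_diff_distrib)
      then have "r * cmod (u z - \<phi> x * (1 / z)) = cmod (\<phi> (blinfun_apply T ?y))"
        using zr by (metis norm_mult)
      also have "\<dots> \<le> norm (blinfun_apply T ?y) * K" by (rule K(2))
      also have "\<dots> \<le> (norm T * (1 / (r - norm T) * norm x)) * K"
      proof (intro mult_right_mono)
        have "norm (blinfun_apply T ?y) \<le> norm T * norm ?y" by (rule norm_blinfun)
        also have "norm ?y \<le> norm (resolvent T z) * norm x" by (rule norm_blinfun)
        also have "\<dots> \<le> 1 / (r - norm T) * norm x" using zn by (intro mult_right_mono) auto
        finally show "norm (blinfun_apply T ?y) \<le> norm T * (1 / (r - norm T) * norm x)"
          by (simp add: mult_left_mono)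
      qed (use K in auto)
      finally show "cmod (u z - \<phi> x * (1 / z)) \<le> norm T * norm x * K / (r * (r - norm T))"
        using r0 r by (simp add: field_simps)
    qed (use r0 r K in auto)
    moreover have "contour_integral ?C u - \<phi> x * (2 * pi * \<i>) =
        (2 * pi * \<i>) * (\<phi> (blinfun_apply (dunford_integral \<Gamma> (\<lambda>z. 1) T) x) - \<phi> x)"
      unfolding e1 by (simp add: field_simps)
    ultimately have "2 * pi * d \<le> norm T * norm x * K / (r * (r - norm T)) * (2 * pi * r)"
      by (simp add: d_def norm_mult)
    also have "norm T * norm x * K / (r * (r - norm T)) * (2 * pi * r) = 2 * pi * (norm T * norm x * K / (r - norm T))"
      using r r0 by (simp add: divide_simps)
    finally have "d \<le> norm T * norm x * K / (r - norm T)"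
      by (rule mult_left_le_imp_le) simp
    then show ?thesis using r by (simp add: pos_le_divide_eq)
  qed
  have "d = 0"
  proof (rule ccontr)
    assume "d \<noteq> 0"
    then have d: "d > 0" by (simp add: d_def)
    define M where "M = norm T * norm x * K"
    have "M \<ge> 0" using K by (simp add: M_def)
    then have "d * ((norm T + (M + 1) / d) - norm T) \<le> M"
      unfolding M_def using d by (intro bound) (auto simp: M_def[symmetric])
    then show False using d by simp
  qed
  then show "\<phi> (blinfun_apply (dunford_integral \<Gamma> (\<lambda>z. 1) T) x) = \<phi> x" by (simp add: d_def)
qed

text \<open>
  Multiplicativity for a simple fraction, from \<open>(\<zeta> - T) k(T) = f(T)\<close> for \<open>k(z) = f(z)/(\<zeta> - z)\<close>.
\<close>

lemma calculus_resolvent: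
  assumes adm: "admissible T \<Gamma> \<Omega>" and f: "f holomorphic_on \<Omega>"
    and \<zeta>: "\<zeta> \<notin> \<Omega>"
  shows "blinfun_apply (dunford_integral \<Gamma> (\<lambda>z. f z / (\<zeta> - z)) T) x
    = blinfun_apply (resolvent T \<zeta>) (blinfun_apply (dunford_integral \<Gamma> f T) x)"
proof -
  define k where "k = (\<lambda>z. f z / (\<zeta> - z))"
  have k: "k holomorphic_on \<Omega>" "(\<lambda>z. \<zeta> * k z) holomorphic_on \<Omega>" "(\<lambda>z. (-1) * (z * k z)) holomorphic_on \<Omega>"
      "(\<lambda>z. z * k z) holomorphic_on \<Omega>"
    unfolding k_def using f \<zeta> by (auto intro!: holomorphic_intros)
  have s: "\<zeta> \<notin> op_spectrum T" using admissibleD(5)[OF adm] \<zeta> by blast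
  let ?y = "blinfun_apply (dunford_integral \<Gamma> k T) x"
  have "blinfun_apply (dunford_integral \<Gamma> f T) x = blinfun_apply (dunford_integral \<Gamma> (\<lambda>z. \<zeta> * k z + (-1) * (z * k z)) T) x"
    by (rule calculus_cong[OF adm f]) (use \<zeta> in \<open>auto simp: k_def divide_simps, auto simp: algebra_simps\<close>)
  also have "\<dots> = \<zeta> *\<^sub>C ?y - blinfun_apply T ?y"
    unfolding calculus_add[OF adm k(2,3)] calculus_cmult[OF adm k(1)] calculus_cmult[OF adm k(4)] calculus_mult_var[OF adm k(1)]
    by (simp add: scaleC_minus_left scaleC_one)
  finally have "blinfun_apply (resolvent T \<zeta>) (blinfun_apply (dunford_integral \<Gamma> f T) x) = ?y"
    by (simp add: blinfun.bilinear_simps resolvent_left[OF s] complex_linear_opD[OF resolvent_complex_linear[OF s]])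
  then show ?thesis by (simp add: k_def)
qed

lemma calculus_rational_sum:
  assumes "admissible T \<Gamma> \<Omega>" "f holomorphic_on \<Omega>"
    and "\<And>c \<zeta>. (c, \<zeta>) \<in> set ps \<Longrightarrow> \<zeta> \<notin> \<Omega>"
  shows "blinfun_apply (dunford_integral \<Gamma> (\<lambda>z. (\<Sum>(c, \<zeta>)\<leftarrow>ps. c / (\<zeta> - z)) * f z) T) x
    = (\<Sum>(c, \<zeta>)\<leftarrow>ps. c *\<^sub>C blinfun_apply (resolvent T \<zeta>) (blinfun_apply (dunford_integral \<Gamma> f T) x))"
  using assms(3)
proof (induction ps)
  case Nil
  have "blinfun_apply (dunford_integral \<Gamma> (\<lambda>z. 0 * f z) T) x = 0 *\<^sub>C blinfun_apply (dunford_integral \<Gamma> f T) x"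
    by (rule calculus_cmult[OF assms(1,2)])
  then show ?case by simp
next
  case (Cons p ps)
  obtain c \<zeta> where p: "p = (c, \<zeta>)" by (cases p)
  have \<zeta>: "\<zeta> \<notin> \<Omega>" using Cons.prems p by auto
  have h: "(\<lambda>z. f z / (\<zeta> - z)) holomorphic_on \<Omega>" "(\<lambda>z. c * (f z / (\<zeta> - z))) holomorphic_on \<Omega>"
    using assms(2) \<zeta> by (auto intro!: holomorphic_intros)
  have q: "(\<lambda>z. (\<Sum>(c, \<zeta>)\<leftarrow>ps. c / (\<zeta> - z)) * f z) holomorphic_on \<Omega>"
    by (intro holomorphic_on_mult rational_sum_holomorphic assms(2)) (use Cons.prems in auto)
  have "(\<lambda>z. (\<Sum>(c, \<zeta>)\<leftarrow>p # ps. c / (\<zeta> - z)) * f z) = (\<lambda>z. c * (f z / (\<zeta> - z)) + (\<Sum>(c, \<zeta>)\<leftarrow>ps. c / (\<zeta> - z)) * f z)"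
    by (simp add: p distrib_right)
  moreover have "blinfun_apply (dunford_integral \<Gamma> (\<lambda>z. (\<Sum>(c, \<zeta>)\<leftarrow>ps. c / (\<zeta> - z)) * f z) T) x
    = (\<Sum>(c, \<zeta>)\<leftarrow>ps. c *\<^sub>C blinfun_apply (resolvent T \<zeta>) (blinfun_apply (dunford_integral \<Gamma> f T) x))"
    by (rule Cons.IH) (use Cons.prems in auto)
  ultimately show ?case
    using calculus_add[OF assms(1) h(2) q] calculus_cmult[OF assms(1) h(1)] calculus_resolvent[OF assms(1,2) \<zeta>]
    by (simp add: p)
qed

lemma admissible_remove_poles:
  assumes "admissible T \<Gamma> \<Omega>"
    "\<And>c \<zeta>. (c, \<zeta>) \<in> set ps \<Longrightarrow> \<zeta> \<notin> (\<Union>\<gamma>\<in>set \<Gamma>. path_image \<gamma>)"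
    "\<And>c \<zeta>. (c, \<zeta>) \<in> set ps \<Longrightarrow> cycle_winding \<Gamma> \<zeta> = 0"
  shows "admissible T \<Gamma> (\<Omega> - snd ` set ps)"
  using assms(2,3)
proof (induction ps)
  case Nil
  then show ?case using assms(1) by simp
next
  case (Cons p ps)
  have "admissible T \<Gamma> (\<Omega> - snd ` set ps)" by (rule Cons.IH; (rule Cons.prems, erule list.set_intros(2)))
  then have "admissible T \<Gamma> (\<Omega> - snd ` set ps - {snd p})"
    using Cons.prems[of "fst p" "snd p"] by (intro admissible_remove) auto
  moreover have "\<Omega> - snd ` set ps - {snd p} = \<Omega> - snd ` set (p # ps)" by auto
  ultimately show ?case by simp
qed

text \<open>
  Multiplicativity: it holds for rational \<open>h\<close> by \<open>calculus_rational_sum\<close>, and the approximants of \<open>h\<close>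
  given by \<open>cycle_rational_approx\<close> serve for both sides.
\<close>

theorem calculus_mult:
  assumes adm: "admissible T \<Gamma> \<Omega>" and h: "h holomorphic_on \<Omega>" and f: "f holomorphic_on \<Omega>"
  shows "blinfun_apply (dunford_integral \<Gamma> (\<lambda>z. h z * f z) T) x
    = blinfun_apply (dunford_integral \<Gamma> h T) (blinfun_apply (dunford_integral \<Gamma> f T) x)"
proof (rule eq_by_functionals)
  fix \<phi> :: "'a \<Rightarrow> complex" assume \<phi>: "clinear_functional \<phi>"
  obtain Q :: "nat \<Rightarrow> (complex \<times> complex) list" where
    Q: "\<And>n c \<zeta>. (c, \<zeta>) \<in> set (Q n) \<Longrightarrow> \<zeta> \<notin> (\<Union>\<gamma>\<in>set \<Gamma>. path_image \<gamma>)"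
    "\<And>n c \<zeta>. (c, \<zeta>) \<in> set (Q n) \<Longrightarrow> cycle_winding \<Gamma> \<zeta> = 0"
    "\<And>U u. cycle_in \<Gamma> U \<Longrightarrow> u holomorphic_on U \<Longrightarrow>
      (\<lambda>n. cycle_integral \<Gamma> (\<lambda>w. (\<Sum>(c, \<zeta>)\<leftarrow>Q n. c / (\<zeta> - w)) * u w)) \<longlonglongrightarrow> cycle_integral \<Gamma> (\<lambda>w. h w * u w)"
    using cycle_rational_approx[OF admissibleD(3,7)[OF adm] h] by blast
  define q where "q = (\<lambda>n w. \<Sum>(c, \<zeta>)\<leftarrow>Q n. c / (\<zeta> - w))"
  define \<Omega>' where "\<Omega>' = (\<lambda>n. \<Omega> - snd ` set (Q n))"
  have adm': "admissible T \<Gamma> (\<Omega>' n)" for n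
    unfolding \<Omega>'_def by (rule admissible_remove_poles[OF adm Q(1,2)])
  have poles: "\<zeta> \<notin> \<Omega>' n" if "(c, \<zeta>) \<in> set (Q n)" for c \<zeta> n
    using that by (force simp: \<Omega>'_def)
  have approx: "(\<lambda>n. \<phi> (blinfun_apply (dunford_integral \<Gamma> (\<lambda>z. q n z * g z) T) y)) \<longlonglongrightarrow>
      \<phi> (blinfun_apply (dunford_integral \<Gamma> (\<lambda>z. h z * g z) T) y)" if g: "g holomorphic_on \<Omega>" for g y
  proof -
    have "(\<lambda>z. q n z * g z) holomorphic_on \<Omega>' n" for n
      unfolding q_def by (intro holomorphic_on_mult rational_sum_holomorphic poles holomorphic_on_subset[OF g]) (auto simp: \<Omega>'_def)
    then have 1: "\<phi> (blinfun_apply (dunford_integral \<Gamma> (\<lambda>z. q n z * g z) T) y)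
       = 1 / (2 * pi * \<i>) * cycle_integral \<Gamma> (\<lambda>z. q n z * g z * \<phi> (blinfun_apply (resolvent T z) y))" for n
      by (rule functional_calculus[OF adm' _ \<phi>])
    have 2: "\<phi> (blinfun_apply (dunford_integral \<Gamma> (\<lambda>z. h z * g z) T) y)
       = 1 / (2 * pi * \<i>) * cycle_integral \<Gamma> (\<lambda>z. h z * g z * \<phi> (blinfun_apply (resolvent T z) y))"
      by (rule functional_calculus[OF adm holomorphic_on_mult[OF h g] \<phi>])
    show ?thesis
      unfolding 1 2 mult.assoc[of _ "g _"]
      unfolding q_def
      by (rule tendsto_mult[OF tendsto_const Q(3)[OF admissibleD(4)[OF adm] calculus_integrand_holomorphic[OF g \<phi>]]])
  qed
  let ?y = "blinfun_apply (dunford_integral \<Gamma> f T) x"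
  have eq: "blinfun_apply (dunford_integral \<Gamma> (\<lambda>z. q n z * f z) T) x = blinfun_apply (dunford_integral \<Gamma> (\<lambda>z. q n z * 1) T) ?y" for n
  proof -
    have "f holomorphic_on \<Omega>' n" using f by (rule holomorphic_on_subset) (auto simp: \<Omega>'_def)
    then show ?thesis
      using calculus_rational_sum[OF adm', of f n "Q n" x] calculus_rational_sum[OF adm', of "\<lambda>z. 1" n "Q n" ?y] poles
      unfolding calculus_one[OF adm] q_def by simp
  qed
  have "(\<lambda>n. \<phi> (blinfun_apply (dunford_integral \<Gamma> (\<lambda>z. q n z * f z) T) x)) \<longlonglongrightarrow> \<phi> (blinfun_apply (dunford_integral \<Gamma> (\<lambda>z. h z * 1) T) ?y)"
    unfolding eq by (rule approx) auto
  with approx[OF f, of x]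
  show "\<phi> (blinfun_apply (dunford_integral \<Gamma> (\<lambda>z. h z * f z) T) x) = \<phi> (blinfun_apply (dunford_integral \<Gamma> h T) ?y)"
    using LIMSEQ_unique by fastforce
qed

lemma admissible_exists:
  fixes T :: "'a::complex_banach \<Rightarrow>\<^sub>L 'a"
  assumes "complex_linear_op T" "open \<Omega>" "op_spectrum T \<subseteq> \<Omega>"
  shows "\<exists>\<Gamma>. admissible T \<Gamma> \<Omega>"
  using exists_encloses[OF compact_op_spectrum[OF assms(1)] assms(2,3)] assms by (auto simp: admissible_def)

lemma riesz_dunford_admissible:
  fixes T :: "'a::complex_banach \<Rightarrow>\<^sub>L 'a"
  assumes "complex_linear_op T" "open \<Omega>" "op_spectrum T \<subseteq> \<Omega>"
  obtains \<Gamma> where "admissible T \<Gamma> \<Omega>" "\<And>f. riesz_dunford \<Omega> f T = dunford_integral \<Gamma> f T"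
proof -
  have "encloses (SOME \<Gamma>. encloses \<Gamma> (op_spectrum T) \<Omega>) (op_spectrum T) \<Omega>"
    by (rule someI_ex) (use admissible_exists[OF assms] in \<open>auto simp: admissible_def\<close>)
  then show ?thesis using that assms unfolding admissible_def riesz_dunford_def by blast
qed

section \<open>Unconditional bases of subspaces\<close>

text \<open>
  The linear span of a family of subspaces, as the set of finite sums; the summands are extended by
  zero outside the finite set.
\<close>

definition finite_sums :: "('i \<Rightarrow> 'a::complex_normed_vector set) \<Rightarrow> 'i set \<Rightarrow> 'a set"
  where "finite_sums E D =
    {\<Sum>\<alpha>\<in>H. y \<alpha> | H y. finite H \<and> H \<subseteq> D \<and> (\<forall>\<alpha>. y \<alpha> \<in> (if \<alpha> \<in> H then E \<alpha> else {0}))}"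

lemma finite_sumsI:
  assumes "finite H" "H \<subseteq> D" "\<And>\<alpha>. \<alpha> \<in> H \<Longrightarrow> y \<alpha> \<in> E \<alpha>"
  shows "(\<Sum>\<alpha>\<in>H. y \<alpha>) \<in> finite_sums E D"
proof -
  have "(\<Sum>\<alpha>\<in>H. y \<alpha>) = (\<Sum>\<alpha>\<in>H. if \<alpha> \<in> H then y \<alpha> else 0)" by (rule sum.cong) auto
  then show ?thesis unfolding finite_sums_def using assms
    by (intro CollectI exI[of _ H] exI[of _ "\<lambda>\<alpha>. if \<alpha> \<in> H then y \<alpha> else 0"]) auto
qed

lemma finite_sumsE:
  assumes "x \<in> finite_sums E D"
  obtains H y where "finite H" "H \<subseteq> D" "\<forall>\<alpha>\<in>H. y \<alpha> \<in> E \<alpha>" "\<forall>\<alpha>. \<alpha> \<notin> H \<longrightarrow> y \<alpha> = 0" "x = (\<Sum>\<alpha>\<in>H. y \<alpha>)"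
proof -
  obtain H y where *: "finite H" "H \<subseteq> D" "\<forall>\<alpha>. y \<alpha> \<in> (if \<alpha> \<in> H then E \<alpha> else {0})" "x = (\<Sum>\<alpha>\<in>H. y \<alpha>)"
    using assms unfolding finite_sums_def by blast
  have "\<forall>\<alpha>\<in>H. y \<alpha> \<in> E \<alpha>" "\<forall>\<alpha>. \<alpha> \<notin> H \<longrightarrow> y \<alpha> = 0"
    using *(3) by (auto split: if_splits)
  with * show ?thesis by (intro that)
qed

lemma subspace_finite_sums:
  assumes "\<And>\<alpha>. \<alpha> \<in> D \<Longrightarrow> complex_vector.subspace (E \<alpha>)"
  shows "complex_vector.subspace (finite_sums E D)"
proof (rule complex_vector.subspaceI)
  show "0 \<in> finite_sums E D" using finite_sumsI[of "{}" D "\<lambda>_. 0" E] by simp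
next
  fix x y assume x: "x \<in> finite_sums E D" and y: "y \<in> finite_sums E D"
  obtain H u where u': "finite H" "H \<subseteq> D" "\<forall>\<alpha>\<in>H. u \<alpha> \<in> E \<alpha>"
      "\<forall>\<alpha>. \<alpha> \<notin> H \<longrightarrow> u \<alpha> = 0" "x = (\<Sum>\<alpha>\<in>H. u \<alpha>)"
    by (rule finite_sumsE[OF x])
  note u = u'(1,2) u'(3)[rule_format] u'(4)[rule_format] u'(5)
  obtain K v where v': "finite K" "K \<subseteq> D" "\<forall>\<alpha>\<in>K. v \<alpha> \<in> E \<alpha>"
      "\<forall>\<alpha>. \<alpha> \<notin> K \<longrightarrow> v \<alpha> = 0" "y = (\<Sum>\<alpha>\<in>K. v \<alpha>)"
    by (rule finite_sumsE[OF y])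
  note v = v'(1,2) v'(3)[rule_format] v'(4)[rule_format] v'(5)
  have "x = (\<Sum>\<alpha>\<in>H \<union> K. u \<alpha>)" unfolding u(5) by (rule sum.mono_neutral_left) (use u v in auto)
  moreover have "y = (\<Sum>\<alpha>\<in>H \<union> K. v \<alpha>)" unfolding v(5) by (rule sum.mono_neutral_left) (use u v in auto)
  ultimately have "x + y = (\<Sum>\<alpha>\<in>H \<union> K. u \<alpha> + v \<alpha>)" by (simp add: sum.distrib)
  moreover have "u \<alpha> + v \<alpha> \<in> E \<alpha>" if "\<alpha> \<in> H \<union> K" for \<alpha>
  proof -
    have s: "complex_vector.subspace (E \<alpha>)" using assms that u(2) v(2) by blast
    have "u \<alpha> \<in> E \<alpha>" "v \<alpha> \<in> E \<alpha>"
      using u(3,4)[of \<alpha>] v(3,4)[of \<alpha>] complex_vector.subspace_0[OF s] by (cases "\<alpha> \<in> H"; cases "\<alpha> \<in> K"; simp)+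
    then show ?thesis by (rule complex_vector.subspace_add[OF s])
  qed
  ultimately show "x + y \<in> finite_sums E D" using u v finite_sumsI[of "H \<union> K" D "\<lambda>\<alpha>. u \<alpha> + v \<alpha>" E] by simp
next
  fix c x assume "x \<in> finite_sums E D"
  then obtain H u where u': "finite H" "H \<subseteq> D" "\<forall>\<alpha>\<in>H. u \<alpha> \<in> E \<alpha>"
      "\<forall>\<alpha>. \<alpha> \<notin> H \<longrightarrow> u \<alpha> = 0" "x = (\<Sum>\<alpha>\<in>H. u \<alpha>)"
    by (rule finite_sumsE)
  note u = u'(1,2) u'(3)[rule_format] u'(4)[rule_format] u'(5)
  have "c *\<^sub>C x = (\<Sum>\<alpha>\<in>H. c *\<^sub>C u \<alpha>)" unfolding u(5) by (rule complex_vector.scale_sum_right)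
  also have "\<dots> \<in> finite_sums E D"
    using u assms by (intro finite_sumsI complex_vector.subspace_scale) auto
  finally show "c *\<^sub>C x \<in> finite_sums E D" .
qed

lemma span_UN_eq_finite_sums:
  assumes "\<And>\<alpha>. \<alpha> \<in> D \<Longrightarrow> complex_vector.subspace (E \<alpha>)"
  shows "complex_vector.span (\<Union>\<alpha>\<in>D. E \<alpha>) = finite_sums E D"
proof
  show "complex_vector.span (\<Union>\<alpha>\<in>D. E \<alpha>) \<subseteq> finite_sums E D"
  proof (rule complex_vector.span_minimal[OF _ subspace_finite_sums[OF assms]])
    show "(\<Union>\<alpha>\<in>D. E \<alpha>) \<subseteq> finite_sums E D"
    proof
      fix x assume "x \<in> (\<Union>\<alpha>\<in>D. E \<alpha>)"
      then obtain \<alpha> where "\<alpha> \<in> D" "x \<in> E \<alpha>" by blast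
      then show "x \<in> finite_sums E D" using finite_sumsI[of "{\<alpha>}" D "\<lambda>_. x" E] by simp
    qed
  qed
  show "finite_sums E D \<subseteq> complex_vector.span (\<Union>\<alpha>\<in>D. E \<alpha>)"
  proof
    fix x assume "x \<in> finite_sums E D"
    then obtain H u where u': "finite H" "H \<subseteq> D" "\<forall>\<alpha>\<in>H. u \<alpha> \<in> E \<alpha>"
        "\<forall>\<alpha>. \<alpha> \<notin> H \<longrightarrow> u \<alpha> = 0" "x = (\<Sum>\<alpha>\<in>H. u \<alpha>)"
      by (rule finite_sumsE)
    note u = u'(1,2) u'(3)[rule_format] u'(4)[rule_format] u'(5)
    show "x \<in> complex_vector.span (\<Union>\<alpha>\<in>D. E \<alpha>)"
      unfolding u(5) by (intro complex_vector.span_sum complex_vector.span_base) (use u(2,3) in blast)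
  qed
qed

text \<open>
  The inequality in the definition of an unconditional basis, with its constant as a parameter.  It
  implies linear independence (case of one-element \<open>F1\<close>).
\<close>

definition unconditional_bound :: "real \<Rightarrow> 'i set \<Rightarrow> ('i \<Rightarrow> 'a::complex_normed_vector set) \<Rightarrow> bool"
  where "unconditional_bound C A X \<longleftrightarrow> C > 0 \<and> (\<forall>F1 F2 x. F1 \<subseteq> F2 \<and> finite F2 \<and> F2 \<subseteq> A \<and> (\<forall>\<alpha>\<in>A. x \<alpha> \<in> X \<alpha>) \<longrightarrow>
       norm (\<Sum>\<alpha>\<in>F1. x \<alpha>) \<le> C * norm (\<Sum>\<alpha>\<in>F2. x \<alpha>))"

lemma unconditional_boundD:
  assumes "unconditional_bound C A X" "\<And>\<alpha>. \<alpha> \<in> A \<Longrightarrow> complex_vector.subspace (X \<alpha>)"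
    and "F1 \<subseteq> F2" "finite F2" "F2 \<subseteq> A" "\<And>\<alpha>. \<alpha> \<in> F2 \<Longrightarrow> x \<alpha> \<in> X \<alpha>"
  shows "norm (\<Sum>\<alpha>\<in>F1. x \<alpha>) \<le> C * norm (\<Sum>\<alpha>\<in>F2. x \<alpha>)"
proof -
  let ?x = "\<lambda>\<alpha>. if \<alpha> \<in> F2 then x \<alpha> else 0"
  have "\<forall>\<alpha>\<in>A. ?x \<alpha> \<in> X \<alpha>" using assms(2,6) by (simp add: complex_vector.subspace_0)
  then have "norm (\<Sum>\<alpha>\<in>F1. ?x \<alpha>) \<le> C * norm (\<Sum>\<alpha>\<in>F2. ?x \<alpha>)"
    using assms(1)[unfolded unconditional_bound_def, THEN conjunct2, rule_format, of F1 F2 ?x] assms(3-5) by simp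
  also have "(\<Sum>\<alpha>\<in>F1. ?x \<alpha>) = (\<Sum>\<alpha>\<in>F1. x \<alpha>)" using assms(3) by (intro sum.cong) auto
  also have "(\<Sum>\<alpha>\<in>F2. ?x \<alpha>) = (\<Sum>\<alpha>\<in>F2. x \<alpha>)" by (intro sum.cong) auto
  finally show ?thesis .
qed

lemma unconditional_basis_iff:
  "unconditional_basis A X \<longleftrightarrow> countable A \<and> (\<forall>\<alpha>\<in>A. complex_vector.subspace (X \<alpha>)) \<and>
     closure (complex_vector.span (\<Union>\<alpha>\<in>A. X \<alpha>)) = UNIV \<and> (\<exists>C. unconditional_bound C A X)"
proof -
  have "independent_subspaces A X" if C: "unconditional_bound C A X" and sub: "\<And>\<alpha>. \<alpha> \<in> A \<Longrightarrow> complex_vector.subspace (X \<alpha>)" for C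
    unfolding independent_subspaces_def
  proof (intro allI impI ballI)
    fix F x \<alpha> assume F: "finite F \<and> F \<subseteq> A \<and> (\<forall>\<alpha>\<in>F. x \<alpha> \<in> X \<alpha>) \<and> (\<Sum>\<alpha>\<in>F. x \<alpha>) = 0" and \<alpha>: "\<alpha> \<in> F"
    have "norm (\<Sum>\<alpha>\<in>{\<alpha>}. x \<alpha>) \<le> C * norm (\<Sum>\<alpha>\<in>F. x \<alpha>)"
      by (rule unconditional_boundD[OF C sub]) (use F \<alpha> in auto)
    then show "x \<alpha> = 0" using F by simp
  qed
  moreover have "(\<exists>C>0. \<forall>F1 F2 x. F1 \<subseteq> F2 \<and> finite F2 \<and> F2 \<subseteq> A \<and> (\<forall>\<alpha>\<in>A. x \<alpha> \<in> X \<alpha>) \<longrightarrow>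
       norm (\<Sum>\<alpha>\<in>F1. x \<alpha>) \<le> C * norm (\<Sum>\<alpha>\<in>F2. x \<alpha>)) \<longleftrightarrow> (\<exists>C. unconditional_bound C A X)"
    by (simp add: unconditional_bound_def)
  ultimately show ?thesis unfolding unconditional_basis_def by auto
qed

text \<open>
  The inequality persists when the part outside the finite set \<open>G\<close> is a limit of finite sums.
\<close>

lemma unconditional_bound_closure:
  assumes C: "unconditional_bound C A X" "\<And>\<alpha>. \<alpha> \<in> A \<Longrightarrow> complex_vector.subspace (X \<alpha>)"
    and G: "F1 \<subseteq> G" "finite G" "G \<subseteq> A" "\<And>\<alpha>. \<alpha> \<in> G \<Longrightarrow> v \<alpha> \<in> X \<alpha>"
    and w: "w \<in> closure (finite_sums X (A - G))"
  shows "norm (\<Sum>\<alpha>\<in>F1. v \<alpha>) \<le> C * norm ((\<Sum>\<alpha>\<in>G. v \<alpha>) + w)"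
proof -
  let ?S = "{w. norm (\<Sum>\<alpha>\<in>F1. v \<alpha>) \<le> C * norm ((\<Sum>\<alpha>\<in>G. v \<alpha>) + w)}"
  have "closed ?S" by (intro closed_Collect_le continuous_intros)
  moreover have "finite_sums X (A - G) \<subseteq> ?S"
  proof
    fix w assume "w \<in> finite_sums X (A - G)"
    then obtain H y where H': "finite H" "H \<subseteq> A - G" "\<forall>\<alpha>\<in>H. y \<alpha> \<in> X \<alpha>"
        "\<forall>\<alpha>. \<alpha> \<notin> H \<longrightarrow> y \<alpha> = 0" "w = (\<Sum>\<alpha>\<in>H. y \<alpha>)"
      by (rule finite_sumsE)
    note H = H'(1,2) H'(3)[rule_format] H'(4)[rule_format] H'(5)
    let ?x = "\<lambda>\<alpha>. if \<alpha> \<in> G then v \<alpha> else y \<alpha>"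
    have "norm (\<Sum>\<alpha>\<in>F1. ?x \<alpha>) \<le> C * norm (\<Sum>\<alpha>\<in>G \<union> H. ?x \<alpha>)"
      by (rule unconditional_boundD[OF C]) (use G H in auto)
    moreover have "(\<Sum>\<alpha>\<in>F1. ?x \<alpha>) = (\<Sum>\<alpha>\<in>F1. v \<alpha>)" using G(1) by (intro sum.cong) auto
    moreover have "(\<Sum>\<alpha>\<in>G \<union> H. ?x \<alpha>) = (\<Sum>\<alpha>\<in>G. ?x \<alpha>) + (\<Sum>\<alpha>\<in>H. ?x \<alpha>)"
      using G(2) H(1,2) by (intro sum.union_disjoint) auto
    moreover have "(\<Sum>\<alpha>\<in>G. ?x \<alpha>) = (\<Sum>\<alpha>\<in>G. v \<alpha>)" by (intro sum.cong) auto
    moreover have "(\<Sum>\<alpha>\<in>H. ?x \<alpha>) = w" unfolding H(5) using H(2) by (intro sum.cong) auto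
    ultimately show "w \<in> ?S" by simp
  qed
  ultimately show ?thesis using w closure_minimal by blast
qed

text \<open>
  Every vector has components with respect to finitely many members of the basis: the components of
  approximating finite sums form Cauchy sequences.
\<close>

lemma finite_part_decomposition:
  fixes X :: "'i \<Rightarrow> 'a::complex_banach set"
  assumes C: "unconditional_bound C A X" and sub: "\<And>\<alpha>. \<alpha> \<in> A \<Longrightarrow> complex_vector.subspace (X \<alpha>)"
    and cl: "\<And>\<alpha>. \<alpha> \<in> A \<Longrightarrow> closed (X \<alpha>)" and dense: "closure (finite_sums X A) = UNIV"
    and G: "finite G" "G \<subseteq> A"
  obtains v where "\<forall>\<alpha>\<in>G. v \<alpha> \<in> X \<alpha>" "x - (\<Sum>\<alpha>\<in>G. v \<alpha>) \<in> closure (finite_sums X (A - G))"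
proof -
  have "x \<in> closure (finite_sums X A)" using dense by simp
  then obtain s where s: "\<And>n. s n \<in> finite_sums X A" "s \<longlonglongrightarrow> x" unfolding closure_sequential by blast
  have "\<forall>n. \<exists>p. finite (fst p) \<and> fst p \<subseteq> A \<and> (\<forall>\<alpha>\<in>fst p. snd p \<alpha> \<in> X \<alpha>) \<and>
      (\<forall>\<alpha>. \<alpha> \<notin> fst p \<longrightarrow> snd p \<alpha> = 0) \<and> s n = (\<Sum>\<alpha>\<in>fst p. snd p \<alpha>)"
  proof
    fix n
    obtain H y where "finite H" "H \<subseteq> A" "\<forall>\<alpha>\<in>H. y \<alpha> \<in> X \<alpha>"
        "\<forall>\<alpha>. \<alpha> \<notin> H \<longrightarrow> y \<alpha> = 0" "s n = (\<Sum>\<alpha>\<in>H. y \<alpha>)"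
      by (rule finite_sumsE[OF s(1)[of n]])
    then show "\<exists>p. finite (fst p) \<and> fst p \<subseteq> A \<and> (\<forall>\<alpha>\<in>fst p. snd p \<alpha> \<in> X \<alpha>) \<and>
        (\<forall>\<alpha>. \<alpha> \<notin> fst p \<longrightarrow> snd p \<alpha> = 0) \<and> s n = (\<Sum>\<alpha>\<in>fst p. snd p \<alpha>)"
      by (intro exI[of _ "(H, y)"]) simp
  qed
  from choice[OF this] obtain p where p: "\<And>n. finite (fst (p n)) \<and> fst (p n) \<subseteq> A \<and> (\<forall>\<alpha>\<in>fst (p n). snd (p n) \<alpha> \<in> X \<alpha>) \<and>
      (\<forall>\<alpha>. \<alpha> \<notin> fst (p n) \<longrightarrow> snd (p n) \<alpha> = 0) \<and> s n = (\<Sum>\<alpha>\<in>fst (p n). snd (p n) \<alpha>)"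
    by blast
  define H where "H = (\<lambda>n. fst (p n))"
  define y where "y = (\<lambda>n. snd (p n))"
  have H: "\<And>n. finite (H n)" "\<And>n. H n \<subseteq> A" "\<And>n \<alpha>. \<alpha> \<in> H n \<Longrightarrow> y n \<alpha> \<in> X \<alpha>"
    "\<And>n \<alpha>. \<alpha> \<notin> H n \<Longrightarrow> y n \<alpha> = 0" "\<And>n. s n = (\<Sum>\<alpha>\<in>H n. y n \<alpha>)"
    using p by (simp_all add: H_def y_def)
  have yX: "y n \<alpha> \<in> X \<alpha>" if "\<alpha> \<in> A" for n \<alpha>
    using H(3,4)[of \<alpha> n] complex_vector.subspace_0[OF sub[OF that]] by (cases "\<alpha> \<in> H n") auto
  have ext: "s n = (\<Sum>\<alpha>\<in>H n \<union> K. y n \<alpha>)" if "finite K" for n K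
    unfolding H(5) by (rule sum.mono_neutral_left) (use H that in auto)
  have diff: "norm (y n \<alpha> - y m \<alpha>) \<le> C * norm (s n - s m)" if "\<alpha> \<in> G" for n m \<alpha>
  proof -
    let ?F = "H n \<union> (H m \<union> G)"
    have "norm (\<Sum>\<alpha>\<in>{\<alpha>}. y n \<alpha> - y m \<alpha>) \<le> C * norm (\<Sum>\<alpha>\<in>?F. y n \<alpha> - y m \<alpha>)"
    proof (rule unconditional_boundD[OF C sub])
      fix \<beta> assume "\<beta> \<in> ?F"
      then have "\<beta> \<in> A" using H(2) G(2) by blast
      then show "y n \<beta> - y m \<beta> \<in> X \<beta>" by (intro complex_vector.subspace_diff sub yX)
    qed (use H(1,2) G that in auto)
    moreover have "s n = (\<Sum>\<alpha>\<in>?F. y n \<alpha>)" using ext[of "H m \<union> G" n] H(1) G(1) by simp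
    moreover have "s m = (\<Sum>\<alpha>\<in>?F. y m \<alpha>)"
      using ext[of "H n \<union> G" m] H(1) G(1) by (simp add: Un_left_commute)
    ultimately show ?thesis by (simp add: sum_subtractf)
  qed
  have "\<exists>l. (\<lambda>n. y n \<alpha>) \<longlonglongrightarrow> l" if \<alpha>: "\<alpha> \<in> G" for \<alpha>
  proof -
    have C0: "C > 0" using C by (simp add: unconditional_bound_def)
    have "Cauchy s" using s(2) by (rule LIMSEQ_imp_Cauchy)
    have "Cauchy (\<lambda>n. y n \<alpha>)"
    proof (rule CauchyI)
      fix e :: real assume "e > 0"
      then have "e / C > 0" using C0 by simp
      then obtain N where N: "\<And>m n. m \<ge> N \<Longrightarrow> n \<ge> N \<Longrightarrow> norm (s m - s n) < e / C"
        using CauchyD[OF \<open>Cauchy s\<close>] by blast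
      show "\<exists>M. \<forall>m\<ge>M. \<forall>n\<ge>M. norm (y m \<alpha> - y n \<alpha>) < e"
      proof (intro exI[of _ N] allI impI)
        fix m n assume "N \<le> m" "N \<le> n"
        then have "C * norm (s m - s n) < e" using N[of m n] C0 by (simp add: field_simps)
        then show "norm (y m \<alpha> - y n \<alpha>) < e" using diff[OF \<alpha>, of m n] by linarith
      qed
    qed
    then show ?thesis by (simp add: Cauchy_convergent convergent_def[symmetric])
  qed
  then have "\<forall>\<alpha>. \<exists>l. \<alpha> \<in> G \<longrightarrow> (\<lambda>n. y n \<alpha>) \<longlonglongrightarrow> l" by blast
  from choice[OF this] obtain v where v: "\<And>\<alpha>. \<alpha> \<in> G \<Longrightarrow> (\<lambda>n. y n \<alpha>) \<longlonglongrightarrow> v \<alpha>" by blast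
  show ?thesis
  proof (rule that)
    show "\<forall>\<alpha>\<in>G. v \<alpha> \<in> X \<alpha>"
    proof
      fix \<alpha> assume \<alpha>: "\<alpha> \<in> G"
      then have "\<alpha> \<in> A" using G by blast
      then show "v \<alpha> \<in> X \<alpha>" using closed_sequentially[OF cl _ v[OF \<alpha>]] yX by blast
    qed
    have "s n - (\<Sum>\<alpha>\<in>G. y n \<alpha>) \<in> finite_sums X (A - G)" for n
    proof -
      have "s n = (\<Sum>\<alpha>\<in>H n \<union> G. y n \<alpha>)" by (rule ext[OF G(1)])
      also have "\<dots> = (\<Sum>\<alpha>\<in>G. y n \<alpha>) + (\<Sum>\<alpha>\<in>H n - G. y n \<alpha>)"
        using H(1) G(1) by (subst sum.union_disjoint[symmetric]) (auto intro!: sum.cong)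
      finally have "s n - (\<Sum>\<alpha>\<in>G. y n \<alpha>) = (\<Sum>\<alpha>\<in>H n - G. y n \<alpha>)" by simp
      also have "\<dots> \<in> finite_sums X (A - G)" by (rule finite_sumsI) (use H in auto)
      finally show ?thesis .
    qed
    moreover have "(\<lambda>n. s n - (\<Sum>\<alpha>\<in>G. y n \<alpha>)) \<longlonglongrightarrow> x - (\<Sum>\<alpha>\<in>G. v \<alpha>)"
      by (intro tendsto_intros s(2) v)
    ultimately show "x - (\<Sum>\<alpha>\<in>G. v \<alpha>) \<in> closure (finite_sums X (A - G))"
      unfolding closure_sequential by (intro exI[of _ "\<lambda>n. s n - (\<Sum>\<alpha>\<in>G. y n \<alpha>)"]) simp
  qed
qed

text \<open>
  If \<open>S\<close> is the scalar \<open>g \<alpha>\<close> on the member \<open>X \<alpha>\<close> of the basis, then every eigenvector of \<open>S\<close> for \<open>\<mu>\<close> is a sum of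
  vectors from the members with \<open>g \<alpha> = \<mu>\<close>.
\<close>

lemma eigenspace_sum_of_diagonal:
  fixes X :: "complex \<Rightarrow> 'a::complex_banach set" and S :: "'a \<Rightarrow>\<^sub>L 'a"
  assumes C: "unconditional_bound C A X" and sub: "\<And>\<alpha>. \<alpha> \<in> A \<Longrightarrow> complex_vector.subspace (X \<alpha>)"
    and cl: "\<And>\<alpha>. \<alpha> \<in> A \<Longrightarrow> closed (X \<alpha>)" and dense: "closure (finite_sums X A) = UNIV"
    and S: "\<And>\<alpha> x. \<alpha> \<in> A \<Longrightarrow> x \<in> X \<alpha> \<Longrightarrow> blinfun_apply S x = g \<alpha> *\<^sub>C x"
    and fin: "finite {\<alpha> \<in> A. g \<alpha> = \<mu>}" and x: "blinfun_apply S x = \<mu> *\<^sub>C x"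
  obtains v where "\<forall>\<alpha>\<in>A. g \<alpha> = \<mu> \<longrightarrow> v \<alpha> \<in> X \<alpha>" "x = (\<Sum>\<alpha>\<in>{\<alpha> \<in> A. g \<alpha> = \<mu>}. v \<alpha>)"
proof -
  define G where "G = {\<alpha> \<in> A. g \<alpha> = \<mu>}"
  have G: "finite G" "G \<subseteq> A" using fin by (auto simp: G_def)
  have C0: "C > 0" using C by (simp add: unconditional_bound_def)
  obtain v where v: "\<forall>\<alpha>\<in>G. v \<alpha> \<in> X \<alpha>" "x - (\<Sum>\<alpha>\<in>G. v \<alpha>) \<in> closure (finite_sums X (A - G))"
    by (rule finite_part_decomposition[OF C sub cl dense G, of x])
  \<comment> \<open>The components \<open>v\<close> are fixed, while the approximating sum and its support \<open>H\<close> vary with \<open>e\<close>.\<close>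
  have key: "norm (x - (\<Sum>\<alpha>\<in>G. v \<alpha>)) \<le> (C + 1) * (C + 1) * e" if e: "e > 0" for e
  proof -
    have "x \<in> closure (finite_sums X A)" using dense by simp
    then obtain z where z: "z \<in> finite_sums X A" "dist z x < e" using e closure_approachable by blast
    obtain K y where K': "finite K" "K \<subseteq> A" "\<forall>\<alpha>\<in>K. y \<alpha> \<in> X \<alpha>"
        "\<forall>\<alpha>. \<alpha> \<notin> K \<longrightarrow> y \<alpha> = 0" "z = (\<Sum>\<alpha>\<in>K. y \<alpha>)"
      by (rule finite_sumsE[OF z(1)])
    note K = K'(1,2) K'(3)[rule_format] K'(4)[rule_format] K'(5)
    define H where "H = K \<union> G"
    have H: "finite H" "H \<subseteq> A" "G \<subseteq> H" using K G by (auto simp: H_def)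
    have zH: "z = (\<Sum>\<alpha>\<in>H. y \<alpha>)" unfolding K(5) by (rule sum.mono_neutral_left) (use K H in \<open>auto simp: H_def\<close>)
    have yX: "y \<alpha> \<in> X \<alpha>" if "\<alpha> \<in> A" for \<alpha>
      using K(3,4)[of \<alpha>] complex_vector.subspace_0[OF sub[OF that]] by (cases "\<alpha> \<in> K") auto
    obtain a where a: "\<forall>\<alpha>\<in>H. a \<alpha> \<in> X \<alpha>" "x - (\<Sum>\<alpha>\<in>H. a \<alpha>) \<in> closure (finite_sums X (A - H))"
      by (rule finite_part_decomposition[OF C sub cl dense H(1,2), of x])
    \<comment> \<open>\<open>S - \<mu>\<close> kills \<open>x\<close> and respects the decomposition, so the components outside \<open>G\<close> vanish.\<close>
    define w where "w = x - (\<Sum>\<alpha>\<in>H. a \<alpha>)"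
    have w: "w \<in> closure (finite_sums X (A - H))" using a(2) by (simp add: w_def)
    define N where "N = (\<lambda>u. blinfun_apply S u - \<mu> *\<^sub>C u)"
    have "N ` closure (finite_sums X (A - H)) \<subseteq> closure (finite_sums X (A - H))"
    proof (rule image_closure_subset)
      show "continuous_on (closure (finite_sums X (A - H))) N"
        unfolding N_def by (intro continuous_intros linear_continuous_on bounded_linear_scaleC)
      show "N ` finite_sums X (A - H) \<subseteq> closure (finite_sums X (A - H))"
      proof
        fix t assume "t \<in> N ` finite_sums X (A - H)"
        then obtain t' where t': "t = N t'" "t' \<in> finite_sums X (A - H)" by blast
        obtain M u where M': "finite M" "M \<subseteq> A - H" "\<forall>\<alpha>\<in>M. u \<alpha> \<in> X \<alpha>"
            "\<forall>\<alpha>. \<alpha> \<notin> M \<longrightarrow> u \<alpha> = 0" "t' = (\<Sum>\<alpha>\<in>M. u \<alpha>)"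
          by (rule finite_sumsE[OF t'(2)])
        note M = M'(1,2) M'(3)[rule_format] M'(4)[rule_format] M'(5)
        have "t = (\<Sum>\<alpha>\<in>M. blinfun_apply S (u \<alpha>) - \<mu> *\<^sub>C u \<alpha>)"
          unfolding t'(1) M(5) N_def by (simp add: blinfun.sum_right complex_vector.scale_sum_right sum_subtractf)
        also have "\<dots> = (\<Sum>\<alpha>\<in>M. (g \<alpha> - \<mu>) *\<^sub>C u \<alpha>)"
          by (rule sum.cong) (use M S in \<open>auto simp: scaleC_diff_left\<close>)
        also have "\<dots> \<in> finite_sums X (A - H)"
          by (intro finite_sumsI complex_vector.subspace_scale sub M) (use M in auto)
        finally show "t \<in> closure (finite_sums X (A - H))" using closure_subset by blast
      qed
    qed simp
    then have Nw: "N w \<in> closure (finite_sums X (A - H))" using w by blast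
    have "0 = N ((\<Sum>\<alpha>\<in>H. a \<alpha>) + w)" using x by (simp add: N_def w_def)
    also have "\<dots> = (\<Sum>\<alpha>\<in>H. blinfun_apply S (a \<alpha>) - \<mu> *\<^sub>C a \<alpha>) + N w"
      by (simp add: N_def blinfun.bilinear_simps blinfun.sum_right scaleC_add_right complex_vector.scale_sum_right sum_subtractf)
    also have "(\<Sum>\<alpha>\<in>H. blinfun_apply S (a \<alpha>) - \<mu> *\<^sub>C a \<alpha>) = (\<Sum>\<alpha>\<in>H. (g \<alpha> - \<mu>) *\<^sub>C a \<alpha>)"
      by (rule sum.cong) (use H a S in \<open>auto simp: scaleC_diff_left subset_iff\<close>)
    finally have zero: "(\<Sum>\<alpha>\<in>H. (g \<alpha> - \<mu>) *\<^sub>C a \<alpha>) + N w = 0" by simp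
    have a0: "a \<alpha> = 0" if \<alpha>: "\<alpha> \<in> H - G" for \<alpha>
    proof -
      have "norm (\<Sum>\<alpha>\<in>{\<alpha>}. (g \<alpha> - \<mu>) *\<^sub>C a \<alpha>) \<le> C * norm ((\<Sum>\<alpha>\<in>H. (g \<alpha> - \<mu>) *\<^sub>C a \<alpha>) + N w)"
        by (rule unconditional_bound_closure[OF C sub _ H(1,2) _ Nw])
           (use \<alpha> H(2) a(1) in \<open>auto intro!: complex_vector.subspace_scale sub\<close>)
      then have "(g \<alpha> - \<mu>) *\<^sub>C a \<alpha> = 0" unfolding zero by simp
      moreover have "g \<alpha> \<noteq> \<mu>" using \<alpha> H(2) by (auto simp: G_def)
      ultimately show ?thesis by simp
    qed
    have aG: "(\<Sum>\<alpha>\<in>H. a \<alpha>) = (\<Sum>\<alpha>\<in>G. a \<alpha>)"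
      by (rule sum.mono_neutral_right) (use H a0 in auto)
    have "norm (\<Sum>\<alpha>\<in>H. a \<alpha> - y \<alpha>) \<le> C * norm ((\<Sum>\<alpha>\<in>H. a \<alpha> - y \<alpha>) + w)"
      by (rule unconditional_bound_closure[OF C sub _ H(1,2) _ w])
         (use H(2) a(1) yX in \<open>auto intro!: complex_vector.subspace_diff sub\<close>)
    also have "(\<Sum>\<alpha>\<in>H. a \<alpha> - y \<alpha>) + w = x - z"
      unfolding zH w_def by (simp add: sum_subtractf)
    also have "C * norm (x - z) \<le> C * e"
      using z(2) C0 by (intro mult_left_mono) (auto simp: dist_norm norm_minus_commute)
    finally have "norm ((\<Sum>\<alpha>\<in>G. a \<alpha>) - z) \<le> C * e"
      unfolding zH by (simp add: sum_subtractf aG)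
    moreover have "norm (x - (\<Sum>\<alpha>\<in>G. a \<alpha>)) \<le> norm (x - z) + norm ((\<Sum>\<alpha>\<in>G. a \<alpha>) - z)"
      using norm_triangle_ineq4[of "x - z" "(\<Sum>\<alpha>\<in>G. a \<alpha>) - z"] by simp
    moreover have "norm (x - z) \<le> e" using z(2) by (simp add: dist_norm norm_minus_commute)
    ultimately have xa: "norm (x - (\<Sum>\<alpha>\<in>G. a \<alpha>)) \<le> (C + 1) * e" by (simp add: algebra_simps)
    have "norm (\<Sum>\<alpha>\<in>G. v \<alpha> - a \<alpha>) \<le> C * norm ((\<Sum>\<alpha>\<in>G. v \<alpha> - a \<alpha>) + (x - (\<Sum>\<alpha>\<in>G. v \<alpha>)))"
      by (rule unconditional_bound_closure[OF C sub _ G _ v(2)])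
         (use G(2) H(3) a(1) v(1) in \<open>auto intro!: complex_vector.subspace_diff sub\<close>)
    also have "(\<Sum>\<alpha>\<in>G. v \<alpha> - a \<alpha>) + (x - (\<Sum>\<alpha>\<in>G. v \<alpha>)) = x - (\<Sum>\<alpha>\<in>G. a \<alpha>)"
      by (simp add: sum_subtractf)
    also have "C * norm (x - (\<Sum>\<alpha>\<in>G. a \<alpha>)) \<le> C * ((C + 1) * e)" using xa C0 by (intro mult_left_mono) auto
    finally have "norm ((\<Sum>\<alpha>\<in>G. v \<alpha>) - (\<Sum>\<alpha>\<in>G. a \<alpha>)) \<le> C * ((C + 1) * e)" by (simp add: sum_subtractf)
    moreover have "norm (x - (\<Sum>\<alpha>\<in>G. v \<alpha>)) \<le> norm (x - (\<Sum>\<alpha>\<in>G. a \<alpha>)) + norm ((\<Sum>\<alpha>\<in>G. v \<alpha>) - (\<Sum>\<alpha>\<in>G. a \<alpha>))"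
      using norm_triangle_ineq4[of "x - (\<Sum>\<alpha>\<in>G. a \<alpha>)" "(\<Sum>\<alpha>\<in>G. v \<alpha>) - (\<Sum>\<alpha>\<in>G. a \<alpha>)"] by simp
    ultimately show ?thesis using xa by (simp add: algebra_simps)
  qed
  have "norm (x - (\<Sum>\<alpha>\<in>G. v \<alpha>)) \<le> 0"
  proof (rule field_le_epsilon)
    fix e :: real assume "e > 0"
    then have "e / ((C + 1) * (C + 1)) > 0" using C0 by (intro divide_pos_pos mult_pos_pos) auto
    from key[OF this] show "norm (x - (\<Sum>\<alpha>\<in>G. v \<alpha>)) \<le> 0 + e" using C0 by simp
  qed
  then have "x = (\<Sum>\<alpha>\<in>G. v \<alpha>)" by simp
  with v(1) show ?thesis by (intro that) (auto simp: G_def)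
qed

text \<open>
  Grouping the members of an unconditional basis into finite blocks, the fibres of \<open>g\<close>.
\<close>

lemma unconditional_basis_coarsen:
  assumes basis: "unconditional_basis A X"
    and fin: "\<And>\<beta>. \<beta> \<in> g ` A \<Longrightarrow> finite {\<alpha> \<in> A. g \<alpha> = \<beta>}"
    and sub: "\<And>\<beta>. \<beta> \<in> g ` A \<Longrightarrow> complex_vector.subspace (Y \<beta>)"
    and XY: "\<And>\<alpha>. \<alpha> \<in> A \<Longrightarrow> X \<alpha> \<subseteq> Y (g \<alpha>)"
    and dec: "\<And>\<beta> y. \<beta> \<in> g ` A \<Longrightarrow> y \<in> Y \<beta> \<Longrightarrow>
        \<exists>v. (\<forall>\<alpha>\<in>A. g \<alpha> = \<beta> \<longrightarrow> v \<alpha> \<in> X \<alpha>) \<and> y = (\<Sum>\<alpha>\<in>{\<alpha> \<in> A. g \<alpha> = \<beta>}. v \<alpha>)"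
  shows "unconditional_basis (g ` A) Y"
proof -
  have A: "countable A" "closure (complex_vector.span (\<Union>\<alpha>\<in>A. X \<alpha>)) = UNIV" "\<And>\<alpha>. \<alpha> \<in> A \<Longrightarrow> complex_vector.subspace (X \<alpha>)"
    using basis unfolding unconditional_basis_iff by blast+
  obtain C where C: "unconditional_bound C A X" using basis unfolding unconditional_basis_iff by blast
  have "complex_vector.span (\<Union>\<alpha>\<in>A. X \<alpha>) \<subseteq> complex_vector.span (\<Union>\<beta>\<in>g ` A. Y \<beta>)"
    by (rule complex_vector.span_mono) (use XY in blast)
  then have dense: "closure (complex_vector.span (\<Union>\<beta>\<in>g ` A. Y \<beta>)) = UNIV"
    using closure_mono A(2) by blast
  have "unconditional_bound C (g ` A) Y"
    unfolding unconditional_bound_def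
  proof (intro conjI allI impI)
    show "C > 0" using C by (simp add: unconditional_bound_def)
    fix F1 F2 y assume *: "F1 \<subseteq> F2 \<and> finite F2 \<and> F2 \<subseteq> g ` A \<and> (\<forall>\<beta>\<in>g ` A. y \<beta> \<in> Y \<beta>)"
    have "\<forall>\<beta>. \<exists>v. \<beta> \<in> F2 \<longrightarrow> (\<forall>\<alpha>\<in>A. g \<alpha> = \<beta> \<longrightarrow> v \<alpha> \<in> X \<alpha>) \<and> y \<beta> = (\<Sum>\<alpha>\<in>{\<alpha> \<in> A. g \<alpha> = \<beta>}. v \<alpha>)"
      using * dec by blast
    from choice[OF this] obtain v where v: "\<And>\<alpha>. \<alpha> \<in> A \<Longrightarrow> g \<alpha> \<in> F2 \<Longrightarrow> v (g \<alpha>) \<alpha> \<in> X \<alpha>"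
      "\<And>\<beta>. \<beta> \<in> F2 \<Longrightarrow> y \<beta> = (\<Sum>\<alpha>\<in>{\<alpha> \<in> A. g \<alpha> = \<beta>}. v \<beta> \<alpha>)" by blast
    define P where "P = (\<lambda>F. {\<alpha> \<in> A. g \<alpha> \<in> F})"
    have P: "P F = (\<Union>\<beta>\<in>F. {\<alpha> \<in> A. g \<alpha> = \<beta>})" for F by (auto simp: P_def)
    have fF: "finite F" "F \<subseteq> g ` A" if "F \<subseteq> F2" for F using * that finite_subset by blast+
    have finP: "finite (P F)" if "F \<subseteq> F2" for F
      unfolding P using fF[OF that] fin by (intro finite_UN_I) auto
    have sumP: "(\<Sum>\<beta>\<in>F. y \<beta>) = (\<Sum>\<alpha>\<in>P F. v (g \<alpha>) \<alpha>)" if F: "F \<subseteq> F2" for F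
    proof -
      have "(\<Sum>\<alpha>\<in>P F. v (g \<alpha>) \<alpha>) = (\<Sum>\<beta>\<in>F. \<Sum>\<alpha>\<in>{\<alpha> \<in> A. g \<alpha> = \<beta>}. v (g \<alpha>) \<alpha>)"
        unfolding P using fF[OF F] fin by (intro sum.UNION_disjoint) auto
      also have "\<dots> = (\<Sum>\<beta>\<in>F. y \<beta>)"
        using v(2) F by (intro sum.cong) (auto intro!: sum.cong)
      finally show ?thesis by simp
    qed
    have "norm (\<Sum>\<alpha>\<in>P F1. v (g \<alpha>) \<alpha>) \<le> C * norm (\<Sum>\<alpha>\<in>P F2. v (g \<alpha>) \<alpha>)"
      by (rule unconditional_boundD[OF C A(3)]) (use * finP v(1) in \<open>auto simp: P_def\<close>)
    then show "norm (\<Sum>\<beta>\<in>F1. y \<beta>) \<le> C * norm (\<Sum>\<beta>\<in>F2. y \<beta>)"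
      using sumP * by simp
  qed
  then show ?thesis unfolding unconditional_basis_iff using A(1) sub dense by blast
qed

section \<open>Bounded multipliers\<close>

lemma scaleC_scaleR: "c *\<^sub>C (r *\<^sub>R x) = r *\<^sub>R (c *\<^sub>C (x :: 'a::complex_normed_vector))"
  by (rule linear_cmul[OF bounded_linear.linear[OF bounded_linear_scaleC]])

text \<open>
  The coefficients \<open>0\<close> and \<open>1\<close> are covered by the definition; the estimate is convex in each coefficient,
  so it extends to coefficients in the unit interval, one coefficient at a time.
\<close>

lemma real_multiplier_bound:
  fixes Y :: "'i \<Rightarrow> 'b::complex_normed_vector set"
  assumes C: "unconditional_bound C B Y" "\<And>\<beta>. \<beta> \<in> B \<Longrightarrow> complex_vector.subspace (Y \<beta>)"
    and F: "finite F" "F \<subseteq> B" "\<And>\<beta>. \<beta> \<in> F \<Longrightarrow> y \<beta> \<in> Y \<beta>"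
    and m: "\<And>\<beta>. \<beta> \<in> F \<Longrightarrow> 0 \<le> m \<beta> \<and> m \<beta> \<le> 1"
  shows "norm (\<Sum>\<beta>\<in>F. m \<beta> *\<^sub>R y \<beta>) \<le> C * norm (\<Sum>\<beta>\<in>F. y \<beta>)"
proof -
  have "norm (\<Sum>\<beta>\<in>F. k \<beta> *\<^sub>R y \<beta>) \<le> C * norm (\<Sum>\<beta>\<in>F. y \<beta>)"
    if "finite S" "\<forall>\<beta>. 0 \<le> k \<beta> \<and> k \<beta> \<le> 1" "\<forall>\<beta>. \<beta> \<notin> S \<longrightarrow> k \<beta> = 0 \<or> k \<beta> = 1" for S k
    using that
  proof (induction S arbitrary: k rule: finite_induct)
    case empty
    have "(\<Sum>\<beta>\<in>F. k \<beta> *\<^sub>R y \<beta>) = (\<Sum>\<beta>\<in>{\<beta>\<in>F. k \<beta> = 1}. k \<beta> *\<^sub>R y \<beta>)"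
      by (rule sum.mono_neutral_right) (use F(1) empty in auto)
    also have "\<dots> = (\<Sum>\<beta>\<in>{\<beta>\<in>F. k \<beta> = 1}. y \<beta>)" by (rule sum.cong) auto
    finally show ?case
      using unconditional_boundD[OF C, of "{\<beta>\<in>F. k \<beta> = 1}" F y] F by simp
  next
    case (insert s S)
    define t where "t = k s"
    have t: "0 \<le> t" "t \<le> 1" using insert.prems by (auto simp: t_def)
    have k0: "norm (\<Sum>\<beta>\<in>F. (k(s := 0)) \<beta> *\<^sub>R y \<beta>) \<le> C * norm (\<Sum>\<beta>\<in>F. y \<beta>)"
      by (rule insert.IH) (use insert.prems in auto)
    have k1: "norm (\<Sum>\<beta>\<in>F. (k(s := 1)) \<beta> *\<^sub>R y \<beta>) \<le> C * norm (\<Sum>\<beta>\<in>F. y \<beta>)"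
      by (rule insert.IH) (use insert.prems in auto)
    have "(\<Sum>\<beta>\<in>F. k \<beta> *\<^sub>R y \<beta>) =
        (1 - t) *\<^sub>R (\<Sum>\<beta>\<in>F. (k(s := 0)) \<beta> *\<^sub>R y \<beta>) + t *\<^sub>R (\<Sum>\<beta>\<in>F. (k(s := 1)) \<beta> *\<^sub>R y \<beta>)"
      unfolding scaleR_sum_right sum.distrib[symmetric]
      by (rule sum.cong) (auto simp: t_def algebra_simps)
    moreover have "norm ((1 - t) *\<^sub>R u + t *\<^sub>R v) \<le> (1 - t) * norm u + t * norm v" for u v :: 'b
      using norm_triangle_ineq[of "(1 - t) *\<^sub>R u" "t *\<^sub>R v"] t by simp
    ultimately have "norm (\<Sum>\<beta>\<in>F. k \<beta> *\<^sub>R y \<beta>) \<le>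
        (1 - t) * norm (\<Sum>\<beta>\<in>F. (k(s := 0)) \<beta> *\<^sub>R y \<beta>) + t * norm (\<Sum>\<beta>\<in>F. (k(s := 1)) \<beta> *\<^sub>R y \<beta>)"
      by (simp only:)
    also have "\<dots> \<le> (1 - t) * (C * norm (\<Sum>\<beta>\<in>F. y \<beta>)) + t * (C * norm (\<Sum>\<beta>\<in>F. y \<beta>))"
      using t k0 k1 by (intro add_mono mult_left_mono) auto
    also have "\<dots> = C * norm (\<Sum>\<beta>\<in>F. y \<beta>)" by (simp add: algebra_simps)
    finally show ?case .
  qed
  from this[of F "\<lambda>\<beta>. if \<beta> \<in> F then m \<beta> else 0"] F(1) m
  have "norm (\<Sum>\<beta>\<in>F. (if \<beta> \<in> F then m \<beta> else 0) *\<^sub>R y \<beta>) \<le> C * norm (\<Sum>\<beta>\<in>F. y \<beta>)" by simp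
  also have "(\<Sum>\<beta>\<in>F. (if \<beta> \<in> F then m \<beta> else 0) *\<^sub>R y \<beta>) = (\<Sum>\<beta>\<in>F. m \<beta> *\<^sub>R y \<beta>)"
    by (rule sum.cong) auto
  finally show ?thesis .
qed

lemma complex_multiplier_bound:
  fixes Y :: "'i \<Rightarrow> 'b::complex_normed_vector set"
  assumes C: "unconditional_bound C B Y" "\<And>\<beta>. \<beta> \<in> B \<Longrightarrow> complex_vector.subspace (Y \<beta>)"
    and F: "finite F" "F \<subseteq> B" "\<And>\<beta>. \<beta> \<in> F \<Longrightarrow> y \<beta> \<in> Y \<beta>"
    and m: "\<And>\<beta>. \<beta> \<in> F \<Longrightarrow> cmod (m \<beta>) \<le> R" and R: "R > 0"
  shows "norm (\<Sum>\<beta>\<in>F. m \<beta> *\<^sub>C y \<beta>) \<le> 4 * C * R * norm (\<Sum>\<beta>\<in>F. y \<beta>)"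
proof -
  define N where "N = C * norm (\<Sum>\<beta>\<in>F. y \<beta>)"
  have part: "norm (\<Sum>\<beta>\<in>F. k \<beta> *\<^sub>R y \<beta>) \<le> 2 * R * N" if k: "\<And>\<beta>. \<beta> \<in> F \<Longrightarrow> \<bar>k \<beta>\<bar> \<le> R" for k
  proof -
    have pos: "norm (\<Sum>\<beta>\<in>F. (max 0 (s * k \<beta>) / R) *\<^sub>R y \<beta>) \<le> N" if s: "s = 1 \<or> s = -1" for s
      unfolding N_def
    proof (rule real_multiplier_bound[OF C F])
      fix \<beta> assume "\<beta> \<in> F"
      then have "\<bar>k \<beta>\<bar> \<le> R" by (rule k)
      then show "0 \<le> max 0 (s * k \<beta>) / R \<and> max 0 (s * k \<beta>) / R \<le> 1" using R s by auto
    qed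
    have "(\<Sum>\<beta>\<in>F. k \<beta> *\<^sub>R y \<beta>) =
        R *\<^sub>R (\<Sum>\<beta>\<in>F. (max 0 (1 * k \<beta>) / R) *\<^sub>R y \<beta>) - R *\<^sub>R (\<Sum>\<beta>\<in>F. (max 0 (- 1 * k \<beta>) / R) *\<^sub>R y \<beta>)"
      unfolding scaleR_sum_right sum_subtractf[symmetric]
      by (rule sum.cong) (use R in \<open>auto simp: max_def\<close>)
    moreover have "norm (R *\<^sub>R u - R *\<^sub>R v) \<le> R * norm u + R * norm v" for u v :: 'b
      using norm_triangle_ineq4[of "R *\<^sub>R u" "R *\<^sub>R v"] R by simp
    ultimately have "norm (\<Sum>\<beta>\<in>F. k \<beta> *\<^sub>R y \<beta>) \<le>
        R * norm (\<Sum>\<beta>\<in>F. (max 0 (1 * k \<beta>) / R) *\<^sub>R y \<beta>) + R * norm (\<Sum>\<beta>\<in>F. (max 0 (- 1 * k \<beta>) / R) *\<^sub>R y \<beta>)"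
      by (simp only:)
    also have "\<dots> \<le> R * N + R * N" using R by (intro add_mono mult_left_mono pos) auto
    finally show ?thesis by (simp add: mult_ac)
  qed
  have "(\<Sum>\<beta>\<in>F. m \<beta> *\<^sub>C y \<beta>) = (\<Sum>\<beta>\<in>F. Re (m \<beta>) *\<^sub>R y \<beta>) + \<i> *\<^sub>C (\<Sum>\<beta>\<in>F. Im (m \<beta>) *\<^sub>R y \<beta>)"
    unfolding complex_vector.scale_sum_right sum.distrib[symmetric]
    by (rule sum.cong[OF refl]) (simp only: scaleC_Re_Im[of "m _"] scaleC_scaleR)
  then have "norm (\<Sum>\<beta>\<in>F. m \<beta> *\<^sub>C y \<beta>) \<le> norm (\<Sum>\<beta>\<in>F. Re (m \<beta>) *\<^sub>R y \<beta>) + norm (\<Sum>\<beta>\<in>F. Im (m \<beta>) *\<^sub>R y \<beta>)"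
    using norm_triangle_ineq[of "\<Sum>\<beta>\<in>F. Re (m \<beta>) *\<^sub>R y \<beta>" "\<i> *\<^sub>C (\<Sum>\<beta>\<in>F. Im (m \<beta>) *\<^sub>R y \<beta>)"]
    by (simp add: norm_scaleC)
  also have "\<dots> \<le> 2 * R * N + 2 * R * N"
    using m abs_Re_le_cmod abs_Im_le_cmod by (intro add_mono part) (blast intro: order_trans)+
  finally show ?thesis by (simp add: N_def algebra_simps)
qed

text \<open>
  The function \<open>c\<close> acts boundedly on finite sums by multiplying the component in \<open>X \<alpha>\<close> by \<open>c \<alpha>\<close>.
\<close>

definition multiplier :: "real \<Rightarrow> 'i set \<Rightarrow> ('i \<Rightarrow> 'a::complex_normed_vector set) \<Rightarrow> ('i \<Rightarrow> complex) \<Rightarrow> bool"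
  where "multiplier K A X c \<longleftrightarrow> K \<ge> 0 \<and> (\<forall>F x. finite F \<and> F \<subseteq> A \<and> (\<forall>\<alpha>\<in>F. x \<alpha> \<in> X \<alpha>) \<longrightarrow>
     norm (\<Sum>\<alpha>\<in>F. c \<alpha> *\<^sub>C x \<alpha>) \<le> K * norm (\<Sum>\<alpha>\<in>F. x \<alpha>))"

lemma multiplierI:
  assumes "K \<ge> 0" "\<And>F x. finite F \<Longrightarrow> F \<subseteq> A \<Longrightarrow> \<forall>\<alpha>\<in>F. x \<alpha> \<in> X \<alpha> \<Longrightarrow>
    norm (\<Sum>\<alpha>\<in>F. c \<alpha> *\<^sub>C x \<alpha>) \<le> K * norm (\<Sum>\<alpha>\<in>F. x \<alpha>)"
  shows "multiplier K A X c"
  using assms unfolding multiplier_def by simp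

lemma multiplierD:
  assumes "multiplier K A X c" "finite F" "F \<subseteq> A" "\<forall>\<alpha>\<in>F. x \<alpha> \<in> X \<alpha>"
  shows "norm (\<Sum>\<alpha>\<in>F. c \<alpha> *\<^sub>C x \<alpha>) \<le> K * norm (\<Sum>\<alpha>\<in>F. x \<alpha>)"
  using assms unfolding multiplier_def by simp

lemma multiplier_nonneg: "multiplier K A X c \<Longrightarrow> K \<ge> 0"
  by (simp add: multiplier_def)

lemma multiplier_cong:
  assumes "multiplier K A X c" "\<And>\<alpha>. \<alpha> \<in> A \<Longrightarrow> c \<alpha> = d \<alpha>"
  shows "multiplier K A X d"
proof (rule multiplierI[OF multiplier_nonneg[OF assms(1)]])
  fix F x assume F: "finite F" "F \<subseteq> A" "\<forall>\<alpha>\<in>F. x \<alpha> \<in> X \<alpha>"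
  have "(\<Sum>\<alpha>\<in>F. d \<alpha> *\<^sub>C x \<alpha>) = (\<Sum>\<alpha>\<in>F. c \<alpha> *\<^sub>C x \<alpha>)"
    by (rule sum.cong) (use F assms(2) in auto)
  then show "norm (\<Sum>\<alpha>\<in>F. d \<alpha> *\<^sub>C x \<alpha>) \<le> K * norm (\<Sum>\<alpha>\<in>F. x \<alpha>)"
    using multiplierD[OF assms(1) F] by simp
qed

lemma multiplier_mult:
  assumes "multiplier K A X c" "multiplier L A X d" "\<And>\<alpha>. \<alpha> \<in> A \<Longrightarrow> complex_vector.subspace (X \<alpha>)"
  shows "multiplier (K * L) A X (\<lambda>\<alpha>. c \<alpha> * d \<alpha>)"
proof (rule multiplierI)
  show "K * L \<ge> 0" using assms(1,2) by (simp add: multiplier_nonneg)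
  fix F x assume F: "finite F" "F \<subseteq> A" "\<forall>\<alpha>\<in>F. x \<alpha> \<in> X \<alpha>"
  have "\<forall>\<alpha>\<in>F. d \<alpha> *\<^sub>C x \<alpha> \<in> X \<alpha>"
  proof
    fix \<alpha> assume "\<alpha> \<in> F"
    then show "d \<alpha> *\<^sub>C x \<alpha> \<in> X \<alpha>" using F assms(3)[of \<alpha>] by (intro complex_vector.subspace_scale) auto
  qed
  from multiplierD[OF assms(1) F(1,2) this]
  have "norm (\<Sum>\<alpha>\<in>F. c \<alpha> *\<^sub>C d \<alpha> *\<^sub>C x \<alpha>) \<le> K * norm (\<Sum>\<alpha>\<in>F. d \<alpha> *\<^sub>C x \<alpha>)" .
  also have "\<dots> \<le> K * (L * norm (\<Sum>\<alpha>\<in>F. x \<alpha>))"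
    by (intro mult_left_mono multiplierD[OF assms(2) F] multiplier_nonneg[OF assms(1)])
  finally show "norm (\<Sum>\<alpha>\<in>F. (c \<alpha> * d \<alpha>) *\<^sub>C x \<alpha>) \<le> K * L * norm (\<Sum>\<alpha>\<in>F. x \<alpha>)"
    by (simp add: scaleC_scaleC mult.assoc)
qed

lemma multiplier_add:
  assumes "multiplier K A X c" "multiplier L A X d"
  shows "multiplier (K + L) A X (\<lambda>\<alpha>. c \<alpha> + d \<alpha>)"
proof (rule multiplierI)
  show "K + L \<ge> 0" by (intro add_nonneg_nonneg multiplier_nonneg[OF assms(1)] multiplier_nonneg[OF assms(2)])
  fix F x assume F: "finite F" "F \<subseteq> A" "\<forall>\<alpha>\<in>F. x \<alpha> \<in> X \<alpha>"
  have "norm (\<Sum>\<alpha>\<in>F. (c \<alpha> + d \<alpha>) *\<^sub>C x \<alpha>) \<le> norm (\<Sum>\<alpha>\<in>F. c \<alpha> *\<^sub>C x \<alpha>) + norm (\<Sum>\<alpha>\<in>F. d \<alpha> *\<^sub>C x \<alpha>)"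
    by (simp add: scaleC_add_left sum.distrib norm_triangle_ineq)
  also have "\<dots> \<le> K * norm (\<Sum>\<alpha>\<in>F. x \<alpha>) + L * norm (\<Sum>\<alpha>\<in>F. x \<alpha>)"
    by (intro add_mono multiplierD[OF assms(1) F] multiplierD[OF assms(2) F])
  finally show "norm (\<Sum>\<alpha>\<in>F. (c \<alpha> + d \<alpha>) *\<^sub>C x \<alpha>) \<le> (K + L) * norm (\<Sum>\<alpha>\<in>F. x \<alpha>)"
    by (simp add: algebra_simps)
qed

lemma multiplier_one: "multiplier 1 A X (\<lambda>_. 1)"
  by (rule multiplierI) (simp_all add: scaleC_one)

lemma multiplier_prod:
  assumes "finite I" "\<And>k. k \<in> I \<Longrightarrow> \<exists>K. multiplier K A X (c k)" "\<And>\<alpha>. \<alpha> \<in> A \<Longrightarrow> complex_vector.subspace (X \<alpha>)"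
  shows "\<exists>K. multiplier K A X (\<lambda>\<alpha>. \<Prod>k\<in>I. c k \<alpha>)"
  using assms(1,2)
proof (induction I rule: finite_induct)
  case empty
  then show ?case using multiplier_one by auto
next
  case (insert k I)
  obtain K where K: "multiplier K A X (c k)" using insert.prems by blast
  obtain L where L: "multiplier L A X (\<lambda>\<alpha>. \<Prod>k\<in>I. c k \<alpha>)" using insert.IH insert.prems by blast
  from multiplier_mult[OF K L assms(3)] show ?case using insert.hyps by auto
qed

lemma multiplier_eigenvalue:
  assumes "\<And>\<alpha> x. \<alpha> \<in> A \<Longrightarrow> x \<in> X \<alpha> \<Longrightarrow> blinfun_apply T x = \<alpha> *\<^sub>C x"
  shows "multiplier (norm T) A X (\<lambda>\<alpha>. \<alpha>)"
proof (rule multiplierI)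
  fix F x assume F: "finite F" "F \<subseteq> A" "\<forall>\<alpha>\<in>F. x \<alpha> \<in> X \<alpha>"
  have "(\<Sum>\<alpha>\<in>F. \<alpha> *\<^sub>C x \<alpha>) = blinfun_apply T (\<Sum>\<alpha>\<in>F. x \<alpha>)"
    unfolding blinfun.sum_right by (rule sum.cong) (use F assms in \<open>auto simp: subset_iff\<close>)
  then show "norm (\<Sum>\<alpha>\<in>F. \<alpha> *\<^sub>C x \<alpha>) \<le> norm T * norm (\<Sum>\<alpha>\<in>F. x \<alpha>)"
    by (simp add: norm_blinfun)
qed simp

lemma multiplier_pullback:
  assumes C: "unconditional_bound C B Y" "\<And>\<beta>. \<beta> \<in> B \<Longrightarrow> complex_vector.subspace (Y \<beta>)"
    and g: "\<And>\<alpha>. \<alpha> \<in> A \<Longrightarrow> g \<alpha> \<in> B" "\<And>\<alpha>. \<alpha> \<in> A \<Longrightarrow> X \<alpha> \<subseteq> Y (g \<alpha>)"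
    and m: "\<And>\<beta>. \<beta> \<in> B \<Longrightarrow> cmod (m \<beta>) \<le> R" and R: "R > 0"
  shows "multiplier (4 * C * R) A X (\<lambda>\<alpha>. m (g \<alpha>))"
proof (rule multiplierI)
  show "4 * C * R \<ge> 0" using C(1) R by (simp add: unconditional_bound_def)
  fix F x assume F: "finite F" "F \<subseteq> A" "\<forall>\<alpha>\<in>F. x \<alpha> \<in> X \<alpha>"
  define y where "y = (\<lambda>\<beta>. \<Sum>\<alpha>\<in>{\<alpha>\<in>F. g \<alpha> = \<beta>}. x \<alpha>)"
  have "(\<Sum>\<alpha>\<in>F. m (g \<alpha>) *\<^sub>C x \<alpha>) = (\<Sum>\<beta>\<in>g ` F. \<Sum>\<alpha>\<in>{\<alpha>\<in>F. g \<alpha> = \<beta>}. m (g \<alpha>) *\<^sub>C x \<alpha>)"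
    using F(1) by (rule sum.image_gen)
  also have "\<dots> = (\<Sum>\<beta>\<in>g ` F. m \<beta> *\<^sub>C y \<beta>)"
    unfolding y_def complex_vector.scale_sum_right by (intro sum.cong) auto
  finally have 1: "(\<Sum>\<alpha>\<in>F. m (g \<alpha>) *\<^sub>C x \<alpha>) = (\<Sum>\<beta>\<in>g ` F. m \<beta> *\<^sub>C y \<beta>)" .
  have 2: "(\<Sum>\<alpha>\<in>F. x \<alpha>) = (\<Sum>\<beta>\<in>g ` F. y \<beta>)"
    unfolding y_def using F(1) by (rule sum.image_gen)
  show "norm (\<Sum>\<alpha>\<in>F. m (g \<alpha>) *\<^sub>C x \<alpha>) \<le> 4 * C * R * norm (\<Sum>\<alpha>\<in>F. x \<alpha>)"
    unfolding 1 2
  proof (rule complex_multiplier_bound[OF C _ _ _ _ R])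
    show gB: "g ` F \<subseteq> B" using F(2) g(1) by blast
    show "y \<beta> \<in> Y \<beta>" if "\<beta> \<in> g ` F" for \<beta>
      unfolding y_def
    proof (rule complex_vector.subspace_sum)
      show "complex_vector.subspace (Y \<beta>)" using C(2) gB that by blast
      fix \<alpha> assume "\<alpha> \<in> {\<alpha> \<in> F. g \<alpha> = \<beta>}"
      then show "x \<alpha> \<in> Y \<beta>" using F(2,3) g(2)[of \<alpha>] by auto
    qed
    show "cmod (m \<beta>) \<le> R" if "\<beta> \<in> g ` F" for \<beta> using gB that m by blast
  qed (use F in auto)
qed

text \<open>
  Splitting each member of an unconditional basis into eigenspaces of one operator \<open>T\<close>.  Here \<open>A\<close> is
  the set of eigenvalues, \<open>g \<alpha>\<close> is the index of the member that contains \<open>X \<alpha>\<close>, and \<open>q\<close> sorts the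
  eigenvalues into finitely many classes such that no two eigenvalues of one member share a class.
\<close>

lemma unconditional_bound_refine:
  fixes A :: "complex set" and T :: "'a::complex_normed_vector \<Rightarrow>\<^sub>L 'a"
  assumes C: "unconditional_bound C B Y" "\<And>\<beta>. \<beta> \<in> B \<Longrightarrow> complex_vector.subspace (Y \<beta>)"
    and X: "\<And>\<alpha>. \<alpha> \<in> A \<Longrightarrow> complex_vector.subspace (X \<alpha>)"
    and g: "\<And>\<alpha>. \<alpha> \<in> A \<Longrightarrow> g \<alpha> \<in> B" "\<And>\<alpha>. \<alpha> \<in> A \<Longrightarrow> X \<alpha> \<subseteq> Y (g \<alpha>)"
    and T: "\<And>\<alpha> x. \<alpha> \<in> A \<Longrightarrow> x \<in> X \<alpha> \<Longrightarrow> blinfun_apply T x = \<alpha> *\<^sub>C x"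
    and M: "\<And>\<alpha>. \<alpha> \<in> A \<Longrightarrow> cmod \<alpha> \<le> M"
    and \<delta>: "\<delta> > 0" "\<And>\<alpha> \<alpha>'. \<alpha> \<in> A \<Longrightarrow> \<alpha>' \<in> A \<Longrightarrow> g \<alpha> = g \<alpha>' \<Longrightarrow> \<alpha> \<noteq> \<alpha>' \<Longrightarrow> \<delta> \<le> dist \<alpha> \<alpha>'"
    and D: "finite D" "\<And>\<alpha>. \<alpha> \<in> A \<Longrightarrow> q \<alpha> \<in> D"
      "\<And>\<alpha> \<alpha>'. \<alpha> \<in> A \<Longrightarrow> \<alpha>' \<in> A \<Longrightarrow> g \<alpha> = g \<alpha>' \<Longrightarrow> q \<alpha> = q \<alpha>' \<Longrightarrow> \<alpha> = \<alpha>'"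
  shows "\<exists>K. unconditional_bound K A X"
proof -
  note pull = multiplier_pullback[OF C g]
  \<comment> \<open>\<open>L j \<beta>\<close> is the eigenvalue of class \<open>j\<close> in the member \<open>\<beta>\<close>, provided that \<open>ex j \<beta>\<close> holds.\<close>
  define L where "L = (\<lambda>j \<beta>. SOME \<alpha>. \<alpha> \<in> A \<and> q \<alpha> = j \<and> g \<alpha> = \<beta>)"
  define ex where "ex = (\<lambda>j \<beta>. \<exists>\<alpha>. \<alpha> \<in> A \<and> q \<alpha> = j \<and> g \<alpha> = \<beta>)"
  have L: "L j \<beta> \<in> A" "q (L j \<beta>) = j" "g (L j \<beta>) = \<beta>" if "ex j \<beta>" for j \<beta>
    using someI_ex[of "\<lambda>\<alpha>. \<alpha> \<in> A \<and> q \<alpha> = j \<and> g \<alpha> = \<beta>"] that unfolding L_def ex_def by blast+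
  have Lq: "ex (q \<alpha>) (g \<alpha>)" "L (q \<alpha>) (g \<alpha>) = \<alpha>" if "\<alpha> \<in> A" for \<alpha>
  proof -
    show "ex (q \<alpha>) (g \<alpha>)" using that unfolding ex_def by blast
    from L[OF this] show "L (q \<alpha>) (g \<alpha>) = \<alpha>" using that by (intro D(3)) auto
  qed
  define M' where "M' = max M 1"
  have indicator: "\<exists>K. multiplier K A X (\<lambda>\<alpha>. if q \<alpha> = j then 1 else 0)" for j
  proof -
    \<comment> \<open>With \<open>\<beta> = g \<alpha>\<close>, the Lagrange factor \<open>(\<alpha> - L k \<beta>) / (L j \<beta> - L k \<beta>)\<close> is written as \<open>a k \<beta> * \<alpha> + b k \<beta>\<close>;
      it is \<open>1\<close> when one of the two eigenvalues does not exist.\<close>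
    define a where "a = (\<lambda>k \<beta>. if ex j \<beta> \<and> ex k \<beta> then 1 / (L j \<beta> - L k \<beta>) else 0)"
    define b where "b = (\<lambda>k \<beta>. if ex j \<beta> \<and> ex k \<beta> then - L k \<beta> / (L j \<beta> - L k \<beta>) else 1)"
    define e where "e = (\<lambda>\<beta>. if ex j \<beta> then 1 else 0 :: complex)"
    have dist: "\<delta> \<le> cmod (L j \<beta> - L k \<beta>)" if "ex j \<beta>" "ex k \<beta>" "k \<noteq> j" for k \<beta>
    proof -
      have "L j \<beta> \<noteq> L k \<beta>" using L(2)[OF that(1)] L(2)[OF that(2)] that(3) by metis
      then show ?thesis
        using \<delta>(2)[OF L(1)[OF that(1)] L(1)[OF that(2)]] L(3)[OF that(1)] L(3)[OF that(2)]
        by (simp add: dist_norm)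
    qed
    have fac: "\<exists>K. multiplier K A X (\<lambda>\<alpha>. a k (g \<alpha>) * \<alpha> + b k (g \<alpha>))" if k: "k \<in> D - {j}" for k
    proof -
      have "multiplier (4 * C * (1 / \<delta>)) A X (\<lambda>\<alpha>. a k (g \<alpha>))"
      proof (rule pull)
        show "cmod (a k \<beta>) \<le> 1 / \<delta>" for \<beta>
          using dist[of \<beta> k] k \<delta>(1) by (auto simp: a_def norm_divide intro!: divide_left_mono mult_pos_pos)
      qed (use \<delta> in auto)
      moreover have "multiplier (4 * C * (M' / \<delta> + 1)) A X (\<lambda>\<alpha>. b k (g \<alpha>))"
      proof (rule pull)
        show "cmod (b k \<beta>) \<le> M' / \<delta> + 1" for \<beta>
        proof (cases "ex j \<beta> \<and> ex k \<beta>")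
          case True
          then have "cmod (L k \<beta>) \<le> M'" using M[OF L(1), of k \<beta>] by (simp add: M'_def)
          then have "cmod (b k \<beta>) \<le> M' / \<delta>"
            using dist[of \<beta> k] k \<delta>(1) True order_trans[OF norm_ge_zero]
            by (auto simp: b_def norm_divide intro!: frac_le)
          then show ?thesis by simp
        next
          case False
          then show ?thesis using \<delta>(1) by (auto simp: b_def M'_def)
        qed
        show "M' / \<delta> + 1 > 0" using \<delta>(1) by (auto simp: M'_def intro!: add_nonneg_pos divide_nonneg_pos)
      qed
      ultimately show ?thesis
        using multiplier_add multiplier_mult[OF _ multiplier_eigenvalue[of A X T, OF T] X] by blast
    qed
    have e: "multiplier (4 * C * 1) A X (\<lambda>\<alpha>. e (g \<alpha>))"
      by (rule pull) (auto simp: e_def)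
    have "finite (D - {j})" using D(1) by simp
    from multiplier_prod[of "D - {j}" A X "\<lambda>k \<alpha>. a k (g \<alpha>) * \<alpha> + b k (g \<alpha>)", OF this fac X]
    obtain K where K: "multiplier K A X (\<lambda>\<alpha>. \<Prod>k\<in>D - {j}. a k (g \<alpha>) * \<alpha> + b k (g \<alpha>))" by blast
    have "multiplier (4 * C * 1 * K) A X (\<lambda>\<alpha>. if q \<alpha> = j then 1 else 0)"
    proof (rule multiplier_cong[OF multiplier_mult[OF e K X]])
      fix \<alpha> assume \<alpha>: "\<alpha> \<in> A"
      show "e (g \<alpha>) * (\<Prod>k\<in>D - {j}. a k (g \<alpha>) * \<alpha> + b k (g \<alpha>)) = (if q \<alpha> = j then 1 else 0)"
      proof (cases "q \<alpha> = j")
        case True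
        have "a k (g \<alpha>) * \<alpha> + b k (g \<alpha>) = 1" if k: "k \<in> D - {j}" for k
        proof (cases "ex k (g \<alpha>)")
          case ex: True
          have "\<alpha> - L k (g \<alpha>) \<noteq> 0"
            using dist[of "g \<alpha>" k] ex Lq[OF \<alpha>] True k \<delta>(1) by auto
          then show ?thesis
            using ex Lq[OF \<alpha>] True by (simp add: a_def b_def diff_divide_distrib[symmetric])
        next
          case False
          then show ?thesis by (simp add: a_def b_def)
        qed
        then show ?thesis using True Lq(1)[OF \<alpha>] by (simp add: e_def)
      next
        case False
        show ?thesis
        proof (cases "ex j (g \<alpha>)")
          case True
          have "a (q \<alpha>) (g \<alpha>) * \<alpha> + b (q \<alpha>) (g \<alpha>) = 0"
            using True Lq[OF \<alpha>] by (simp add: a_def b_def)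
          moreover have "q \<alpha> \<in> D - {j}" using D(2)[OF \<alpha>] False by simp
          ultimately have "(\<Prod>k\<in>D - {j}. a k (g \<alpha>) * \<alpha> + b k (g \<alpha>)) = 0"
            using D(1) by (intro prod_zero) auto
          then show ?thesis using False by simp
        next
          case False
          then show ?thesis using \<open>q \<alpha> \<noteq> j\<close> by (simp add: e_def)
        qed
      qed
    qed
    then show ?thesis by blast
  qed
  then have "\<forall>j. \<exists>K. multiplier K A X (\<lambda>\<alpha>. if q \<alpha> = j then 1 else 0)" by (rule allI)
  from choice[OF this] obtain k' where "\<forall>j. multiplier (k' j) A X (\<lambda>\<alpha>. if q \<alpha> = j then 1 else 0)" ..
  then have k: "multiplier (k' j) A X (\<lambda>\<alpha>. if q \<alpha> = j then 1 else 0)" for j by (rule spec)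
  define K where "K = (\<Sum>j\<in>D. 4 * C * 1 * k' j) + 1"
  have "K > 0"
    unfolding K_def using C(1) multiplier_nonneg[OF k]
    by (intro add_nonneg_pos sum_nonneg mult_nonneg_nonneg) (auto simp: unconditional_bound_def)
  moreover have "norm (\<Sum>\<alpha>\<in>F1. x \<alpha>) \<le> K * norm (\<Sum>\<alpha>\<in>F2. x \<alpha>)"
    if F: "F1 \<subseteq> F2" "finite F2" "F2 \<subseteq> A" "\<forall>\<alpha>\<in>A. x \<alpha> \<in> X \<alpha>" for F1 F2 x
  proof -
    \<comment> \<open>Within one class, membership in \<open>F1\<close> depends on \<open>g \<alpha>\<close> only.\<close>
    define m where "m = (\<lambda>j \<beta>. if \<exists>\<alpha>\<in>F1. q \<alpha> = j \<and> g \<alpha> = \<beta> then 1 else 0 :: complex)"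
    have mult: "multiplier (4 * C * 1 * k' j) A X (\<lambda>\<alpha>. m j (g \<alpha>) * (if q \<alpha> = j then 1 else 0))" for j
      by (rule multiplier_mult[OF pull k X]) (auto simp: m_def)
    have split: "(if \<alpha> \<in> F1 then 1 else 0) = (\<Sum>j\<in>D. m j (g \<alpha>) * (if q \<alpha> = j then 1 else 0))" if \<alpha>: "\<alpha> \<in> F2" for \<alpha>
    proof -
      have \<alpha>A: "\<alpha> \<in> A" using \<alpha> F by blast
      have "(\<Sum>j\<in>D. m j (g \<alpha>) * (if q \<alpha> = j then 1 else 0)) = (\<Sum>j\<in>D. if q \<alpha> = j then m j (g \<alpha>) else 0)"
        by (rule sum.cong) auto
      also have "\<dots> = m (q \<alpha>) (g \<alpha>)" using D(1) D(2)[OF \<alpha>A] by simp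
      also have "\<dots> = (if \<alpha> \<in> F1 then 1 else 0)"
      proof -
        have "(\<exists>\<alpha>'\<in>F1. q \<alpha>' = q \<alpha> \<and> g \<alpha>' = g \<alpha>) \<longleftrightarrow> \<alpha> \<in> F1"
          using D(3)[OF _ \<alpha>A] F by blast
        then show ?thesis by (simp add: m_def)
      qed
      finally show ?thesis by simp
    qed
    have xF: "\<forall>\<alpha>\<in>F2. x \<alpha> \<in> X \<alpha>" using F by blast
    have "(\<Sum>\<alpha>\<in>F1. x \<alpha>) = (\<Sum>\<alpha>\<in>F2. (if \<alpha> \<in> F1 then 1 else 0) *\<^sub>C x \<alpha>)"
      by (rule sum.mono_neutral_cong_left) (use F in \<open>auto simp: scaleC_one\<close>)
    also have "\<dots> = (\<Sum>\<alpha>\<in>F2. \<Sum>j\<in>D. (m j (g \<alpha>) * (if q \<alpha> = j then 1 else 0)) *\<^sub>C x \<alpha>)"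
      by (rule sum.cong[OF refl]) (simp only: split complex_vector.scale_sum_left)
    also have "\<dots> = (\<Sum>j\<in>D. \<Sum>\<alpha>\<in>F2. (m j (g \<alpha>) * (if q \<alpha> = j then 1 else 0)) *\<^sub>C x \<alpha>)"
      by (rule sum.swap)
    finally have "norm (\<Sum>\<alpha>\<in>F1. x \<alpha>) \<le> (\<Sum>j\<in>D. norm (\<Sum>\<alpha>\<in>F2. (m j (g \<alpha>) * (if q \<alpha> = j then 1 else 0)) *\<^sub>C x \<alpha>))"
      by (simp only: norm_sum)
    also have "\<dots> \<le> (\<Sum>j\<in>D. 4 * C * 1 * k' j * norm (\<Sum>\<alpha>\<in>F2. x \<alpha>))"
      by (intro sum_mono multiplierD[OF mult F(2,3) xF])
    also have "\<dots> \<le> K * norm (\<Sum>\<alpha>\<in>F2. x \<alpha>)"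
      unfolding K_def sum_distrib_right[symmetric] by (intro mult_right_mono) auto
    finally show ?thesis .
  qed
  ultimately show ?thesis unfolding unconditional_bound_def by (intro exI[of _ K]) simp
qed

section \<open>Eigenspaces under the functional calculus\<close>

lemma subspace_eigenspace: "complex_linear_op T \<Longrightarrow> complex_vector.subspace (eigenspace T z)"
  by (rule complex_vector.subspaceI)
     (simp_all add: eigenspace_def blinfun.bilinear_simps scaleC_add_right complex_linear_opD scaleC_scaleC mult.commute)

lemma closed_eigenspace: "closed (eigenspace T z)"
  unfolding eigenspace_def
  by (intro closed_Collect_eq linear_continuous_on blinfun.bounded_linear_right bounded_linear_scaleC)

lemma point_spectrum_subset: "point_spectrum T \<subseteq> op_spectrum T"
proof
  fix z assume "z \<in> point_spectrum T"
  then obtain x where x: "blinfun_apply T x = z *\<^sub>C x" "x \<noteq> 0"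
    by (auto simp: point_spectrum_def eigenspace_def)
  show "z \<in> op_spectrum T"
  proof (rule ccontr)
    assume z: "z \<notin> op_spectrum T"
    have "blinfun_apply (resolvent T z) (blinfun_apply T x) = z *\<^sub>C blinfun_apply (resolvent T z) x"
      unfolding x(1) by (rule complex_linear_opD[OF resolvent_complex_linear[OF z]])
    then show False using resolvent_left[OF z, of x] x(2) by simp
  qed
qed

text \<open>
  Write \<open>f w = f z + (w - z) g w\<close> and use that \<open>g(T)\<close> commutes with \<open>T\<close>.
\<close>

lemma calculus_eigenvector:
  assumes adm: "admissible T \<Gamma> \<Omega>" and f: "f holomorphic_on \<Omega>" and z: "z \<in> \<Omega>"
    and x: "blinfun_apply T x = z *\<^sub>C x"
  shows "blinfun_apply (dunford_integral \<Gamma> f T) x = f z *\<^sub>C x"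
proof -
  define g where "g = (\<lambda>w. if w = z then deriv f z else (f w - f z) / (w - z))"
  have g: "g holomorphic_on \<Omega>"
    unfolding g_def by (rule pole_lemma_open[OF f admissibleD(2)[OF adm]])
  have h: "(\<lambda>w. f z * 1) holomorphic_on \<Omega>" "(\<lambda>w. (1 :: complex)) holomorphic_on \<Omega>"
      "(\<lambda>w. w * g w) holomorphic_on \<Omega>" "(\<lambda>w. (- z) * g w) holomorphic_on \<Omega>"
      "(\<lambda>w. w * g w + (- z) * g w) holomorphic_on \<Omega>"
    using g by (auto intro!: holomorphic_intros)
  have "blinfun_apply (dunford_integral \<Gamma> f T) x = blinfun_apply (dunford_integral \<Gamma> (\<lambda>w. f z * 1 + (w * g w + (- z) * g w)) T) x"
  proof (rule calculus_cong[OF adm f])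
    fix w
    show "f w = f z * 1 + (w * g w + (- z) * g w)"
    proof (cases "w = z")
      case False
      then have "(w - z) * g w = f w - f z" by (simp add: g_def)
      then show ?thesis by (simp add: algebra_simps)
    qed simp
  qed
  also have "\<dots> = f z *\<^sub>C x + (blinfun_apply T (blinfun_apply (dunford_integral \<Gamma> g T) x) + (- z) *\<^sub>C blinfun_apply (dunford_integral \<Gamma> g T) x)"
    unfolding calculus_add[OF adm h(1,5)] calculus_add[OF adm h(3,4)] calculus_cmult[OF adm h(2)] calculus_cmult[OF adm g]
      calculus_mult_var[OF adm g] calculus_one[OF adm] ..
  also have "blinfun_apply T (blinfun_apply (dunford_integral \<Gamma> g T) x) = z *\<^sub>C blinfun_apply (dunford_integral \<Gamma> g T) x"
    unfolding calculus_commute[OF adm g, symmetric] x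
    by (rule complex_linear_opD[OF calculus_complex_linear[OF adm g]])
  finally show ?thesis by (simp add: scaleC_minus_left)
qed

lemma finite_level_set:
  fixes f :: "complex \<Rightarrow> complex"
  assumes "compact K" "open \<Omega>" "K \<subseteq> \<Omega>" "f holomorphic_on \<Omega>"
    and nonconst: "\<And>U. U \<in> components \<Omega> \<Longrightarrow> \<not> f constant_on U"
  shows "finite {z \<in> K. f z = \<mu>}"
proof (rule ccontr)
  assume inf: "infinite {z \<in> K. f z = \<mu>}"
  have "\<exists>\<xi>\<in>K. \<xi> islimpt {z \<in> K. f z = \<mu>}"
    by (rule assms(1)[unfolded compact_eq_Bolzano_Weierstrass, rule_format]) (use inf in simp)
  then obtain \<xi> where \<xi>: "\<xi> \<in> K" "\<xi> islimpt {z \<in> K. f z = \<mu>}" ..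
  define U where "U = connected_component_set \<Omega> \<xi>"
  have \<xi>\<Omega>: "\<xi> \<in> \<Omega>" using \<xi> assms(3) by blast
  have U: "U \<in> components \<Omega>" "open U" "connected U" "\<xi> \<in> U" "U \<subseteq> \<Omega>"
    using \<xi>\<Omega> assms(2) by (auto simp: U_def componentsI open_connected_component connected_component_subset)
  have "\<xi> islimpt (U \<inter> {z \<in> K. f z = \<mu>})"
    unfolding islimpt_def
  proof (intro allI impI)
    fix V assume "\<xi> \<in> V" "open V"
    then have "\<xi> \<in> V \<inter> U" "open (V \<inter> U)" using U(2,4) by auto
    from islimptE[OF \<xi>(2) this]
    show "\<exists>y\<in>U \<inter> {z \<in> K. f z = \<mu>}. y \<in> V \<and> y \<noteq> \<xi>" by blast
  qed
  have "f z - \<mu> = 0" if "z \<in> U" for z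
  proof (rule analytic_continuation[of "\<lambda>z. f z - \<mu>" U "U \<inter> {z \<in> K. f z = \<mu>}" \<xi>])
    show "(\<lambda>z. f z - \<mu>) holomorphic_on U"
      by (intro holomorphic_intros holomorphic_on_subset[OF assms(4) U(5)])
  qed (use U that \<open>\<xi> islimpt (U \<inter> {z \<in> K. f z = \<mu>})\<close> in auto)
  then have "f constant_on U" unfolding constant_on_def by (intro exI[of _ \<mu>]) auto
  with nonconst U(1) show False by blast
qed

lemma factor_finite_zeros:
  fixes u :: "complex \<Rightarrow> complex"
  assumes "finite Z" "open \<Omega>" "u holomorphic_on \<Omega>" "\<forall>z\<in>Z. u z = 0"
  shows "\<exists>g. g holomorphic_on \<Omega> \<and> (\<forall>z. u z = (\<Prod>a\<in>Z. z - a) * g z)"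
  using assms(1,4)
proof (induction Z rule: finite_induct)
  case empty
  then show ?case using assms(3) by auto
next
  case (insert a Z)
  then obtain g where g: "g holomorphic_on \<Omega>" "\<And>z. u z = (\<Prod>b\<in>Z. z - b) * g z" by auto
  have "(\<Prod>b\<in>Z. a - b) \<noteq> 0" using insert.hyps by auto
  then have ga: "g a = 0" using g(2)[of a] insert.prems by simp
  define h where "h = (\<lambda>z. if z = a then deriv g a else (g z - g a) / (z - a))"
  have "h holomorphic_on \<Omega>" unfolding h_def by (rule pole_lemma_open[OF g(1) assms(2)])
  moreover have "g z = (z - a) * h z" for z using ga by (simp add: h_def)
  then have "u z = (\<Prod>b\<in>insert a Z. z - b) * h z" for z
    using g(2)[of z] insert.hyps by (simp add: mult_ac)
  ultimately show ?case by blast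
qed

text \<open>
  The kernel of a polynomial in \<open>T\<close> with simple zeros is the sum of the eigenspaces at the zeros.
\<close>

lemma kernel_of_product:
  assumes adm: "admissible T \<Gamma> \<Omega>"
  shows "finite Z \<Longrightarrow> blinfun_apply (dunford_integral \<Gamma> (\<lambda>z. \<Prod>a\<in>Z. z - a) T) x = 0 \<Longrightarrow>
    \<exists>v. (\<forall>a\<in>Z. v a \<in> eigenspace T a) \<and> x = (\<Sum>a\<in>Z. v a)"
proof (induction Z arbitrary: x rule: finite_induct)
  case empty
  then show ?case using calculus_one[OF adm, of x] by simp
next
  case (insert a Z)
  define p where "p = (\<lambda>z :: complex. \<Prod>b\<in>Z. z - b)"
  have p: "p holomorphic_on \<Omega>" "(\<lambda>z. z * p z) holomorphic_on \<Omega>" "(\<lambda>z. (- a) * p z) holomorphic_on \<Omega>"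
    unfolding p_def by (auto intro!: holomorphic_intros)
  let ?D = "\<lambda>f. blinfun_apply (dunford_integral \<Gamma> f T)"
  have T: "complex_linear_op T" by (rule admissibleD(1)[OF adm])
  define y where "y = blinfun_apply T x - a *\<^sub>C x"
  have "0 = ?D (\<lambda>z. z * p z + (- a) * p z) x"
    using insert by (simp add: p_def left_diff_distrib)
  also have "\<dots> = blinfun_apply T (?D p x) + (- a) *\<^sub>C ?D p x"
    unfolding calculus_add[OF adm p(2,3)] calculus_cmult[OF adm p(1)] calculus_mult_var[OF adm p(1)] ..
  also have "\<dots> = ?D p y"
    by (simp add: y_def blinfun.bilinear_simps scaleC_minus_left calculus_commute[OF adm p(1)]
        complex_linear_opD[OF calculus_complex_linear[OF adm p(1)]])
  finally have "?D (\<lambda>z. \<Prod>b\<in>Z. z - b) y = 0" by (simp add: p_def)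
  from insert.IH[OF this] obtain v where v: "\<forall>b\<in>Z. v b \<in> eigenspace T b" "y = (\<Sum>b\<in>Z. v b)" by blast
  define w where "w = (\<lambda>b. (1 / (b - a)) *\<^sub>C v b)"
  have w: "w b \<in> eigenspace T b" "blinfun_apply T (w b) - a *\<^sub>C w b = v b" if "b \<in> Z" for b
  proof -
    have ba: "b - a \<noteq> 0" using that insert.hyps by auto
    show wb: "w b \<in> eigenspace T b"
      unfolding w_def using v(1) that by (intro complex_vector.subspace_scale subspace_eigenspace[OF T]) auto
    have "blinfun_apply T (w b) - a *\<^sub>C w b = (b - a) *\<^sub>C w b"
      using wb by (simp add: eigenspace_def scaleC_diff_left)
    also have "\<dots> = v b" using ba by (simp add: w_def scaleC_scaleC scaleC_one)
    finally show "blinfun_apply T (w b) - a *\<^sub>C w b = v b" .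
  qed
  define r where "r = x - (\<Sum>b\<in>Z. w b)"
  have "blinfun_apply T r - a *\<^sub>C r = y - (\<Sum>b\<in>Z. blinfun_apply T (w b) - a *\<^sub>C w b)"
    by (simp add: r_def y_def blinfun.bilinear_simps blinfun.sum_right scaleC_diff_right complex_vector.scale_sum_right sum_subtractf)
  also have "\<dots> = 0" using w(2) by (simp add: v(2))
  finally have r: "r \<in> eigenspace T a" by (simp add: eigenspace_def)
  have "(\<Sum>b\<in>insert a Z. if b = a then r else w b) = r + (\<Sum>b\<in>Z. w b)"
    using insert.hyps by (auto intro!: sum.cong)
  then show ?case
    using r w(1) by (intro exI[of _ "\<lambda>b. if b = a then r else w b"]) (auto simp: r_def)
qed

text \<open>
  Simple zeros of \<open>f - \<mu>\<close> on the spectrum give \<open>f - \<mu> = p g\<close> with \<open>g\<close> free of zeros there.  As \<open>1/g\<close> is only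
  holomorphic on a smaller open set, a second cycle around the spectrum is used for it.
\<close>

lemma calculus_eigenspace_decomposition:
  assumes adm: "admissible T \<Gamma> \<Omega>" and f: "f holomorphic_on \<Omega>"
    and fin: "finite {z \<in> op_spectrum T. f z = \<mu>}"
    and deriv: "\<And>z. z \<in> op_spectrum T \<Longrightarrow> deriv f z \<noteq> 0"
    and x: "blinfun_apply (dunford_integral \<Gamma> f T) x = \<mu> *\<^sub>C x"
  shows "\<exists>v. (\<forall>a\<in>{z \<in> op_spectrum T. f z = \<mu>}. v a \<in> eigenspace T a) \<and> x = (\<Sum>a\<in>{z \<in> op_spectrum T. f z = \<mu>}. v a)"
proof -
  define Z where "Z = {z \<in> op_spectrum T. f z = \<mu>}"
  have Z: "finite Z" using fin by (simp add: Z_def)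
  have T: "complex_linear_op T" and \<Omega>: "open \<Omega>" and sub: "op_spectrum T \<subseteq> \<Omega>"
    by (rule admissibleD[OF adm])+
  have u: "(\<lambda>z. f z - \<mu>) holomorphic_on \<Omega>" using f by (intro holomorphic_intros)
  have "\<forall>z\<in>Z. f z - \<mu> = 0" by (simp add: Z_def)
  from factor_finite_zeros[OF Z \<Omega> u this]
  obtain g where g: "g holomorphic_on \<Omega>" "\<And>z. f z - \<mu> = (\<Prod>a\<in>Z. z - a) * g z" by blast
  have gnz: "g z \<noteq> 0" if z: "z \<in> op_spectrum T" for z
  proof
    assume gz: "g z = 0"
    then have "f z = \<mu>" using g(2)[of z] by simp
    then have zZ: "z \<in> Z" using z by (simp add: Z_def)
    define k where "k = (\<lambda>w. (\<Prod>a\<in>Z - {z}. w - a) * g w)"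
    have "k holomorphic_on \<Omega>" unfolding k_def using g(1) by (auto intro!: holomorphic_intros)
    then have "k field_differentiable (at z)"
      by (rule holomorphic_on_imp_differentiable_at[OF _ \<Omega>]) (use sub z in blast)
    then obtain d where d: "(k has_field_derivative d) (at z)"
      unfolding field_differentiable_def ..
    have "f w = \<mu> + (w - z) * k w" for w
    proof -
      have "(\<Prod>a\<in>Z. w - a) = (w - z) * (\<Prod>a\<in>Z - {z}. w - a)" by (rule prod.remove[OF Z zZ])
      moreover have "f w = \<mu> + (\<Prod>a\<in>Z. w - a) * g w" using g(2)[of w] by (simp add: diff_eq_eq add.commute)
      ultimately show ?thesis by (simp only: k_def mult.assoc)
    qed
    then have fk: "f = (\<lambda>w. \<mu> + (w - z) * k w)" by (rule ext)
    have "((\<lambda>w. \<mu> + (w - z) * k w) has_field_derivative k z) (at z)"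
      using d by (auto intro!: derivative_eq_intros)
    then have "(f has_field_derivative k z) (at z)" by (subst fk)
    then have "deriv f z = 0" using gz by (simp add: DERIV_imp_deriv k_def)
    with deriv[OF z] show False by simp
  qed
  define \<Omega>' where "\<Omega>' = {z \<in> \<Omega>. g z \<noteq> 0}"
  have "open (\<Omega> \<inter> g -` (- {0}))"
    using g(1) \<Omega> by (intro continuous_open_preimage holomorphic_on_imp_continuous_on) auto
  also have "\<Omega> \<inter> g -` (- {0}) = \<Omega>'" by (auto simp: \<Omega>'_def)
  finally have \<Omega>': "open \<Omega>'" .
  have sub': "op_spectrum T \<subseteq> \<Omega>'" using sub gnz by (auto simp: \<Omega>'_def)
  obtain \<Gamma>' where adm': "admissible T \<Gamma>' \<Omega>'" using admissible_exists[OF T \<Omega>' sub'] by blast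
  have "\<Omega>' \<subseteq> \<Omega>" by (auto simp: \<Omega>'_def)
  note adm2 = admissible_mono[OF adm' this \<Omega>]
  have hol': "g holomorphic_on \<Omega>'" "f holomorphic_on \<Omega>'"
    by (rule holomorphic_on_subset[OF g(1) \<open>\<Omega>' \<subseteq> \<Omega>\<close>], rule holomorphic_on_subset[OF f \<open>\<Omega>' \<subseteq> \<Omega>\<close>])
  have hol: "(\<lambda>z. 1 / g z) holomorphic_on \<Omega>'" "(\<lambda>z. f z + (- \<mu>) * 1) holomorphic_on \<Omega>'"
    "(\<lambda>z. (- \<mu>) * 1) holomorphic_on \<Omega>'" "(\<lambda>z. 1 :: complex) holomorphic_on \<Omega>'"
    using hol' by (auto intro!: holomorphic_intros simp: \<Omega>'_def)
  let ?D = "\<lambda>f. blinfun_apply (dunford_integral \<Gamma>' f T)"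
  have "?D (\<lambda>z. f z + (- \<mu>) * 1) x = ?D f x + (- \<mu>) *\<^sub>C x"
    unfolding calculus_add[OF adm' hol'(2) hol(3)] calculus_cmult[OF adm' hol(4)] calculus_one[OF adm'] ..
  also have "?D f x = \<mu> *\<^sub>C x"
    using calculus_independent[OF adm2 adm f] x by simp
  finally have zero: "?D (\<lambda>z. f z + (- \<mu>) * 1) x = 0" by (simp add: scaleC_minus_left)
  have "?D (\<lambda>z. \<Prod>a\<in>Z. z - a) x = ?D (\<lambda>z. 1 / g z * (f z + (- \<mu>) * 1)) x"
  proof (rule calculus_cong[OF adm'])
    show "(\<lambda>z. \<Prod>a\<in>Z. z - a) holomorphic_on \<Omega>'" by (auto intro!: holomorphic_intros)
    show "(\<Prod>a\<in>Z. z - a) = 1 / g z * (f z + (- \<mu>) * 1)" if "z \<in> \<Omega>'" for z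
      using g(2)[of z] that by (simp add: \<Omega>'_def)
  qed
  also have "\<dots> = 0" by (simp only: calculus_mult[OF adm' hol(1,2)] zero blinfun.zero_right)
  finally show ?thesis using kernel_of_product[OF adm' Z] by (simp only: Z_def)
qed

text \<open>
  A Lebesgue number of the cover of \<open>K\<close> by open sets on which \<open>f\<close> is injective.
\<close>

lemma separation_of_level_sets:
  fixes f :: "complex \<Rightarrow> complex"
  assumes "compact K" "open \<Omega>" "K \<subseteq> \<Omega>" "f holomorphic_on \<Omega>" "\<And>z. z \<in> K \<Longrightarrow> deriv f z \<noteq> 0"
  obtains \<delta> where "\<delta> > 0" "\<And>z w. z \<in> K \<Longrightarrow> w \<in> K \<Longrightarrow> f z = f w \<Longrightarrow> z \<noteq> w \<Longrightarrow> \<delta> \<le> dist z w"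
proof -
  define \<G> where "\<G> = {B. open B \<and> inj_on f B}"
  have cover: "K \<subseteq> \<Union>\<G>"
  proof
    fix z assume z: "z \<in> K"
    then have "z \<in> \<Omega>" using assms(3) by blast
    from has_complex_derivative_locally_injective[OF assms(4) this assms(2) assms(5)[OF z]]
    obtain r where "r > 0" "inj_on f (ball z r)" by blast
    then have "ball z r \<in> \<G>" "z \<in> ball z r" by (auto simp: \<G>_def)
    then show "z \<in> \<Union>\<G>" by blast
  qed
  have op: "open B" if "B \<in> \<G>" for B using that by (simp add: \<G>_def)
  have "\<exists>e>0. \<forall>x\<in>K. \<exists>G\<in>\<G>. ball x e \<subseteq> G"
    by (rule Heine_Borel_lemma[OF assms(1) cover op]) auto
  then obtain e where e: "e > 0" "\<forall>x\<in>K. \<exists>G\<in>\<G>. ball x e \<subseteq> G" by blast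
  show ?thesis
  proof (rule that[OF e(1)], rule ccontr)
    fix z w :: complex assume *: "z \<in> K" "w \<in> K" "f z = f w" "z \<noteq> w" "\<not> e \<le> dist z w"
    obtain G where G: "G \<in> \<G>" "ball z e \<subseteq> G" using e(2) *(1) by blast
    have "z \<in> ball z e" "w \<in> ball z e" using *(5) e(1) by simp_all
    then have "z \<in> G" "w \<in> G" using G(2) by blast+
    moreover have "inj_on f G" using G(1) by (simp add: \<G>_def)
    ultimately have "z = w" using *(3) by (simp add: inj_on_def)
    with *(4) show False ..
  qed
qed

theorem basis_calculus_forward:
  assumes adm: "admissible T \<Gamma> \<Omega>" and f: "f holomorphic_on \<Omega>"
    and nonconst: "\<And>U. U \<in> components \<Omega> \<Longrightarrow> \<not> f constant_on U"
    and basis: "eigenspaces_form_unconditional_basis T"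
  shows "eigenspaces_form_unconditional_basis (dunford_integral \<Gamma> f T)"
proof -
  let ?F = "dunford_integral \<Gamma> f T" and ?A = "point_spectrum T"
  have T: "complex_linear_op T" and \<Omega>: "open \<Omega>" and sub: "op_spectrum T \<subseteq> \<Omega>"
    by (rule admissibleD[OF adm])+
  have F: "complex_linear_op ?F" by (rule calculus_complex_linear[OF adm f])
  have A: "?A \<subseteq> op_spectrum T" by (rule point_spectrum_subset)
  have fin: "finite {\<alpha> \<in> ?A. f \<alpha> = \<mu>}" for \<mu>
    by (rule finite_subset[OF _ finite_level_set[OF compact_op_spectrum[OF T] \<Omega> sub f nonconst, of \<mu>]]) (use A in auto)
  have basis': "unconditional_basis ?A (eigenspace T)"
    using basis by (simp add: eigenspaces_form_unconditional_basis_def)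
  obtain C where C: "unconditional_bound C ?A (eigenspace T)"
    using basis' unfolding unconditional_basis_iff by blast
  have sT: "complex_vector.subspace (eigenspace T \<alpha>)" for \<alpha> by (rule subspace_eigenspace[OF T])
  have dense: "closure (finite_sums (eigenspace T) ?A) = UNIV"
    using basis' unfolding unconditional_basis_iff by (simp add: span_UN_eq_finite_sums sT)
  have eig: "blinfun_apply ?F x = f \<alpha> *\<^sub>C x" if "\<alpha> \<in> ?A" "x \<in> eigenspace T \<alpha>" for \<alpha> x
    by (rule calculus_eigenvector[OF adm f]) (use that A sub in \<open>auto simp: eigenspace_def\<close>)
  have dec: "\<exists>v. (\<forall>\<alpha>\<in>?A. f \<alpha> = \<mu> \<longrightarrow> v \<alpha> \<in> eigenspace T \<alpha>) \<and> x = (\<Sum>\<alpha>\<in>{\<alpha> \<in> ?A. f \<alpha> = \<mu>}. v \<alpha>)"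
    if "x \<in> eigenspace ?F \<mu>" for \<mu> x
  proof -
    have "blinfun_apply ?F x = \<mu> *\<^sub>C x" using that by (simp add: eigenspace_def)
    from eigenspace_sum_of_diagonal[OF C sT closed_eigenspace dense eig fin this]
    obtain v where "\<forall>\<alpha>\<in>?A. f \<alpha> = \<mu> \<longrightarrow> v \<alpha> \<in> eigenspace T \<alpha>" "x = (\<Sum>\<alpha>\<in>{\<alpha> \<in> ?A. f \<alpha> = \<mu>}. v \<alpha>)" .
    then show ?thesis by (intro exI[of _ v]) simp
  qed
  have incl: "eigenspace T \<alpha> \<subseteq> eigenspace ?F (f \<alpha>)" if "\<alpha> \<in> ?A" for \<alpha>
    using eig[OF that] by (auto simp: eigenspace_def)
  have "point_spectrum ?F = f ` ?A"
  proof
    show "f ` ?A \<subseteq> point_spectrum ?F"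
      using incl by (auto simp: point_spectrum_def)
    show "point_spectrum ?F \<subseteq> f ` ?A"
    proof
      fix \<mu> assume "\<mu> \<in> point_spectrum ?F"
      then obtain x where x: "x \<in> eigenspace ?F \<mu>" "x \<noteq> 0" by (auto simp: point_spectrum_def)
      obtain v where "x = (\<Sum>\<alpha>\<in>{\<alpha> \<in> ?A. f \<alpha> = \<mu>}. v \<alpha>)" using dec[OF x(1)] by blast
      then have "{\<alpha> \<in> ?A. f \<alpha> = \<mu>} \<noteq> {}" using x(2) by (metis sum.empty)
      then show "\<mu> \<in> f ` ?A" by blast
    qed
  qed
  moreover have "unconditional_basis (f ` ?A) (eigenspace ?F)"
    by (rule unconditional_basis_coarsen[OF basis' fin subspace_eigenspace[OF F] incl dec])
  ultimately show ?thesis by (simp add: eigenspaces_form_unconditional_basis_def)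
qed

theorem basis_calculus_backward:
  assumes adm: "admissible T \<Gamma> \<Omega>" and f: "f holomorphic_on \<Omega>"
    and nonconst: "\<And>U. U \<in> components \<Omega> \<Longrightarrow> \<not> f constant_on U"
    and deriv: "\<And>z. z \<in> op_spectrum T \<Longrightarrow> deriv f z \<noteq> 0"
    and basis: "eigenspaces_form_unconditional_basis (dunford_integral \<Gamma> f T)"
  shows "eigenspaces_form_unconditional_basis T"
proof -
  let ?F = "dunford_integral \<Gamma> f T" and ?A = "point_spectrum T"
  let ?B = "point_spectrum ?F"
  have T: "complex_linear_op T" and \<Omega>: "open \<Omega>" and sub: "op_spectrum T \<subseteq> \<Omega>"
    by (rule admissibleD[OF adm])+
  have K: "compact (op_spectrum T)" by (rule compact_op_spectrum[OF T])
  have F: "complex_linear_op ?F" by (rule calculus_complex_linear[OF adm f])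
  have A: "?A \<subseteq> op_spectrum T" by (rule point_spectrum_subset)
  have sT: "complex_vector.subspace (eigenspace T \<alpha>)" for \<alpha> by (rule subspace_eigenspace[OF T])
  have sF: "complex_vector.subspace (eigenspace ?F \<alpha>)" for \<alpha> by (rule subspace_eigenspace[OF F])
  have fin: "finite {z \<in> op_spectrum T. f z = \<mu>}" for \<mu>
    by (rule finite_level_set[OF K \<Omega> sub f nonconst])
  have B: "countable ?B" "closure (complex_vector.span (\<Union>\<beta>\<in>?B. eigenspace ?F \<beta>)) = UNIV"
    "\<exists>C. unconditional_bound C ?B (eigenspace ?F)"
    using basis unfolding eigenspaces_form_unconditional_basis_def unconditional_basis_iff by simp_all
  obtain C where C: "unconditional_bound C ?B (eigenspace ?F)" using B(3) ..
  have eig: "blinfun_apply ?F x = f \<alpha> *\<^sub>C x" if "\<alpha> \<in> ?A" "x \<in> eigenspace T \<alpha>" for \<alpha> x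
    by (rule calculus_eigenvector[OF adm f]) (use that A sub in \<open>auto simp: eigenspace_def\<close>)
  have incl: "eigenspace T \<alpha> \<subseteq> eigenspace ?F (f \<alpha>)" if "\<alpha> \<in> ?A" for \<alpha>
    using eig[OF that] by (auto simp: eigenspace_def)
  have fB: "f \<alpha> \<in> ?B" if \<alpha>: "\<alpha> \<in> ?A" for \<alpha>
  proof -
    obtain x where "x \<in> eigenspace T \<alpha>" "x \<noteq> 0" using \<alpha> by (auto simp: point_spectrum_def)
    then show ?thesis using incl[OF \<alpha>] by (auto simp: point_spectrum_def)
  qed
  have "?A \<subseteq> (\<Union>\<mu>\<in>?B. {z \<in> op_spectrum T. f z = \<mu>})" using fB A by auto
  then have countable: "countable ?A"
    by (rule countable_subset) (intro countable_UN B(1) countable_finite fin)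
  have "(\<Union>\<beta>\<in>?B. eigenspace ?F \<beta>) \<subseteq> complex_vector.span (\<Union>\<alpha>\<in>?A. eigenspace T \<alpha>)"
  proof
    fix x assume "x \<in> (\<Union>\<beta>\<in>?B. eigenspace ?F \<beta>)"
    then obtain \<mu> where "blinfun_apply ?F x = \<mu> *\<^sub>C x" by (auto simp: eigenspace_def)
    from calculus_eigenspace_decomposition[OF adm f fin deriv this]
    obtain v where v: "\<forall>a\<in>{z \<in> op_spectrum T. f z = \<mu>}. v a \<in> eigenspace T a"
        "x = (\<Sum>a\<in>{z \<in> op_spectrum T. f z = \<mu>}. v a)" by blast
    show "x \<in> complex_vector.span (\<Union>\<alpha>\<in>?A. eigenspace T \<alpha>)"
      unfolding v(2)
    proof (rule complex_vector.span_sum)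
      fix a assume a: "a \<in> {z \<in> op_spectrum T. f z = \<mu>}"
      show "v a \<in> complex_vector.span (\<Union>\<alpha>\<in>?A. eigenspace T \<alpha>)"
      proof (cases "v a = 0")
        case True
        then show ?thesis by (simp add: complex_vector.span_zero)
      next
        case False
        then have "a \<in> ?A" using v(1) a unfolding point_spectrum_def by blast
        then show ?thesis using v(1) a by (intro complex_vector.span_base) blast
      qed
    qed
  qed
  then have "complex_vector.span (\<Union>\<beta>\<in>?B. eigenspace ?F \<beta>) \<subseteq> complex_vector.span (\<Union>\<alpha>\<in>?A. eigenspace T \<alpha>)"
    by (rule complex_vector.span_minimal) (rule complex_vector.subspace_span)
  then have dense: "closure (complex_vector.span (\<Union>\<alpha>\<in>?A. eigenspace T \<alpha>)) = UNIV"
    using closure_mono B(2) by blast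
  obtain \<delta> where \<delta>: "\<delta> > 0" "\<And>z w. z \<in> op_spectrum T \<Longrightarrow> w \<in> op_spectrum T \<Longrightarrow> f z = f w \<Longrightarrow> z \<noteq> w \<Longrightarrow> \<delta> \<le> dist z w"
    using separation_of_level_sets[OF K \<Omega> sub f deriv] by blast
  obtain M where M: "\<And>z. z \<in> op_spectrum T \<Longrightarrow> cmod z \<le> M"
    using compact_imp_bounded[OF K] by (auto simp: bounded_iff)
  obtain D where D: "finite D" "op_spectrum T \<subseteq> (\<Union>d\<in>D. ball d (\<delta> / 2))"
    using K \<delta>(1) unfolding compact_eq_totally_bounded by (meson half_gt_zero)
  \<comment> \<open>The classes are given by balls of radius \<open>\<delta> / 2\<close>, on each of which \<open>f\<close> is injective as far as
    eigenvalues are concerned.\<close>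
  define q where "q = (\<lambda>z. SOME d. d \<in> D \<and> dist d z < \<delta> / 2)"
  have q: "q z \<in> D \<and> dist (q z) z < \<delta> / 2" if "z \<in> ?A" for z
    unfolding q_def
  proof (rule someI_ex)
    have "z \<in> (\<Union>d\<in>D. ball d (\<delta> / 2))" using that A D(2) by blast
    then show "\<exists>d. d \<in> D \<and> dist d z < \<delta> / 2" by (simp only: UN_iff mem_ball Bex_def)
  qed
  have "\<exists>K. unconditional_bound K ?A (eigenspace T)"
  proof (rule unconditional_bound_refine[where g = f and q = q and T = T and D = D and \<delta> = \<delta> and M = M, OF C sF sT fB incl])
    show "blinfun_apply T x = \<alpha> *\<^sub>C x" if "x \<in> eigenspace T \<alpha>" for \<alpha> x using that by (simp add: eigenspace_def)
    show "cmod \<alpha> \<le> M" if "\<alpha> \<in> ?A" for \<alpha> using that A M by blast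
    show "\<delta> \<le> dist \<alpha> \<alpha>'" if "\<alpha> \<in> ?A" "\<alpha>' \<in> ?A" "f \<alpha> = f \<alpha>'" "\<alpha> \<noteq> \<alpha>'" for \<alpha> \<alpha>'
      using that A \<delta>(2) by blast
    show "q \<alpha> \<in> D" if "\<alpha> \<in> ?A" for \<alpha> using q[OF that] by blast
    show "\<alpha> = \<alpha>'" if "\<alpha> \<in> ?A" "\<alpha>' \<in> ?A" "f \<alpha> = f \<alpha>'" "q \<alpha> = q \<alpha>'" for \<alpha> \<alpha>'
    proof (rule ccontr)
      assume "\<alpha> \<noteq> \<alpha>'"
      then have "\<delta> \<le> dist \<alpha> \<alpha>'" using that A \<delta>(2) by blast
      moreover have "dist \<alpha> \<alpha>' < \<delta>"
        by (rule dist_triangle_half_r[of "q \<alpha>"]) (use q[OF that(1)] q[OF that(2)] that(4) in auto)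
      ultimately show False by simp
    qed
  qed (use \<delta>(1) D(1) in auto)
  then show ?thesis
    unfolding eigenspaces_form_unconditional_basis_def unconditional_basis_iff
    using countable sT dense by simp
qed

theorem theorem4p4:
  fixes T :: "'a::complex_banach \<Rightarrow>\<^sub>L 'a"
    and \<Omega> :: "complex set"
    and f :: "complex \<Rightarrow> complex"
  assumes "separable_space (euclidean :: 'a topology)"
    and "complex_linear_op T"
    and "open \<Omega>" and "bounded \<Omega>" and "op_spectrum T \<subseteq> \<Omega>"
    and "f holomorphic_on \<Omega>"
    and "\<And>U. U \<in> components \<Omega> \<Longrightarrow> \<not> f constant_on U"
  shows "(eigenspaces_form_unconditional_basis T \<longrightarrow>
            eigenspaces_form_unconditional_basis (riesz_dunford \<Omega> f T)) \<and>
         ((\<forall>z \<in> op_spectrum T. deriv f z \<noteq> 0) \<and>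
            eigenspaces_form_unconditional_basis (riesz_dunford \<Omega> f T) \<longrightarrow>
          eigenspaces_form_unconditional_basis T)"
proof -
  obtain \<Gamma> where \<Gamma>: "admissible T \<Gamma> \<Omega>" "\<And>f. riesz_dunford \<Omega> f T = dunford_integral \<Gamma> f T"
    using riesz_dunford_admissible[OF assms(2,3,5)] by blast
  show ?thesis
    unfolding \<Gamma>(2)
    using basis_calculus_forward[OF \<Gamma>(1) assms(6,7)] basis_calculus_backward[OF \<Gamma>(1) assms(6,7)] by blast
qed

end
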